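(* Let $\mathbb{P}=\{\sigma_1,\sigma_2,\dots,\sigma_s\}$ be a simplicial complement (a sequence of subsets of $[m]$), and let $K_{\mathbb{P}}$ be the corresponding simplicial complex, so that $\mathcal{I}_{K_{\mathbb{P}}}=\mathcal{I}_{\mathbb{P}}$. Let $(\Lambda^{*,*}[\mathbb{P}],d)$ be the chain complex induced from the bigraded exterior algebra on $\mathbb{P}$, i.e. $(\Lambda^{*,*}[\mathbb{P}],d)=\big((\Lambda^{*,*}[\mathbb{P}]\otimes_{\mathbf{k}}\mathbf{k}[\mathbf{x}])\otimes_{\mathbf{k}[\mathbf{x}]}\mathbf{k},\ \widetilde d\otimes 1\big)$. Then the differential $d:\Lambda^{q,*}[\mathbb{P}]\to\Lambda^{q-1,*}[\mathbb{P}]$ is given on generators $\mathbf{u}$ by $$d(\mathbf{u})=\sum_i(-1)^i\,\partial_i(\mathbf{u})\cdot\delta_{\partial_i(\mathbf{u})},$$ where $\delta_{\partial_i(\mathbf{u})}=1$ if $S_{\mathbf{u}}=S_{\partial_i(\mathbf{u})}$ and $\delta_{\partial_i(\mathbf{u})}=0$ if $S_{\mathbf{u}}\neq S_{\partial_i(\mathbf{u})}$, and for every $\sigma\subset[m]$ the homology of $(\Lambda^{*,*}[\mathbb{P}],d)$ is $$H_{*,\sigma}(\Lambda^{*,*}[\mathbb{P}],d)=\mathrm{Tor}^{\mathbf{k}[\mathbf{x}]}_{*,\sigma}(\mathbf{k}[\mathbf{x}]/\mathcal{I}_{\mathbb{P}},\mathbf{k})=\mathrm{Tor}^{\mathbf{k}[\mathbf{x}]}_{*,\sigma}(\mathbf{k}(K_{\mathbb{P}}),\mathbf{k}).$$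 (Equality means isomorphism of $\mathbf{k}$-modules.)
   Context: $\mathbf{k}$ is a principal ideal domain, $[m]=\{1,\dots,m\}$, $\mathbf{k}[\mathbf{x}]=\mathbf{k}[x_1,\dots,x_m]$ with its $\mathbb{N}^m$-grading, and $\mathbf{k}$ is a $\mathbf{k}[\mathbf{x}]$-module with every $x_i$ acting as $0$. For $\sigma=\{i_1,\dots,i_n\}\subset[m]$ put $\mathbf{x}_\sigma=x_{i_1}\cdots x_{i_n}$, with $\mathbf{x}_\emptyset=1$. A simplicial complement is a (finite) sequence $\mathbb{P}=\{\sigma_1,\dots,\sigma_s\}$ of subsets of $[m]$; $\mathcal{I}_{\mathbb{P}}=\langle\mathbf{x}_{\sigma_1},\dots,\mathbf{x}_{\sigma_s}\rangle\subset\mathbf{k}[\mathbf{x}]$. $K_{\mathbb{P}}$ is the abstract simplicial complex on $[m]$ whose non-faces are exactly the $\sigma\subset[m]$ containing some $\sigma_i$ (it is void if some $\sigma_i=\emptyset$). For a simplicial complex $K$ on $[m]$, $\mathcal{I}_K=\langle\mathbf{x}_\sigma:\sigma\notin K\rangle$ and $\mathbf{k}(K)=\mathbf{k}[\mathbf{x}]/\mathcal{I}_K$ is the Stanley–Reisner face ring. $\Lambda[\mathbb{P}]$ is the exterior algebra over $\mathbf{k}$ on the formal generators $\sigma_1,\dots,\sigma_s$ (distinct generators even if some of the subsets coincide). Its $\mathbf{k}$-module generators are $\mathbf{u}=\sigma_{k_1}\sigma_{k_2}\cdots\sigma_{k_q}$, $k_1<\dots<k_q$ (including $1$ for $q=0$).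 The total subset is $S_{\mathbf{u}}=\sigma_{k_1}\cup\dots\cup\sigma_{k_q}$, $S_1=\emptyset$; the bidegree of $\mathbf{u}$ is $(q,S_{\mathbf{u}})\in\mathbb{N}\times 2^{[m]}$, and $\Lambda^{q,\sigma}[\mathbb{P}]$ is spanned by the generators of bidegree $(q,\sigma)$. Put $\partial_i(\mathbf{u})=\sigma_{k_1}\cdots\widehat{\sigma}_{k_i}\cdots\sigma_{k_q}$. The Taylor complex is the free $\mathbf{k}[\mathbf{x}]$-module $\Lambda^{*,*}[\mathbb{P}]\otimes_{\mathbf{k}}\mathbf{k}[\mathbf{x}]$ with $\mathbf{k}[\mathbf{x}]$-linear differential $\widetilde d(\mathbf{u}\otimes\mathbf{x}^{\mathbf{a}})=\sum_{i=1}^q(-1)^i\partial_i(\mathbf{u})\otimes\mathbf{x}_{S_{\mathbf{u}}\setminus S_{\partial_i(\mathbf{u})}}\mathbf{x}^{\mathbf{a}}$. $H_{q,\sigma}(\Lambda^{*,*}[\mathbb{P}],d)$ is the homology in bidegree $(q,\sigma)$, and $\mathrm{Tor}_{q,\sigma}$ is the component of $\mathrm{Tor}_q$ of $\mathbb{N}^m$-degree $\mathbf{a}_\sigma$, where $\mathbf{x}^{\mathbf{a}_\sigma}=\mathbf{x}_\sigma$. $H_{*,*}(\Lambda^{*,*}[\mathbb{P}],d)$ is called the homology of the simplicial complement $\mathbb{P}$. *)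

theory Defs
  imports "HOL-Algebra.Algebra" "HOL-Algebra.Algebraic_Closure_Type" "HOL-Library.Poly_Mapping"
begin

section \<open>The ground ring and the polynomial ring\<close>

text \<open>
  The ground ring is the whole type \<open>'k\<close>, seen as a ring record via
  \<^const>\<open>ring_of_type_algebra\<close>. An exponent vector is a finitely supported function
  \<open>nat \<Rightarrow>\<^sub>0 nat\<close>, and a polynomial is a finitely supported function from exponent vectors to
  coefficients (the monoid algebra of \<^theory>\<open>HOL-Library.Poly_Mapping\<close>). The variables are
  indexed by \<open>{1..m}\<close>.
\<close>

type_synonym expo = "nat \<Rightarrow>\<^sub>0 nat"
type_synonym 'k mpoly = "expo \<Rightarrow>\<^sub>0 'k"

abbreviation base_ring :: "'k::comm_ring_1 ring" where
  "base_ring \<equiv> ring_of_type_algebra"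

definition mpoly_ring :: "nat \<Rightarrow> 'k::comm_ring_1 mpoly ring" where
  "mpoly_ring m = ring_of_type_algebra
     \<lparr>carrier := {p. \<forall>t \<in> Poly_Mapping.keys p. Poly_Mapping.keys t \<subseteq> {1..m}}\<rparr>"

definition set_expo :: "nat set \<Rightarrow> expo" where
  "set_expo \<sigma> = (\<Sum>i\<in>\<sigma>. Poly_Mapping.single i 1)"

definition set_monom :: "nat set \<Rightarrow> 'k::comm_ring_1 mpoly" where
  "set_monom \<sigma> = Poly_Mapping.single (set_expo \<sigma>) 1"


section \<open>Modules\<close>

text \<open>
  The fields \<^const>\<open>monoid.mult\<close> and \<^const>\<open>one\<close>, which the module record of HOL-Algebra inherits
  from rings, play no role for modules.
\<close>

definition mod_hom ::
  "('r, 's) ring_scheme \<Rightarrow> ('r, 'a, 'u) module_scheme \<Rightarrow> ('r, 'b, 'v) module_scheme \<Rightarrow> ('a \<Rightarrow> 'b) set"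
  where "mod_hom R M N = {f. f \<in> carrier M \<rightarrow> carrier N
     \<and> (\<forall>x\<in>carrier M. \<forall>y\<in>carrier M. f (x \<oplus>\<^bsub>M\<^esub> y) = f x \<oplus>\<^bsub>N\<^esub> f y)
     \<and> (\<forall>r\<in>carrier R. \<forall>x\<in>carrier M. f (r \<odot>\<^bsub>M\<^esub> x) = r \<odot>\<^bsub>N\<^esub> f x)}"

definition module_iso ::
  "('r, 's) ring_scheme \<Rightarrow> ('r, 'a, 'u) module_scheme \<Rightarrow> ('r, 'b, 'v) module_scheme \<Rightarrow> ('a \<Rightarrow> 'b) set"
  where "module_iso R M N = {f \<in> mod_hom R M N. bij_betw f (carrier M) (carrier N)}"

definition module_isomorphic ::
  "('r, 's) ring_scheme \<Rightarrow> ('r, 'a, 'u) module_scheme \<Rightarrow> ('r, 'b, 'v) module_scheme \<Rightarrow> bool"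
  where "module_isomorphic R M N \<longleftrightarrow> module_iso R M N \<noteq> {}"

definition quotient_module ::
  "('r, 'a, 'u) module_scheme \<Rightarrow> 'a set \<Rightarrow> ('r, 'a set) module"
  where "quotient_module M N =
    \<lparr>carrier = a_rcosets\<^bsub>M\<^esub> N, monoid.mult = undefined, one = undefined, ring.zero = N, add = set_add M,
     module.smult = (\<lambda>r C. \<Union>x\<in>C. N +>\<^bsub>M\<^esub> (r \<odot>\<^bsub>M\<^esub> x))\<rparr>"

text \<open>
  A graded module carries its homogeneous components: \<open>gr M d\<close> is the component of degree \<open>d\<close>.
\<close>

record ('r, 'a, 'd) graded_module = "('r, 'a) module" +
  gr :: "'d \<Rightarrow> 'a set"

definition with_grading :: "('r, 'a) module \<Rightarrow> ('d \<Rightarrow> 'a set) \<Rightarrow> ('r, 'a, 'd) graded_module" where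
  "with_grading M g = module.extend M (graded_module.fields g)"

definition restrict_scalars ::
  "('s \<Rightarrow> 'r) \<Rightarrow> ('r, 'a, 'd) graded_module \<Rightarrow> ('s, 'a, 'd) graded_module" where
  "restrict_scalars h M =
    \<lparr>carrier = carrier M, monoid.mult = monoid.mult M, one = one M, ring.zero = ring.zero M, add = add M,
     module.smult = (\<lambda>c x. h c \<odot>\<^bsub>M\<^esub> x), gr = gr M\<rparr>"

abbreviation over_base :: "('k::comm_ring_1 mpoly, 'a, 'd) graded_module \<Rightarrow> ('k, 'a, 'd) graded_module"
  where "over_base \<equiv> restrict_scalars (Poly_Mapping.single 0)"


section \<open>Free modules\<close>

text \<open>
  Free modules consist of finitely supported functions on the basis. \<open>R\<close> is always a subring of
  the type \<open>'r\<close>, so the operations can be taken from the type and only the carrier of \<open>R\<close> is used.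
\<close>

definition pm_scale :: "'r::comm_ring_1 \<Rightarrow> ('b \<Rightarrow>\<^sub>0 'r) \<Rightarrow> ('b \<Rightarrow>\<^sub>0 'r)" where
  "pm_scale r f = Poly_Mapping.map ((*) r) f"

definition lin_ext :: "('b \<Rightarrow> ('c \<Rightarrow>\<^sub>0 'r)) \<Rightarrow> ('b \<Rightarrow>\<^sub>0 'r::comm_ring_1) \<Rightarrow> ('c \<Rightarrow>\<^sub>0 'r)" where
  "lin_ext g f = (\<Sum>b\<in>Poly_Mapping.keys f. pm_scale (Poly_Mapping.lookup f b) (g b))"

definition free_module :: "'r::comm_ring_1 ring \<Rightarrow> 'b set \<Rightarrow> ('r, 'b \<Rightarrow>\<^sub>0 'r) module" where
  "free_module R B =
    \<lparr>carrier = {f. Poly_Mapping.keys f \<subseteq> B \<and> (\<forall>b. Poly_Mapping.lookup f b \<in> carrier R)},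
     monoid.mult = undefined, one = undefined, ring.zero = 0, add = (+), module.smult = pm_scale\<rparr>"

text \<open>
  The free \<open>k[x]\<close>-module on a bigraded basis: a basis element \<open>b\<close> with \<open>dg b = (q, a)\<close> has
  homological degree \<open>q\<close> and internal degree \<open>a\<close>.
\<close>

definition graded_free_module ::
  "nat \<Rightarrow> 'b set \<Rightarrow> ('b \<Rightarrow> nat \<times> expo)
     \<Rightarrow> ('k::comm_ring_1 mpoly, 'b \<Rightarrow>\<^sub>0 'k mpoly, nat \<times> expo) graded_module" where
  "graded_free_module m B dg = with_grading (free_module (mpoly_ring m) B)
     (\<lambda>(q, a). {f \<in> carrier (free_module (mpoly_ring m) B). \<forall>b\<in>Poly_Mapping.keys f.
        fst (dg b) = q \<and> (\<forall>t\<in>Poly_Mapping.keys (Poly_Mapping.lookup f b). t + snd (dg b) = a)})"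


section \<open>Tensor products\<close>

text \<open>
  \<open>M \<otimes>\<^sub>R N\<close> is the free module on \<open>M \<times> N\<close> modulo the submodule generated by the bilinearity
  relations.
\<close>

definition tensor_relations ::
  "'r::comm_ring_1 ring \<Rightarrow> ('r, 'a, 'u) module_scheme \<Rightarrow> ('r, 'b, 'v) module_scheme
     \<Rightarrow> ('a \<times> 'b \<Rightarrow>\<^sub>0 'r) set" where
  "tensor_relations R M N =
     {Poly_Mapping.single (x \<oplus>\<^bsub>M\<^esub> x', y) 1 - Poly_Mapping.single (x, y) 1 - Poly_Mapping.single (x', y) 1
        | x x' y. x \<in> carrier M \<and> x' \<in> carrier M \<and> y \<in> carrier N}
   \<union> {Poly_Mapping.single (x, y \<oplus>\<^bsub>N\<^esub> y') 1 - Poly_Mapping.single (x, y) 1 - Poly_Mapping.single (x, y') 1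
        | x y y'. x \<in> carrier M \<and> y \<in> carrier N \<and> y' \<in> carrier N}
   \<union> {Poly_Mapping.single (r \<odot>\<^bsub>M\<^esub> x, y) 1 - Poly_Mapping.single (x, y) r
        | r x y. r \<in> carrier R \<and> x \<in> carrier M \<and> y \<in> carrier N}
   \<union> {Poly_Mapping.single (x, r \<odot>\<^bsub>N\<^esub> y) 1 - Poly_Mapping.single (x, y) r
        | r x y. r \<in> carrier R \<and> x \<in> carrier M \<and> y \<in> carrier N}"

definition tensor_kernel ::
  "'r::comm_ring_1 ring \<Rightarrow> ('r, 'a, 'u) module_scheme \<Rightarrow> ('r, 'b, 'v) module_scheme
     \<Rightarrow> ('a \<times> 'b \<Rightarrow>\<^sub>0 'r) set" where
  "tensor_kernel R M N =
     \<Inter>{S. submodule S R (free_module R (carrier M \<times> carrier N)) \<and> tensor_relations R M N \<subseteq> S}"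

definition tensor_module ::
  "'r::comm_ring_1 ring \<Rightarrow> ('r, 'a, 'u) module_scheme \<Rightarrow> ('r, 'b, 'v) module_scheme
     \<Rightarrow> ('r, ('a \<times> 'b \<Rightarrow>\<^sub>0 'r) set) module" where
  "tensor_module R M N =
     quotient_module (free_module R (carrier M \<times> carrier N)) (tensor_kernel R M N)"

definition tensor_elt ::
  "'r::comm_ring_1 ring \<Rightarrow> ('r, 'a, 'u) module_scheme \<Rightarrow> ('r, 'b, 'v) module_scheme
     \<Rightarrow> 'a \<Rightarrow> 'b \<Rightarrow> ('a \<times> 'b \<Rightarrow>\<^sub>0 'r) set" where
  "tensor_elt R M N x y =
     tensor_kernel R M N +>\<^bsub>free_module R (carrier M \<times> carrier N)\<^esub> Poly_Mapping.single (x, y) 1"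

text \<open>The map \<open>f \<otimes> 1\<close> on \<open>M \<otimes>\<^sub>R N\<close> induced by an endomorphism \<open>f\<close> of \<open>M\<close>.\<close>

definition tensor_map ::
  "'r::comm_ring_1 ring \<Rightarrow> ('r, 'a, 'u) module_scheme \<Rightarrow> ('r, 'b, 'v) module_scheme
     \<Rightarrow> ('a \<Rightarrow> 'a) \<Rightarrow> ('a \<times> 'b \<Rightarrow>\<^sub>0 'r) set \<Rightarrow> ('a \<times> 'b \<Rightarrow>\<^sub>0 'r) set" where
  "tensor_map R M N f C =
     (\<Union>z\<in>C. tensor_kernel R M N +>\<^bsub>free_module R (carrier M \<times> carrier N)\<^esub>
        lin_ext (\<lambda>(x, y). Poly_Mapping.single (f x, y) 1) z)"

text \<open>
  Tensor product of a graded complex of \<open>\<nat>\<^sup>m\<close>-graded \<open>k[x]\<close>-modules with a graded module: the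
  component of degree \<open>(q, a)\<close> is spanned by the \<open>x \<otimes> y\<close> with \<open>x\<close>, \<open>y\<close> homogeneous of degrees
  \<open>(q, b)\<close>, \<open>c\<close> and \<open>b + c = a\<close>.
\<close>

definition graded_tensor ::
  "nat \<Rightarrow> ('k::comm_ring_1 mpoly, 'a, nat \<times> expo) graded_module
     \<Rightarrow> ('k mpoly, 'b, expo) graded_module
     \<Rightarrow> ('k mpoly, ('a \<times> 'b \<Rightarrow>\<^sub>0 'k mpoly) set, nat \<times> expo) graded_module" where
  "graded_tensor m M N = with_grading (tensor_module (mpoly_ring m) M N)
     (\<lambda>(q, a). generate (add_monoid (tensor_module (mpoly_ring m) M N))
        {tensor_elt (mpoly_ring m) M N x y | x y b c. x \<in> gr M (q, b) \<and> y \<in> gr N c \<and> b + c = a})"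


section \<open>Homology\<close>

text \<open>
  A complex is the direct sum of all its terms together with an endomorphism \<open>d\<close> that maps the
  component of degree \<open>(q + 1, a)\<close> into that of degree \<open>(q, a)\<close> and vanishes on those of degree
  \<open>(0, a)\<close>.
\<close>

definition homology ::
  "('r, 'a, nat \<times> 'd) graded_module \<Rightarrow> ('a \<Rightarrow> 'a) \<Rightarrow> nat \<Rightarrow> 'd \<Rightarrow> ('r, 'a set) module" where
  "homology M d q a =
     quotient_module (M\<lparr>carrier := {x \<in> gr M (q, a). d x = \<zero>\<^bsub>M\<^esub>}\<rparr>) (d ` gr M (Suc q, a))"


section \<open>The standard graded free resolution and Tor\<close>

text \<open>
  The basis in homological degree \<open>0\<close> has an element \<open>Gen a x\<close> for every homogeneous \<open>x\<close> of degree
  \<open>a\<close> in \<open>M\<close>, mapped to \<open>x\<close> by the augmentation. The basis in degree \<open>n + 1\<close> has an element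
  \<open>Syz (n + 1) a L\<close> for every expression \<open>L\<close> of a homogeneous cycle of degree \<open>a\<close> as a combination
  of basis elements in degree \<open>n\<close> (for \<open>n = 0\<close>: of an element of the kernel of the augmentation),
  mapped to that cycle by the differential.
\<close>

datatype ('r, 'a) cell = Gen expo 'a | Syz nat expo "('r \<times> ('r, 'a) cell) list"

fun cell_deg :: "('r, 'a) cell \<Rightarrow> nat \<times> expo" where
  "cell_deg (Gen a x) = (0, a)"
| "cell_deg (Syz n a L) = (n, a)"

definition lincomb :: "('r::comm_ring_1 \<times> 'b) list \<Rightarrow> ('b \<Rightarrow>\<^sub>0 'r)" where
  "lincomb L = (\<Sum>(p, b)\<leftarrow>L. Poly_Mapping.single b p)"

fun cell_boundary :: "('r::comm_ring_1, 'a) cell \<Rightarrow> (('r, 'a) cell \<Rightarrow>\<^sub>0 'r)" where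
  "cell_boundary (Gen a x) = 0"
| "cell_boundary (Syz n a L) = lincomb L"

definition std_diff :: "(('r::comm_ring_1, 'a) cell \<Rightarrow>\<^sub>0 'r) \<Rightarrow> (('r, 'a) cell \<Rightarrow>\<^sub>0 'r)" where
  "std_diff = lin_ext cell_boundary"

fun gen_value :: "('r, 'a) cell \<Rightarrow> 'a" where
  "gen_value (Gen a x) = x"
| "gen_value (Syz n a L) = undefined"

definition std_aug ::
  "('r::comm_ring_1, 'a, 'u) module_scheme \<Rightarrow> (('r, 'a) cell \<Rightarrow>\<^sub>0 'r) \<Rightarrow> 'a" where
  "std_aug M f = (\<Oplus>\<^bsub>M\<^esub>b\<in>Poly_Mapping.keys f. Poly_Mapping.lookup f b \<odot>\<^bsub>M\<^esub> gen_value b)"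

inductive_set std_basis ::
  "nat \<Rightarrow> ('k::comm_ring_1 mpoly, 'a, expo) graded_module \<Rightarrow> ('k mpoly, 'a) cell set"
  for m :: nat and M :: "('k mpoly, 'a, expo) graded_module" where
  Gen: "x \<in> gr M a \<Longrightarrow> Gen a x \<in> std_basis m M"
| Syz: "\<lbrakk> \<forall>(p, b)\<in>set L. b \<in> std_basis m M \<and> fst (cell_deg b) = n \<and> p \<in> carrier (mpoly_ring m)
             \<and> (\<forall>t\<in>Poly_Mapping.keys p. t + snd (cell_deg b) = a);
          if n = 0 then std_aug M (lincomb L) = \<zero>\<^bsub>M\<^esub> else std_diff (lincomb L) = 0 \<rbrakk>
        \<Longrightarrow> Syz (Suc n) a L \<in> std_basis m M"

definition std_resolution ::
  "nat \<Rightarrow> ('k::comm_ring_1 mpoly, 'a, expo) graded_module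
     \<Rightarrow> ('k mpoly, ('k mpoly, 'a) cell \<Rightarrow>\<^sub>0 'k mpoly, nat \<times> expo) graded_module" where
  "std_resolution m M = graded_free_module m (std_basis m M) cell_deg"

text \<open>
  The following lemmas show that this is a graded free resolution of \<open>M\<close>: it is a complex augmented
  to \<open>M\<close> (\<open>std_diff_std_diff\<close>, \<open>std_aug_std_diff\<close>), every homogeneous cycle in the augmented complex
  is a boundary (\<open>std_resolution_exact\<close>), and the augmentation is onto (\<open>std_aug_surj\<close>).
\<close>

lemma lookup_pm_scale: "Poly_Mapping.lookup (pm_scale r f) x = r * Poly_Mapping.lookup f x"
  unfolding pm_scale_def by (simp add: Poly_Mapping.map.rep_eq when_def)

lemma pm_scale_simps [simp]:
  "pm_scale 0 f = 0" "pm_scale r 0 = 0" "pm_scale 1 f = f"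
  "pm_scale r (Poly_Mapping.single b s) = Poly_Mapping.single b (r * s)"
  by (rule poly_mapping_eqI; simp add: lookup_pm_scale lookup_single when_def)+

lemma pm_scale_add: "pm_scale (r + s) f = pm_scale r f + pm_scale s f"
  by (rule poly_mapping_eqI) (simp add: lookup_pm_scale lookup_add distrib_right)

lemma pm_scale_assoc: "pm_scale r (pm_scale s f) = pm_scale (r * s) f"
  by (rule poly_mapping_eqI) (simp add: lookup_pm_scale mult.assoc)

lemma lin_ext_superset:
  assumes "finite B" "Poly_Mapping.keys f \<subseteq> B"
  shows "lin_ext g f = (\<Sum>b\<in>B. pm_scale (Poly_Mapping.lookup f b) (g b))"
  unfolding lin_ext_def using assms
  by (intro sum.mono_neutral_left) (auto simp: in_keys_iff)

lemma lin_ext_single [simp]: "lin_ext g (Poly_Mapping.single b r) = pm_scale r (g b)"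
  by (subst lin_ext_superset[of "{b}"]) auto

lemma lin_ext_zero [simp]: "lin_ext g 0 = 0"
  by (simp add: lin_ext_def)

lemma lin_ext_add: "lin_ext g (f + h) = lin_ext g f + lin_ext g h"
proof -
  let ?B = "Poly_Mapping.keys f \<union> Poly_Mapping.keys h"
  have "Poly_Mapping.keys (f + h) \<subseteq> ?B" by (rule Poly_Mapping.keys_add)
  then show ?thesis
    by (simp add: lin_ext_superset[of ?B] lookup_add pm_scale_add sum.distrib)
qed

lemma lin_ext_sum: "lin_ext g (\<Sum>i\<in>I. f i) = (\<Sum>i\<in>I. lin_ext g (f i))"
  by (induction I rule: infinite_finite_induct) (auto simp: lin_ext_add)

lemma lin_ext_scale: "lin_ext g (pm_scale r f) = pm_scale r (lin_ext g f)"
proof -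
  have "lin_ext g (pm_scale r f)
      = (\<Sum>b\<in>Poly_Mapping.keys f. pm_scale r (pm_scale (Poly_Mapping.lookup f b) (g b)))"
    by (subst lin_ext_superset[of "Poly_Mapping.keys f"])
      (auto simp: in_keys_iff lookup_pm_scale pm_scale_assoc)
  also have "\<dots> = pm_scale r (lin_ext g f)"
    by (rule poly_mapping_eqI) (simp add: lookup_pm_scale lin_ext_def lookup_sum sum_distrib_left)
  finally show ?thesis .
qed

lemma std_diff_std_diff:
  assumes "Poly_Mapping.keys z \<subseteq> std_basis m M"
  shows "std_diff (std_diff z) = 0"
proof -
  have Gen0: "std_diff (lincomb L) = 0"
    if "\<forall>(p, b)\<in>set L. b \<in> std_basis m M \<and> fst (cell_deg b) = 0" for L
  proof -
    have "cell_boundary b = 0" if "b \<in> std_basis m M" "fst (cell_deg b) = 0" for b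
      using that by (cases rule: std_basis.cases) auto
    then show ?thesis using that
      by (induction L) (auto simp: lincomb_def std_diff_def lin_ext_add)
  qed
  have "std_diff (cell_boundary b) = 0" if "b \<in> std_basis m M" for b
    using that
  proof (cases rule: std_basis.cases)
    case (Syz L n a)
    show ?thesis
    proof (cases "n = 0")
      case True
      then show ?thesis using Syz by (auto intro!: Gen0)
    qed (use Syz in auto)
  qed (simp add: std_diff_def)
  then show ?thesis using assms
    by (auto simp: std_diff_def lin_ext_def[of _ z] lin_ext_sum lin_ext_scale intro!: sum.neutral)
qed

lemma gr_graded_free_module:
  "gr (graded_free_module m B dg) (q, a) =
     {f. Poly_Mapping.keys f \<subseteq> B \<and> (\<forall>b. Poly_Mapping.lookup f b \<in> carrier (mpoly_ring m)) \<and>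
       (\<forall>b\<in>Poly_Mapping.keys f. fst (dg b) = q \<and>
          (\<forall>t\<in>Poly_Mapping.keys (Poly_Mapping.lookup f b). t + snd (dg b) = a))}"
  by (auto simp: graded_free_module_def with_grading_def module.defs graded_module.defs
      free_module_def)

lemma single_in_gr_graded_free_module:
  assumes "b \<in> B" "dg b = (q, a)"
  shows "Poly_Mapping.single b 1 \<in> gr (graded_free_module m B dg) (q, a)"
  using assms by (auto simp: gr_graded_free_module lookup_single when_def mpoly_ring_def)

lemma std_resolution_exact:
  assumes z: "z \<in> gr (std_resolution m M) (q, a)"
    and cycle: "if q = 0 then std_aug M z = \<zero>\<^bsub>M\<^esub> else std_diff z = 0"
  shows "z \<in> std_diff ` gr (std_resolution m M) (Suc q, a)"
proof -
  obtain bs where bs: "set bs = Poly_Mapping.keys z" "distinct bs"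
    using finite_distinct_list[OF finite_keys] by metis
  define L where "L = map (\<lambda>b. (Poly_Mapping.lookup z b, b)) bs"
  have "lincomb L = (\<Sum>b\<in>Poly_Mapping.keys z. Poly_Mapping.single b (Poly_Mapping.lookup z b))"
    using bs by (simp add: lincomb_def L_def comp_def sum_list_distinct_conv_sum_set)
  also have "\<dots> = z"
    by (rule poly_mapping_eqI)
      (auto simp: lookup_sum lookup_single when_def in_keys_iff sum.delta)
  finally have L: "lincomb L = z" .
  have "Syz (Suc q) a L \<in> std_basis m M"
    using z bs cycle
    by (intro std_basis.Syz) (auto simp: L, auto simp: L_def std_resolution_def gr_graded_free_module)
  then have "Poly_Mapping.single (Syz (Suc q) a L) 1 \<in> gr (std_resolution m M) (Suc q, a)"
    unfolding std_resolution_def by (rule single_in_gr_graded_free_module) simp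
  moreover have "std_diff (Poly_Mapping.single (Syz (Suc q) a L) 1) = z"
    by (simp add: std_diff_def L)
  ultimately show ?thesis by (metis imageI)
qed

lemma std_aug_surj:
  assumes M: "module (mpoly_ring m) M" and x: "x \<in> gr M a" "gr M a \<subseteq> carrier M"
  shows "x \<in> std_aug M ` gr (std_resolution m M) (0, a)"
proof -
  interpret module "mpoly_ring m" M by fact
  have "std_aug M (Poly_Mapping.single (Gen a x) 1) = x"
    using x smult_one[of x] by (auto simp: std_aug_def mpoly_ring_def ring_of_type_algebra_def)
  moreover have "Poly_Mapping.single (Gen a x) 1 \<in> gr (std_resolution m M) (0, a)"
    unfolding std_resolution_def using x
    by (intro single_in_gr_graded_free_module) (auto intro: std_basis.Gen)
  ultimately show ?thesis by (metis imageI)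
qed

lemma mpoly_ring_ops:
  "p \<oplus>\<^bsub>mpoly_ring m\<^esub> q = p + q" "p \<otimes>\<^bsub>mpoly_ring m\<^esub> q = p * q" "\<zero>\<^bsub>mpoly_ring m\<^esub> = 0"
  by (simp_all add: mpoly_ring_def ring_of_type_algebra_def)

lemma free_module_closed:
  assumes "cring (mpoly_ring m :: 'k::comm_ring_1 mpoly ring)"
    and f: "f \<in> carrier (free_module (mpoly_ring m :: 'k mpoly ring) G)"
  shows "h \<in> carrier (free_module (mpoly_ring m) G) \<Longrightarrow> f + h \<in> carrier (free_module (mpoly_ring m) G)"
    and "r \<in> carrier (mpoly_ring m) \<Longrightarrow> pm_scale r f \<in> carrier (free_module (mpoly_ring m) G)"
proof -
  interpret cring "mpoly_ring m :: 'k mpoly ring" by fact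
  have add: "p + q \<in> carrier (mpoly_ring m)"
    if "p \<in> carrier (mpoly_ring m)" "q \<in> carrier (mpoly_ring m)" for p q :: "'k mpoly"
    using add.m_closed[OF that] by (simp add: mpoly_ring_ops)
  have times: "p * q \<in> carrier (mpoly_ring m)"
    if "p \<in> carrier (mpoly_ring m)" "q \<in> carrier (mpoly_ring m)" for p q :: "'k mpoly"
    using m_closed[OF that] by (simp add: mpoly_ring_ops)
  show "f + h \<in> carrier (free_module (mpoly_ring m) G)" if h: "h \<in> carrier (free_module (mpoly_ring m) G)"
  proof -
    have "Poly_Mapping.keys (f + h) \<subseteq> G"
      using Poly_Mapping.keys_add[of f h] f h unfolding free_module_def by simp blast
    then show ?thesis
      using f h unfolding free_module_def by (simp add: lookup_add add)
  qed
  show "pm_scale r f \<in> carrier (free_module (mpoly_ring m) G)" if r: "r \<in> carrier (mpoly_ring m)"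
  proof -
    have "Poly_Mapping.keys (pm_scale r f) \<subseteq> Poly_Mapping.keys f"
      by (auto simp: in_keys_iff lookup_pm_scale)
    then have "Poly_Mapping.keys (pm_scale r f) \<subseteq> G"
      using f unfolding free_module_def by simp blast
    then show ?thesis
      using f r unfolding free_module_def by (simp add: lookup_pm_scale times)
  qed
qed

lemma std_aug_add_scale:
  assumes M: "module (mpoly_ring m) M" and G: "\<And>b. b \<in> G \<Longrightarrow> gen_value b \<in> carrier M"
    and f: "f \<in> carrier (free_module (mpoly_ring m) G)"
  shows "h \<in> carrier (free_module (mpoly_ring m) G) \<Longrightarrow> std_aug M (f + h) = std_aug M f \<oplus>\<^bsub>M\<^esub> std_aug M h"
    and "r \<in> carrier (mpoly_ring m) \<Longrightarrow> std_aug M (pm_scale r f) = r \<odot>\<^bsub>M\<^esub> std_aug M f"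
    and "std_aug M f \<in> carrier M"
proof -
  interpret module "mpoly_ring m" M by fact
  have in_M: "Poly_Mapping.lookup u b \<odot>\<^bsub>M\<^esub> gen_value b \<in> carrier M"
    if "u \<in> carrier (free_module (mpoly_ring m) G)" "b \<in> G" for u b
    using that G by (auto simp: free_module_def)
  have sup: "std_aug M u = (\<Oplus>\<^bsub>M\<^esub>b\<in>B. Poly_Mapping.lookup u b \<odot>\<^bsub>M\<^esub> gen_value b)"
    if "finite B" "B \<subseteq> G" "Poly_Mapping.keys u \<subseteq> B" "u \<in> carrier (free_module (mpoly_ring m) G)" for u B
    unfolding std_aug_def
  proof (rule M.add.finprod_mono_neutral_cong_left)
    fix i assume i: "i \<in> B - Poly_Mapping.keys u"
    then show "Poly_Mapping.lookup u i \<odot>\<^bsub>M\<^esub> gen_value i = \<zero>\<^bsub>M\<^esub>"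
        using that(2) smult_l_null[OF G[of i]] by (auto simp: in_keys_iff mpoly_ring_ops)
  next
  qed (use that in_M in auto)
  have keys: "Poly_Mapping.keys u \<subseteq> G" if "u \<in> carrier (free_module (mpoly_ring m) G)" for u
    using that by (auto simp: free_module_def)
  show "std_aug M f \<in> carrier M"
    unfolding std_aug_def using f keys[OF f] in_M[OF f] by (intro M.finsum_closed) auto
  show "std_aug M (f + h) = std_aug M f \<oplus>\<^bsub>M\<^esub> std_aug M h" if h: "h \<in> carrier (free_module (mpoly_ring m) G)"
  proof -
    let ?B = "Poly_Mapping.keys f \<union> Poly_Mapping.keys h"
    have B: "finite ?B" "?B \<subseteq> G" using keys f h by auto
    have fh: "f + h \<in> carrier (free_module (mpoly_ring m) G)"
      by (rule free_module_closed(1)[OF R.cring_axioms f h])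
    have "std_aug M (f + h) = (\<Oplus>\<^bsub>M\<^esub>b\<in>?B. Poly_Mapping.lookup f b \<odot>\<^bsub>M\<^esub> gen_value b
        \<oplus>\<^bsub>M\<^esub> Poly_Mapping.lookup h b \<odot>\<^bsub>M\<^esub> gen_value b)"
      unfolding sup[OF B Poly_Mapping.keys_add fh]
    proof (rule M.add.finprod_cong')
      fix b assume b: "b \<in> ?B"
      show "Poly_Mapping.lookup (f + h) b \<odot>\<^bsub>M\<^esub> gen_value b =
          Poly_Mapping.lookup f b \<odot>\<^bsub>M\<^esub> gen_value b \<oplus>\<^bsub>M\<^esub> Poly_Mapping.lookup h b \<odot>\<^bsub>M\<^esub> gen_value b"
        using smult_l_distr[of "Poly_Mapping.lookup f b" "Poly_Mapping.lookup h b" "gen_value b"] f h G b B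
        by (auto simp: free_module_def lookup_add mpoly_ring_ops)
    next
      show "(\<lambda>b. Poly_Mapping.lookup f b \<odot>\<^bsub>M\<^esub> gen_value b \<oplus>\<^bsub>M\<^esub> Poly_Mapping.lookup h b \<odot>\<^bsub>M\<^esub> gen_value b)
          \<in> ?B \<rightarrow> carrier M"
        using in_M[OF f] in_M[OF h] B by (intro Pi_I M.add.m_closed) auto
    qed simp
    also have "\<dots> = std_aug M f \<oplus>\<^bsub>M\<^esub> std_aug M h"
      unfolding sup[OF B Un_upper1 f] sup[OF B Un_upper2 h]
      using in_M[OF f] in_M[OF h] B by (intro M.finsum_addf) auto
    finally show ?thesis .
  qed
  show "std_aug M (pm_scale r f) = r \<odot>\<^bsub>M\<^esub> std_aug M f" if r: "r \<in> carrier (mpoly_ring m)"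
  proof -
    let ?B = "Poly_Mapping.keys f"
    have B: "finite ?B" "?B \<subseteq> G" using keys f by auto
    have sub: "Poly_Mapping.keys (pm_scale r f) \<subseteq> ?B" by (auto simp: in_keys_iff lookup_pm_scale)
    have rf: "pm_scale r f \<in> carrier (free_module (mpoly_ring m) G)"
      by (rule free_module_closed(2)[OF R.cring_axioms f r])
    have "std_aug M (pm_scale r f) = (\<Oplus>\<^bsub>M\<^esub>b\<in>?B. r \<odot>\<^bsub>M\<^esub> (Poly_Mapping.lookup f b \<odot>\<^bsub>M\<^esub> gen_value b))"
      unfolding sup[OF B sub rf]
    proof (rule M.add.finprod_cong')
      fix b assume b: "b \<in> ?B"
      show "Poly_Mapping.lookup (pm_scale r f) b \<odot>\<^bsub>M\<^esub> gen_value b =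
          r \<odot>\<^bsub>M\<^esub> (Poly_Mapping.lookup f b \<odot>\<^bsub>M\<^esub> gen_value b)"
        using smult_assoc1[of r "Poly_Mapping.lookup f b" "gen_value b"] f r G b B
        by (auto simp: free_module_def lookup_pm_scale mpoly_ring_ops)
    qed (use in_M[OF f] B r in auto)
    also have "\<dots> = r \<odot>\<^bsub>M\<^esub> std_aug M f"
      unfolding std_aug_def using in_M[OF f] B r
      by (intro finsum_smult_ldistr[symmetric]) auto
    finally show ?thesis .
  qed
qed

lemma std_aug_std_diff:
  fixes M :: "('k::comm_ring_1 mpoly, 'a, expo) graded_module"
  assumes M: "module (mpoly_ring m) M" and gr: "\<And>a. gr M a \<subseteq> carrier M"
    and z: "z \<in> gr (std_resolution m M) (Suc 0, a)"
  shows "std_aug M (std_diff z) = \<zero>\<^bsub>M\<^esub>"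
proof -
  interpret module "mpoly_ring m" M by fact
  let ?G = "{b \<in> std_basis m M. fst (cell_deg b) = 0}"
  let ?F = "carrier (free_module (mpoly_ring m :: 'k mpoly ring) ?G)"
  have G: "gen_value b \<in> carrier M" if "b \<in> ?G" for b
    proof -
    have "b \<in> std_basis m M" "fst (cell_deg b) = 0" using that by auto
    then show ?thesis using gr by (cases rule: std_basis.cases) auto
  qed
  have F0: "0 \<in> ?F" using R.zero_closed by (auto simp: free_module_def mpoly_ring_ops)
  have Fadd: "f + h \<in> ?F" if "f \<in> ?F" "h \<in> ?F" for f h
    by (rule free_module_closed(1)[OF R.cring_axioms that])
  have Fscale: "pm_scale r f \<in> ?F" if "f \<in> ?F" "r \<in> carrier (mpoly_ring m)" for f r
    by (rule free_module_closed(2)[OF R.cring_axioms that])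
  have cell: "cell_boundary b \<in> ?F \<and> std_aug M (cell_boundary b) = \<zero>\<^bsub>M\<^esub>"
    if b: "b \<in> std_basis m M" "fst (cell_deg b) = Suc 0" for b
    using b(1)
  proof (cases rule: std_basis.cases)
    case (Syz L n a)
    then have n: "n = 0" using b by simp
    have "lincomb L' \<in> ?F" if "set L' \<subseteq> set L" for L'
      using that
    proof (induction L')
      case (Cons pb L')
      obtain p c where pb: "pb = (p, c)" by (cases pb)
      have "Poly_Mapping.single c p \<in> ?F"
        using Cons.prems Syz n R.zero_closed pb by (auto simp: free_module_def lookup_single when_def mpoly_ring_ops)
      with Cons show ?case using Fadd by (auto simp: lincomb_def pb)
    qed (use F0 in \<open>simp add: lincomb_def\<close>)
    then show ?thesis using Syz n by auto
  qed (use b in auto)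
  have zb: "Poly_Mapping.lookup z b \<in> carrier (mpoly_ring m)" for b
    using z by (auto simp: std_resolution_def gr_graded_free_module)
  have "(\<Sum>b\<in>B. pm_scale (Poly_Mapping.lookup z b) (cell_boundary b)) \<in> ?F \<and>
      std_aug M (\<Sum>b\<in>B. pm_scale (Poly_Mapping.lookup z b) (cell_boundary b)) = \<zero>\<^bsub>M\<^esub>"
    if "finite B" "B \<subseteq> Poly_Mapping.keys z" for B
    using that
  proof (induction B)
    case empty
    show ?case using F0 by (simp add: std_aug_def)
  next
    case (insert b B)
    have "b \<in> std_basis m M \<and> fst (cell_deg b) = Suc 0"
      using insert.prems z by (auto simp: std_resolution_def gr_graded_free_module)
    then have c: "cell_boundary b \<in> ?F" "std_aug M (cell_boundary b) = \<zero>\<^bsub>M\<^esub>"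
      using cell by auto
    let ?t = "pm_scale (Poly_Mapping.lookup z b) (cell_boundary b)"
    let ?s = "\<Sum>b\<in>B. pm_scale (Poly_Mapping.lookup z b) (cell_boundary b)"
    have t: "?t \<in> ?F" "std_aug M ?t = \<zero>\<^bsub>M\<^esub>"
      using Fscale[OF c(1) zb] std_aug_add_scale(2)[OF M G c(1) zb] c(2) smult_r_null[OF zb] by auto
    have s: "?s \<in> ?F" "std_aug M ?s = \<zero>\<^bsub>M\<^esub>"
      using insert by auto
    have "?t + ?s \<in> ?F" "std_aug M (?t + ?s) = \<zero>\<^bsub>M\<^esub>"
      using Fadd[OF t(1) s(1)] std_aug_add_scale(1)[OF M G t(1) s(1)] t(2) s(2) by auto
    then show ?case using insert by simp
  qed
  then show ?thesis by (simp add: std_diff_def lin_ext_def)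
qed

text \<open>The component of \<open>Tor\<^sub>q(M, N)\<close> over \<open>k[x]\<close> of internal degree \<open>a\<close>, as a \<open>k\<close>-module.\<close>

definition Tor ::
  "nat \<Rightarrow> ('k::comm_ring_1 mpoly, 'a, expo) graded_module \<Rightarrow> ('k mpoly, 'b, expo) graded_module
     \<Rightarrow> nat \<Rightarrow> expo \<Rightarrow> ('k, ((('k mpoly, 'a) cell \<Rightarrow>\<^sub>0 'k mpoly) \<times> 'b \<Rightarrow>\<^sub>0 'k mpoly) set set) module" where
  "Tor m M N q a =
     homology (over_base (graded_tensor m (std_resolution m M) N))
       (tensor_map (mpoly_ring m) (std_resolution m M) N std_diff) q a"


section \<open>Face rings\<close>

definition complement_ideal :: "nat \<Rightarrow> nat set list \<Rightarrow> 'k::comm_ring_1 mpoly set" where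
  "complement_ideal m P = Idl\<^bsub>mpoly_ring m\<^esub> (set_monom ` set P)"

definition complement_complex :: "nat \<Rightarrow> nat set list \<Rightarrow> nat set set" where
  "complement_complex m P = {\<sigma>. \<sigma> \<subseteq> {1..m} \<and> \<not> (\<exists>\<tau>\<in>set P. \<tau> \<subseteq> \<sigma>)}"

definition face_ideal :: "nat \<Rightarrow> nat set set \<Rightarrow> 'k::comm_ring_1 mpoly set" where
  "face_ideal m K = Idl\<^bsub>mpoly_ring m\<^esub> (set_monom ` {\<sigma>. \<sigma> \<subseteq> {1..m} \<and> \<sigma> \<notin> K})"

text \<open>\<open>k[x]/I\<close> as an \<open>\<nat>\<^sup>m\<close>-graded \<open>k[x]\<close>-module, for an ideal \<open>I\<close> generated by monomials.\<close>

definition quot_ring_module ::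
  "nat \<Rightarrow> 'k::comm_ring_1 mpoly set \<Rightarrow> ('k mpoly, 'k mpoly set, expo) graded_module" where
  "quot_ring_module m I =
    \<lparr>carrier = carrier (mpoly_ring m Quot I), monoid.mult = monoid.mult (mpoly_ring m Quot I),
     one = one (mpoly_ring m Quot I), ring.zero = ring.zero (mpoly_ring m Quot I),
     add = add (mpoly_ring m Quot I),
     module.smult = (\<lambda>p C. (I +>\<^bsub>mpoly_ring m\<^esub> p) \<otimes>\<^bsub>mpoly_ring m Quot I\<^esub> C),
     gr = (\<lambda>a. {I +>\<^bsub>mpoly_ring m\<^esub> p | p. p \<in> carrier (mpoly_ring m) \<and> Poly_Mapping.keys p \<subseteq> {a}})\<rparr>"

abbreviation face_ring ::
  "nat \<Rightarrow> nat set set \<Rightarrow> ('k::comm_ring_1 mpoly, 'k mpoly set, expo) graded_module" where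
  "face_ring m K \<equiv> quot_ring_module m (face_ideal m K)"

text \<open>\<open>k\<close> as a \<open>k[x]\<close>-module concentrated in degree \<open>0\<close>, on which every variable acts as zero.\<close>

definition base_module :: "('k::comm_ring_1 mpoly, 'k, expo) graded_module" where
  "base_module =
    \<lparr>carrier = UNIV, monoid.mult = (*), one = 1, ring.zero = 0, add = (+),
     module.smult = (\<lambda>p c. Poly_Mapping.lookup p 0 * c),
     gr = (\<lambda>a. if a = 0 then UNIV else {0})\<rparr>"


section \<open>The exterior algebra and the Taylor complex\<close>

text \<open>
  The generator \<open>\<sigma>\<^bsub>k\<^sub>1\<^esub> \<dots> \<sigma>\<^bsub>k\<^sub>q\<^esub>\<close> is encoded by the strictly increasing list of indices
  \<open>[k\<^sub>1, \<dots>, k\<^sub>q]\<close>, where indices count from \<open>0\<close> as usual for lists.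
\<close>

definition ext_gens :: "nat set list \<Rightarrow> nat list set" where
  "ext_gens P = {u. sorted_wrt (<) u \<and> set u \<subseteq> {..<length P}}"

definition total_set :: "nat set list \<Rightarrow> nat list \<Rightarrow> nat set" where
  "total_set P u = (\<Union>k\<in>set u. P ! k)"

text \<open>\<open>del_gen i u\<close> omits the \<open>i\<close>-th factor, counted from \<open>1\<close>.\<close>

definition del_gen :: "nat \<Rightarrow> nat list \<Rightarrow> nat list" where
  "del_gen i u = take (i - 1) u @ drop i u"

definition ext_module ::
  "nat set list \<Rightarrow> ('k::comm_ring_1, nat list \<Rightarrow>\<^sub>0 'k, nat \<times> nat set) graded_module" where
  "ext_module P = with_grading (free_module base_ring (ext_gens P))
     (\<lambda>(q, \<sigma>). carrier (free_module base_ring {u \<in> ext_gens P. length u = q \<and> total_set P u = \<sigma>}))"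

definition taylor ::
  "nat \<Rightarrow> nat set list \<Rightarrow> ('k::comm_ring_1 mpoly, nat list \<Rightarrow>\<^sub>0 'k mpoly, nat \<times> expo) graded_module"
  where "taylor m P =
     graded_free_module m (ext_gens P) (\<lambda>u. (length u, set_expo (total_set P u)))"

definition taylor_diff ::
  "nat set list \<Rightarrow> (nat list \<Rightarrow>\<^sub>0 'k::comm_ring_1 mpoly) \<Rightarrow> (nat list \<Rightarrow>\<^sub>0 'k mpoly)" where
  "taylor_diff P = lin_ext (\<lambda>u. \<Sum>i = 1..length u.
     Poly_Mapping.single (del_gen i u)
       ((-1) ^ i * set_monom (total_set P u - total_set P (del_gen i u))))"

abbreviation taylor_tensor ::
  "nat \<Rightarrow> nat set list
     \<Rightarrow> ('k::comm_ring_1, ((nat list \<Rightarrow>\<^sub>0 'k mpoly) \<times> 'k \<Rightarrow>\<^sub>0 'k mpoly) set, nat \<times> expo) graded_module"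
  where "taylor_tensor m P \<equiv> over_base (graded_tensor m (taylor m P) base_module)"

abbreviation taylor_tensor_diff ::
  "nat \<Rightarrow> nat set list
     \<Rightarrow> ((nat list \<Rightarrow>\<^sub>0 'k::comm_ring_1 mpoly) \<times> 'k \<Rightarrow>\<^sub>0 'k mpoly) set
     \<Rightarrow> ((nat list \<Rightarrow>\<^sub>0 'k mpoly) \<times> 'k \<Rightarrow>\<^sub>0 'k mpoly) set"
  where "taylor_tensor_diff m P \<equiv>
     tensor_map (mpoly_ring m) (taylor m P) base_module (taylor_diff P)"

text \<open>
  The canonical map \<open>\<lambda> \<mapsto> (\<lambda> \<otimes> 1) \<otimes> 1\<close> from \<open>\<Lambda>[P]\<close> to the Taylor complex tensored with \<open>k\<close>, and
  the differential of \<open>\<Lambda>[P]\<close> that it transports from there.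
\<close>

definition ext_to_taylor ::
  "nat \<Rightarrow> nat set list \<Rightarrow> (nat list \<Rightarrow>\<^sub>0 'k::comm_ring_1)
     \<Rightarrow> ((nat list \<Rightarrow>\<^sub>0 'k mpoly) \<times> 'k \<Rightarrow>\<^sub>0 'k mpoly) set" where
  "ext_to_taylor m P f =
     tensor_elt (mpoly_ring m) (taylor m P) base_module
       (Poly_Mapping.map (Poly_Mapping.single 0) f) 1"

definition ext_diff ::
  "nat \<Rightarrow> nat set list \<Rightarrow> (nat list \<Rightarrow>\<^sub>0 'k::comm_ring_1) \<Rightarrow> (nat list \<Rightarrow>\<^sub>0 'k)" where
  "ext_diff m P f =
     inv_into (carrier (ext_module P)) (ext_to_taylor m P)
       (taylor_tensor_diff m P (ext_to_taylor m P f))"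

end

theory Submission
  imports Defs
begin

text \<open>
  \<open>Tor\<close> is defined through the standard resolution of \<open>k[x]/I\<^sub>P\<close>. The theorem holds because the Taylor
  complex is another graded free resolution of the same module, and because tensoring either one
  with \<open>k\<close> leaves a complex of free \<open>k\<close>-modules that can be written down explicitly.

  Tensoring: in \<open>F \<otimes> k\<close> every variable acts as zero, so for a free module \<open>F\<close> on a basis \<open>B\<close> only the
  constant terms of the coefficients survive, and \<open>F \<otimes> k\<close> is the free \<open>k\<close>-module on \<open>B\<close>
  (\<open>tensor_kernel_eq\<close>, \<open>base_tensor_iso\<close>, \<open>gr_tensor\<close>). A differential on \<open>F\<close> turns into the one whose
  matrix entries are the constant terms (\<open>tensor_map_base_tensor\<close>). In the Taylor complex the entry
  of \<open>d u\<close> at \<open>\<partial>\<^sub>i u\<close> is, up to sign, the monomial of the set difference of the total sets. Its constant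
  term is \<open>1\<close> if the total sets agree and \<open>0\<close> otherwise, which is the factor \<open>\<delta>\<close> of the formula for
  \<open>d\<close> (\<open>ext_boundary_eq\<close>).

  Comparison: two graded free resolutions of \<open>k[x]/I\<close> are connected by chain maps in both directions
  that lift the identity (\<open>chain_map_exists\<close>), and both composites are homotopic to the identity
  (\<open>round_trip_homotopy\<close>). Taking constant terms keeps chain maps and homotopies, so the homology
  after tensoring is the same in each bidegree (\<open>reduced_homology_isomorphic\<close>). Augmentations are
  represented by values in \<open>k[x]\<close> that only matter modulo \<open>I\<close>; this avoids calculations with cosets.

  Exactness of the Taylor complex: in a fixed multidegree \<open>a\<close> it is the augmented chain complex, with
  coefficients in \<open>k\<close>, of the full simplex on the indices \<open>i\<close> for which the monomial of \<open>\<sigma>\<^sub>i\<close> divides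
  \<open>x\<^sup>a\<close> (\<open>taylor_homogenize\<close>). If there is such an index, then coning with the least one contracts the
  complex (\<open>cone_homotopy\<close>). If there is none, then the complex is \<open>k\<close> in degree \<open>0\<close> and \<open>x\<^sup>a\<close> is not in
  \<open>I\<^sub>P\<close>, so the augmentation is injective there.

  The two ideals agree since the monomial of a non-face is a multiple of the monomial of some \<open>\<sigma>\<^sub>i\<close>.
\<close>

section \<open>Finitely supported functions\<close>

lemma sum_single_keys:
  "(\<Sum>b\<in>Poly_Mapping.keys f. Poly_Mapping.single b (Poly_Mapping.lookup f b)) = f"
  by (rule poly_mapping_eqI)
    (auto simp: lookup_sum lookup_single when_def in_keys_iff sum.delta)

lemma single_eq_0_iff: "Poly_Mapping.single k c = 0 \<longleftrightarrow> c = 0"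
  by (metis lookup_single_eq lookup_zero single_zero)

lemma poly_mapping_induct_on:
  fixes f :: "'b \<Rightarrow>\<^sub>0 'c::comm_monoid_add"
  assumes f: "\<And>b. b \<in> Poly_Mapping.keys f \<Longrightarrow> b \<in> B \<and> Poly_Mapping.lookup f b \<in> C"
    and "Q 0" and "\<And>b c. \<lbrakk>b \<in> B; c \<in> C\<rbrakk> \<Longrightarrow> Q (Poly_Mapping.single b c)"
    and "\<And>x y. \<lbrakk>Q x; Q y\<rbrakk> \<Longrightarrow> Q (x + y)"
  shows "Q f"
proof -
  have "Q (\<Sum>b\<in>A. Poly_Mapping.single b (Poly_Mapping.lookup f b))"
    if "finite A" "A \<subseteq> Poly_Mapping.keys f" for A
    using that by (induction A) (use assms in auto)
  from this[of "Poly_Mapping.keys f"] show ?thesis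
    by (simp add: sum_single_keys)
qed

text \<open>
  Identities between additive maps are checked on single terms. Additivity is required on the whole
  type and not only on the functions supported in \<open>B\<close>, so that sums need no side conditions.
\<close>

lemma additive_eq_on:
  fixes F G :: "('b \<Rightarrow>\<^sub>0 'c::comm_monoid_add) \<Rightarrow> 'd::ab_group_add"
  assumes "Poly_Mapping.keys f \<subseteq> B"
    and F: "\<And>x y. F (x + y) = F x + F y" and G: "\<And>x y. G (x + y) = G x + G y"
    and "\<And>b c. b \<in> B \<Longrightarrow> F (Poly_Mapping.single b c) = G (Poly_Mapping.single b c)"
  shows "F f = G f"
proof -
  have "F 0 = 0" "G 0 = 0" using F[of 0 0] G[of 0 0] by (simp_all only: add_0_left add_cancel_right_right)
  then have 0: "F 0 = G 0" by simp
  show ?thesis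
    by (rule poly_mapping_induct_on[where f = f and B = B and C = UNIV and Q = "\<lambda>f. F f = G f"])
      (use assms 0 in auto)
qed

lemma pm_scale_add_right: "pm_scale r (f + h) = pm_scale r f + pm_scale r h"
  by (rule poly_mapping_eqI) (simp add: lookup_pm_scale lookup_add distrib_left)

lemma pm_scale_sum_right: "pm_scale r (\<Sum>i\<in>I. f i) = (\<Sum>i\<in>I. pm_scale r (f i))"
  by (induction I rule: infinite_finite_induct) (auto simp: pm_scale_add_right)

lemma pm_scale_minus_one: "pm_scale (-1) f = - f"
  by (rule poly_mapping_eqI) (simp add: lookup_pm_scale)

lemma keys_pm_scale: "Poly_Mapping.keys (pm_scale r f) \<subseteq> Poly_Mapping.keys f"
  by (auto simp: in_keys_iff lookup_pm_scale)

lemma lin_ext_minus: "lin_ext g (- f) = - lin_ext g f"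
  using lin_ext_scale[of g "-1" f] by (simp add: pm_scale_minus_one)

lemma lin_ext_diff: "lin_ext g (f - h) = lin_ext g f - lin_ext g h"
  using lin_ext_add[of g f "- h"] by (simp add: lin_ext_minus)

lemma lin_ext_cong:
  assumes "\<And>b. b \<in> Poly_Mapping.keys f \<Longrightarrow> g b = h b"
  shows "lin_ext g f = lin_ext h f"
  unfolding lin_ext_def using assms by (intro sum.cong) auto

lemma lin_ext_id: "lin_ext (\<lambda>b. Poly_Mapping.single b 1) f = f"
  by (simp add: lin_ext_def sum_single_keys)

lemma lin_ext_lin_ext: "lin_ext g (lin_ext h f) = lin_ext (\<lambda>b. lin_ext g (h b)) f"
  by (simp add: lin_ext_def[of h] lin_ext_def[of "\<lambda>b. lin_ext g (h b)"] lin_ext_sum lin_ext_scale)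

lemma lin_ext_fun_add: "lin_ext (\<lambda>b. g b + h b) f = lin_ext g f + lin_ext h f"
  by (simp add: lin_ext_def pm_scale_add_right sum.distrib)

lemma lin_ext_fun_minus: "lin_ext (\<lambda>b. - g b) f = - lin_ext g f"
  unfolding lin_ext_def sum_negf[symmetric]
  by (intro sum.cong refl poly_mapping_eqI) (simp add: lookup_pm_scale)

lemma lin_ext_fun_diff: "lin_ext (\<lambda>b. g b - h b) f = lin_ext g f - lin_ext h f"
  using lin_ext_fun_add[of g "\<lambda>b. - h b" f] by (simp add: lin_ext_fun_minus)

lemma keys_lin_ext: "Poly_Mapping.keys (lin_ext g f) \<subseteq> (\<Union>b\<in>Poly_Mapping.keys f. Poly_Mapping.keys (g b))"
proof -
  have "Poly_Mapping.keys (lin_ext g f) \<subseteq>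
      (\<Union>b\<in>Poly_Mapping.keys f. Poly_Mapping.keys (pm_scale (Poly_Mapping.lookup f b) (g b)))"
    unfolding lin_ext_def by (rule keys_sum)
  also have "\<dots> \<subseteq> (\<Union>b\<in>Poly_Mapping.keys f. Poly_Mapping.keys (g b))"
    by (intro UN_mono keys_pm_scale order_refl)
  finally show ?thesis .
qed


section \<open>Constant terms\<close>

lemma expo_add_eq_0_iff: "s + t = 0 \<longleftrightarrow> s = 0 \<and> t = 0" for s t :: expo
  by (auto simp: poly_mapping_eq_iff lookup_add fun_eq_iff)

lemma keys_expo_add: "Poly_Mapping.keys (s + t) = Poly_Mapping.keys s \<union> Poly_Mapping.keys t" for s t :: expo
  by (auto simp: in_keys_iff lookup_add)

lemma lookup_mult_zero:
  fixes p q :: "'k::comm_ring_1 mpoly"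
  shows "Poly_Mapping.lookup (p * q) 0 = Poly_Mapping.lookup p 0 * Poly_Mapping.lookup q 0"
proof -
  have s: "Poly_Mapping.lookup (Poly_Mapping.single s c * q) 0 = Poly_Mapping.lookup (Poly_Mapping.single s c) 0 * Poly_Mapping.lookup q 0"
    for s and c :: 'k
    by (rule additive_eq_on[of q UNIV "\<lambda>q. Poly_Mapping.lookup (Poly_Mapping.single s c * q) 0"])
      (auto simp: distrib_left lookup_add mult_single lookup_single when_def expo_add_eq_0_iff)
  show ?thesis
    by (rule additive_eq_on[of p UNIV "\<lambda>p. Poly_Mapping.lookup (p * q) 0"])
      (auto simp: distrib_right lookup_add s)
qed

text \<open>
  On a free module over the polynomial ring, tensoring with the ground ring amounts to replacing
  each coefficient by its constant term; this works because taking constant terms is a ring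
  homomorphism.
\<close>

definition const_part :: "('b \<Rightarrow>\<^sub>0 'k::comm_ring_1 mpoly) \<Rightarrow> ('b \<Rightarrow>\<^sub>0 'k)" where
  "const_part f = Poly_Mapping.map (\<lambda>p. Poly_Mapping.lookup p 0) f"

abbreviation const_coeffs :: "('b \<Rightarrow>\<^sub>0 'k::comm_ring_1) \<Rightarrow> ('b \<Rightarrow>\<^sub>0 'k mpoly)" where
  "const_coeffs \<equiv> Poly_Mapping.map (Poly_Mapping.single 0)"

lemma lookup_const_part: "Poly_Mapping.lookup (const_part f) b = Poly_Mapping.lookup (Poly_Mapping.lookup f b) 0"
  by (simp add: const_part_def Poly_Mapping.map.rep_eq when_def)

lemma lookup_const_coeffs: "Poly_Mapping.lookup (const_coeffs g) b = Poly_Mapping.single 0 (Poly_Mapping.lookup g b)"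
  by (simp add: Poly_Mapping.map.rep_eq when_def)

lemma const_part_simps [simp]:
  "const_part 0 = 0"
  "const_part (Poly_Mapping.single b p) = Poly_Mapping.single b (Poly_Mapping.lookup p 0)"
  "const_part (const_coeffs g) = g"
  by (rule poly_mapping_eqI; simp add: lookup_const_part lookup_const_coeffs lookup_single when_def)+

lemma const_part_add: "const_part (f + g) = const_part f + const_part g"
  by (rule poly_mapping_eqI) (simp add: lookup_const_part lookup_add)

lemma const_part_diff: "const_part (f - g) = const_part f - const_part g"
  by (rule poly_mapping_eqI) (simp add: lookup_const_part lookup_minus)

lemma const_part_sum: "const_part (\<Sum>i\<in>I. f i) = (\<Sum>i\<in>I. const_part (f i))"
  by (induction I rule: infinite_finite_induct) (auto simp: const_part_add)

lemma const_part_pm_scale: "const_part (pm_scale p f) = pm_scale (Poly_Mapping.lookup p 0) (const_part f)"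
  by (rule poly_mapping_eqI) (simp add: lookup_const_part lookup_pm_scale lookup_mult_zero)

lemma const_part_lin_ext: "const_part (lin_ext g f) = lin_ext (\<lambda>b. const_part (g b)) (const_part f)"
  by (rule additive_eq_on[of f UNIV "\<lambda>f. const_part (lin_ext g f)"])
    (auto simp: lin_ext_add const_part_add const_part_pm_scale)

lemma keys_const_part: "Poly_Mapping.keys (const_part f) \<subseteq> Poly_Mapping.keys f"
  by (auto simp: in_keys_iff lookup_const_part)

lemma const_coeffs_simps [simp]:
  "const_coeffs 0 = 0"
  "const_coeffs (Poly_Mapping.single b c) = Poly_Mapping.single b (Poly_Mapping.single 0 c)"
  by (rule poly_mapping_eqI; simp add: lookup_const_coeffs lookup_single when_def)+

lemma const_coeffs_add: "const_coeffs (g + h) = const_coeffs g + const_coeffs h"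
  by (rule poly_mapping_eqI) (simp add: lookup_const_coeffs lookup_add single_add)

lemma keys_const_coeffs [simp]:
  "Poly_Mapping.keys (const_coeffs g) = Poly_Mapping.keys g" for g :: "'b \<Rightarrow>\<^sub>0 'k::comm_ring_1"
  by (simp add: set_eq_iff in_keys_iff lookup_const_coeffs single_eq_0_iff)

section \<open>The polynomial ring and free modules\<close>

lemma mem_mpoly_ring: "p \<in> carrier (mpoly_ring m) \<longleftrightarrow>
    (\<forall>t\<in>Poly_Mapping.keys p. Poly_Mapping.keys t \<subseteq> {1..m})"
  by (simp add: mpoly_ring_def)

lemma mpoly_ring_simps [simp]: "add (mpoly_ring m) = (+)" "monoid.mult (mpoly_ring m) = (*)"
   "ring.zero (mpoly_ring m) = 0" "one (mpoly_ring m) = 1"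
  by (simp_all add: mpoly_ring_def ring_of_type_algebra_def)

lemma base_ring_simps [simp]: "add base_ring = (+)" "monoid.mult base_ring = (*)"
   "ring.zero base_ring = 0" "one base_ring = 1" "carrier base_ring = UNIV"
  by (simp_all add: ring_of_type_algebra_def)

lemma mpoly_closed:
  fixes p q :: "'k::comm_ring_1 mpoly"
  shows "0 \<in> carrier (mpoly_ring m :: 'k mpoly ring)" "1 \<in> carrier (mpoly_ring m :: 'k mpoly ring)"
    "\<lbrakk>p \<in> carrier (mpoly_ring m); q \<in> carrier (mpoly_ring m)\<rbrakk> \<Longrightarrow> p + q \<in> carrier (mpoly_ring m)"
    "\<lbrakk>p \<in> carrier (mpoly_ring m); q \<in> carrier (mpoly_ring m)\<rbrakk> \<Longrightarrow> p * q \<in> carrier (mpoly_ring m)"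
    "p \<in> carrier (mpoly_ring m) \<Longrightarrow> - p \<in> carrier (mpoly_ring m)"
    "\<lbrakk>p \<in> carrier (mpoly_ring m); q \<in> carrier (mpoly_ring m)\<rbrakk> \<Longrightarrow> p - q \<in> carrier (mpoly_ring m)"
    "Poly_Mapping.keys t \<subseteq> {1..m} \<Longrightarrow> Poly_Mapping.single t c \<in> carrier (mpoly_ring m :: 'k mpoly ring)"
proof -
  show "p + q \<in> carrier (mpoly_ring m)" if "p \<in> carrier (mpoly_ring m)" "q \<in> carrier (mpoly_ring m)"
    using that Poly_Mapping.keys_add[of p q] unfolding mem_mpoly_ring by blast
  show "p - q \<in> carrier (mpoly_ring m)" if "p \<in> carrier (mpoly_ring m)" "q \<in> carrier (mpoly_ring m)"
    using that keys_diff[of p q] unfolding mem_mpoly_ring by blast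
  show "p * q \<in> carrier (mpoly_ring m)" if "p \<in> carrier (mpoly_ring m)" "q \<in> carrier (mpoly_ring m)"
    unfolding mem_mpoly_ring
  proof
    fix t assume "t \<in> Poly_Mapping.keys (p * q)"
    then obtain a b where "t = a + b" "a \<in> Poly_Mapping.keys p" "b \<in> Poly_Mapping.keys q"
      using Poly_Mapping.keys_mult[of p q] by blast
    then show "Poly_Mapping.keys t \<subseteq> {1..m}" using that by (simp add: keys_expo_add mem_mpoly_ring)
  qed
qed (auto simp: mem_mpoly_ring)

lemma cring_mpoly_ring: "cring (mpoly_ring m :: 'k::comm_ring_1 mpoly ring)"
proof (rule cringI)
  show "abelian_group (mpoly_ring m :: 'k mpoly ring)"
  proof (rule abelian_groupI)
    fix x :: "'k mpoly" assume "x \<in> carrier (mpoly_ring m)"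
    then show "\<exists>y\<in>carrier (mpoly_ring m). y \<oplus>\<^bsub>mpoly_ring m\<^esub> x = \<zero>\<^bsub>mpoly_ring m\<^esub>"
      by (intro bexI[of _ "- x"]) (simp_all add: mpoly_closed)
  qed (simp_all add: mpoly_closed ac_simps)
  show "comm_monoid (mpoly_ring m :: 'k mpoly ring)"
    by (rule comm_monoidI) (simp_all add: mpoly_closed ac_simps)
qed (simp add: distrib_right)

lemma free_module_simps [simp]:
  "add (free_module R B) = (+)" "ring.zero (free_module R B) = 0" "module.smult (free_module R B) = pm_scale"
  by (simp_all add: free_module_def)

lemma mem_free_module: "f \<in> carrier (free_module R B) \<longleftrightarrow>
    Poly_Mapping.keys f \<subseteq> B \<and> (\<forall>b. Poly_Mapping.lookup f b \<in> carrier R)"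
  by (simp add: free_module_def)

lemma module_free_module:
  fixes R :: "'r::comm_ring_1 ring"
  assumes R: "cring R" and [simp]: "add R = (+)" "monoid.mult R = (*)" "ring.zero R = 0" "one R = 1"
  shows "module R (free_module R B)"
proof -
  interpret cring R by fact
  have add: "x + y \<in> carrier R" and mult: "x * y \<in> carrier R"
    if "x \<in> carrier R" "y \<in> carrier R" for x y
    using add.m_closed[OF that] m_closed[OF that] by simp_all
  have neg: "- x \<in> carrier R" if "x \<in> carrier R" for x
  proof -
    have "x + (\<ominus>\<^bsub>R\<^esub> x) = 0" using r_neg[OF that] by simp
    then have "- x = \<ominus>\<^bsub>R\<^esub> x" by (simp add: neg_eq_iff_add_eq_0)
    then show ?thesis using that by simp
  qed
  have 0: "0 \<in> carrier R" using zero_closed by simp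
  have addF: "f + h \<in> carrier (free_module R B)"
    if "f \<in> carrier (free_module R B)" "h \<in> carrier (free_module R B)" for f h
    using that add Poly_Mapping.keys_add[of f h] by (auto simp: mem_free_module lookup_add)
  have "abelian_group (free_module R B)"
  proof (rule abelian_groupI)
    fix f assume "f \<in> carrier (free_module R B)"
    then show "\<exists>h\<in>carrier (free_module R B). h \<oplus>\<^bsub>free_module R B\<^esub> f = \<zero>\<^bsub>free_module R B\<^esub>"
      by (intro bexI[of _ "- f"]) (simp_all add: mem_free_module neg)
  qed (simp_all add: addF ac_simps, simp add: mem_free_module 0)
  moreover have "pm_scale r f \<in> carrier (free_module R B)"
    if "r \<in> carrier R" "f \<in> carrier (free_module R B)" for r f
    using that mult keys_pm_scale[of r f] by (auto simp: mem_free_module lookup_pm_scale)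
  ultimately show ?thesis
    by (intro moduleI R) (simp_all add: pm_scale_add pm_scale_add_right pm_scale_assoc)
qed

lemma module_free_mpoly: "module (mpoly_ring m) (free_module (mpoly_ring m :: 'k::comm_ring_1 mpoly ring) B)"
  by (rule module_free_module) (simp_all add: cring_mpoly_ring)

lemma module_free_base: "module base_ring (free_module (base_ring :: 'k::comm_ring_1 ring) B)"
  by (rule module_free_module) (simp_all add: cring_from_type_algebra)

lemma (in abelian_group) a_inv_eqI:
  assumes "x \<in> carrier G" "y \<in> carrier G" "x \<oplus> y = \<zero>"
  shows "\<ominus> x = y"
  using assms minus_equality[of y x] by (simp add: a_comm)

lemma a_inv_free_module:
  fixes R :: "'r::comm_ring_1 ring"
  assumes M: "module R (free_module R B)" and f: "f \<in> carrier (free_module R B)"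
  shows "\<ominus>\<^bsub>free_module R B\<^esub> f = - f"
proof -
  interpret module R "free_module R B" by fact
  have "f + (\<ominus>\<^bsub>free_module R B\<^esub> f) = 0" using M.r_neg[OF f] by simp
  then show ?thesis by (simp add: add_eq_0_iff)
qed

section \<open>Homology of complexes of modules\<close>

lemma module_isomorphic_trans:
  assumes "module_isomorphic R L M" "module_isomorphic R M N"
  shows "module_isomorphic R L N"
proof -
  obtain f g where f: "f \<in> module_iso R L M" and g: "g \<in> module_iso R M N"
    using assms unfolding module_isomorphic_def by blast
  have "g \<circ> f \<in> module_iso R L N"
    using f g bij_betw_trans[of f "carrier L" "carrier M" g "carrier N"]
    by (auto simp: module_iso_def mod_hom_def Pi_iff)
  then show ?thesis unfolding module_isomorphic_def by blast
qed

lemma module_isomorphic_refl: "module_isomorphic R M M"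
proof -
  have "id \<in> module_iso R M M" by (simp add: module_iso_def mod_hom_def)
  then show ?thesis unfolding module_isomorphic_def by blast
qed

lemma (in module) mod_hom_zero:
  assumes "abelian_group N" "f \<in> mod_hom R M N"
  shows "f \<zero>\<^bsub>M\<^esub> = \<zero>\<^bsub>N\<^esub>"
proof -
  interpret N: abelian_group N by fact
  have f: "f \<zero>\<^bsub>M\<^esub> \<in> carrier N" using assms(2) M.zero_closed by (auto simp: mod_hom_def)
  have "f (\<zero>\<^bsub>M\<^esub> \<oplus>\<^bsub>M\<^esub> \<zero>\<^bsub>M\<^esub>) = f \<zero>\<^bsub>M\<^esub> \<oplus>\<^bsub>N\<^esub> f \<zero>\<^bsub>M\<^esub>"
    using assms(2) M.zero_closed unfolding mod_hom_def by blast
  then have "f \<zero>\<^bsub>M\<^esub> = f \<zero>\<^bsub>M\<^esub> \<oplus>\<^bsub>N\<^esub> f \<zero>\<^bsub>M\<^esub>" by simp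
  then show ?thesis using f by (metis N.add.r_cancel_one')
qed

lemma (in module) mod_hom_uminus:
  assumes "abelian_group N" "f \<in> mod_hom R M N" "x \<in> carrier M"
  shows "f (\<ominus>\<^bsub>M\<^esub> x) = \<ominus>\<^bsub>N\<^esub> f x"
proof -
  interpret N: abelian_group N by fact
  have "f x \<in> carrier N" "f (\<ominus>\<^bsub>M\<^esub> x) \<in> carrier N"
    "f x \<oplus>\<^bsub>N\<^esub> f (\<ominus>\<^bsub>M\<^esub> x) = f (x \<oplus>\<^bsub>M\<^esub> (\<ominus>\<^bsub>M\<^esub> x))"
    using assms(2,3) by (auto simp: mod_hom_def)
  moreover have "f (x \<oplus>\<^bsub>M\<^esub> (\<ominus>\<^bsub>M\<^esub> x)) = \<zero>\<^bsub>N\<^esub>"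
    using assms(3) by (simp add: M.r_neg mod_hom_zero[OF assms(1,2)])
  ultimately show ?thesis by (metis N.a_inv_eqI)
qed

locale module_with_submodule = module R M + submodule N R M for R (structure) and M (structure) and N
begin

lemma abelian_subgroup: "abelian_subgroup N M"
  by (intro abelian_subgroupI3 additive_subgroup.intro subgroup_axioms M.abelian_group_axioms)

sublocale quot: abelian_subgroup N M by (rule abelian_subgroup)

lemma coset_eq_iff:
  assumes "x \<in> carrier M" "y \<in> carrier M"
  shows "N +>\<^bsub>M\<^esub> x = N +>\<^bsub>M\<^esub> y \<longleftrightarrow> x \<oplus>\<^bsub>M\<^esub> (\<ominus>\<^bsub>M\<^esub> y) \<in> N"
  using assms quot.a_rcos_module quot.a_repr_independence' quot.a_repr_independenceD by metis

lemma coset_smult: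
  assumes r: "r \<in> carrier R" and x: "x \<in> carrier M"
  shows "(\<Union>y\<in>N +>\<^bsub>M\<^esub> x. N +>\<^bsub>M\<^esub> (r \<odot>\<^bsub>M\<^esub> y)) = N +>\<^bsub>M\<^esub> (r \<odot>\<^bsub>M\<^esub> x)"
proof -
  have "N +>\<^bsub>M\<^esub> (r \<odot>\<^bsub>M\<^esub> y) = N +>\<^bsub>M\<^esub> (r \<odot>\<^bsub>M\<^esub> x)" if y: "y \<in> N +>\<^bsub>M\<^esub> x" for y
  proof -
    have yM: "y \<in> carrier M" using quot.a_elemrcos_carrier[OF x y] .
    have "r \<odot>\<^bsub>M\<^esub> (y \<oplus>\<^bsub>M\<^esub> (\<ominus>\<^bsub>M\<^esub> x)) \<in> N"
      using quot.a_rcos_module_imp[OF x y] r by (rule smult_closed[rotated])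
    then show ?thesis using r x yM
      by (simp add: coset_eq_iff smult_r_distr smult_r_minus)
  qed
  moreover have "x \<in> N +>\<^bsub>M\<^esub> x" using quot.a_rcos_self[OF x] .
  ultimately show ?thesis by blast
qed

lemma quotient_module_simps:
  "carrier (quotient_module M N) = (\<lambda>x. N +>\<^bsub>M\<^esub> x) ` carrier M"
  "\<lbrakk>x \<in> carrier M; y \<in> carrier M\<rbrakk> \<Longrightarrow>
     (N +>\<^bsub>M\<^esub> x) \<oplus>\<^bsub>quotient_module M N\<^esub> (N +>\<^bsub>M\<^esub> y) = N +>\<^bsub>M\<^esub> (x \<oplus>\<^bsub>M\<^esub> y)"
  "\<lbrakk>r \<in> carrier R; x \<in> carrier M\<rbrakk> \<Longrightarrow> r \<odot>\<^bsub>quotient_module M N\<^esub> (N +>\<^bsub>M\<^esub> x) = N +>\<^bsub>M\<^esub> (r \<odot>\<^bsub>M\<^esub> x)"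
  by (auto simp: quotient_module_def A_RCOSETS_def' quot.a_rcos_sum coset_smult)

end

text \<open>
  Injectivity and surjectivity of the induced map are stated on representatives, which is the form in
  which homotopies supply them.
\<close>

lemma quotient_module_isomorphic:
  assumes "module_with_submodule R M N" "module_with_submodule R M' N'"
    and f: "f \<in> mod_hom R M M'"
    and f_N: "\<And>x. x \<in> N \<Longrightarrow> f x \<in> N'"
    and inj: "\<And>x. \<lbrakk>x \<in> carrier M; f x \<in> N'\<rbrakk> \<Longrightarrow> x \<in> N"
    and surj: "\<And>y. y \<in> carrier M' \<Longrightarrow> \<exists>x\<in>carrier M. y \<oplus>\<^bsub>M'\<^esub> (\<ominus>\<^bsub>M'\<^esub> f x) \<in> N'"
  shows "module_isomorphic R (quotient_module M N) (quotient_module M' N')"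
proof -
  interpret A: module_with_submodule R M N by fact
  interpret B: module_with_submodule R M' N' by fact
  have fM: "f x \<in> carrier M'" if "x \<in> carrier M" for x
    using f that by (auto simp: mod_hom_def)
  have fadd: "f (x \<oplus>\<^bsub>M\<^esub> y) = f x \<oplus>\<^bsub>M'\<^esub> f y" if "x \<in> carrier M" "y \<in> carrier M" for x y
    using f that by (auto simp: mod_hom_def)
  have fsmult: "f (r \<odot>\<^bsub>M\<^esub> x) = r \<odot>\<^bsub>M'\<^esub> f x" if "r \<in> carrier R" "x \<in> carrier M" for r x
    using f that by (auto simp: mod_hom_def)
  have fminus: "f (x \<oplus>\<^bsub>M\<^esub> (\<ominus>\<^bsub>M\<^esub> y)) = f x \<oplus>\<^bsub>M'\<^esub> (\<ominus>\<^bsub>M'\<^esub> f y)" if "x \<in> carrier M" "y \<in> carrier M" for x y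
    using that A.mod_hom_uminus[OF B.M.abelian_group_axioms f] by (simp add: fadd)
  have eq: "N' +>\<^bsub>M'\<^esub> f x = N' +>\<^bsub>M'\<^esub> f y \<longleftrightarrow> N +>\<^bsub>M\<^esub> x = N +>\<^bsub>M\<^esub> y"
    if "x \<in> carrier M" "y \<in> carrier M" for x y
    using that f_N[of "x \<oplus>\<^bsub>M\<^esub> (\<ominus>\<^bsub>M\<^esub> y)"] inj[of "x \<oplus>\<^bsub>M\<^esub> (\<ominus>\<^bsub>M\<^esub> y)"]
    by (auto simp: A.coset_eq_iff B.coset_eq_iff fM fminus)
  define F where "F = (\<lambda>C. \<Union>x\<in>C. N' +>\<^bsub>M'\<^esub> f x)"
  have F: "F (N +>\<^bsub>M\<^esub> x) = N' +>\<^bsub>M'\<^esub> f x" if x: "x \<in> carrier M" for x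
  proof -
    have "N' +>\<^bsub>M'\<^esub> f y = N' +>\<^bsub>M'\<^esub> f x" if "y \<in> N +>\<^bsub>M\<^esub> x" for y
      using that x A.quot.a_elemrcos_carrier[OF x that] A.quot.a_repr_independence'[OF that x] eq by metis
    moreover have "x \<in> N +>\<^bsub>M\<^esub> x" using A.quot.a_rcos_self[OF x] .
    ultimately show ?thesis unfolding F_def by blast
  qed
  have "\<exists>x\<in>carrier M. N' +>\<^bsub>M'\<^esub> y = N' +>\<^bsub>M'\<^esub> f x" if "y \<in> carrier M'" for y
    using surj[OF that] that fM by (auto simp: B.coset_eq_iff)
  then have "bij_betw F (carrier (quotient_module M N)) (carrier (quotient_module M' N'))"
    by (auto simp: bij_betw_def inj_on_def A.quotient_module_simps B.quotient_module_simps F fM eq image_iff)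
  moreover have "F \<in> mod_hom R (quotient_module M N) (quotient_module M' N')"
    by (auto simp: mod_hom_def A.quotient_module_simps B.quotient_module_simps F fM fadd fsmult)
  ultimately show ?thesis
    unfolding module_isomorphic_def module_iso_def by blast
qed

text \<open>
  Tensor products are built as sets of cosets. Transport from a concrete module spares
  proving the laws for them directly.
\<close>

lemma abelian_group_transport:
  assumes "abelian_group M" and M': "carrier M' = f ` carrier M" and f0: "f \<zero>\<^bsub>M\<^esub> = \<zero>\<^bsub>M'\<^esub>"
    and add: "\<And>x y. \<lbrakk>x \<in> carrier M; y \<in> carrier M\<rbrakk> \<Longrightarrow> f x \<oplus>\<^bsub>M'\<^esub> f y = f (x \<oplus>\<^bsub>M\<^esub> y)"
  shows "abelian_group M'"
proof -
  interpret M: abelian_group M by fact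
  show ?thesis
  proof (rule abelian_groupI)
    fix y assume "y \<in> carrier M'"
    then obtain x where x: "x \<in> carrier M" "y = f x" using M' by auto
    have "f (\<ominus>\<^bsub>M\<^esub> x) \<oplus>\<^bsub>M'\<^esub> y = \<zero>\<^bsub>M'\<^esub>" using x by (simp add: add M.l_neg f0)
    then show "\<exists>z\<in>carrier M'. z \<oplus>\<^bsub>M'\<^esub> y = \<zero>\<^bsub>M'\<^esub>" using x M' by blast
  qed (auto simp: M' add f0[symmetric] M.add.m_ac)
qed

lemma module_transport:
  assumes "module R M" and f: "f \<in> module_iso R M M'" and f0: "f \<zero>\<^bsub>M\<^esub> = \<zero>\<^bsub>M'\<^esub>"
  shows "module R M'"
proof -
  interpret module R M by fact
  have M': "carrier M' = f ` carrier M"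
    using f by (auto simp: module_iso_def bij_betw_def)
  have add: "f x \<oplus>\<^bsub>M'\<^esub> f y = f (x \<oplus>\<^bsub>M\<^esub> y)" if "x \<in> carrier M" "y \<in> carrier M" for x y
    using f that by (auto simp: module_iso_def mod_hom_def)
  have smult: "r \<odot>\<^bsub>M'\<^esub> f x = f (r \<odot>\<^bsub>M\<^esub> x)" if "r \<in> carrier R" "x \<in> carrier M" for r x
    using f that by (auto simp: module_iso_def mod_hom_def)
  have "abelian_group M'"
    by (rule abelian_group_transport[OF M.abelian_group_axioms M' f0 add])
  then show ?thesis
    by (intro moduleI R.cring_axioms)
      (auto simp: M' add smult smult_l_distr smult_r_distr smult_assoc1)
qed

locale module_complex = module R K for R :: "('r, 's) ring_scheme" and K :: "('r, 'a, nat \<times> 'd) graded_module" +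
  fixes d :: "'a \<Rightarrow> 'a"
  assumes submodule_gr: "submodule (gr K (q, a)) R K"
    and d_hom: "d \<in> mod_hom R K K"
    and d_gr: "x \<in> gr K (Suc q, a) \<Longrightarrow> d x \<in> gr K (q, a)"
    and d_d: "x \<in> gr K (Suc q, a) \<Longrightarrow> d (d x) = \<zero>\<^bsub>K\<^esub>"
begin

definition cycles :: "nat \<Rightarrow> 'd \<Rightarrow> 'a set" where
  "cycles q a = {x \<in> gr K (q, a). d x = \<zero>\<^bsub>K\<^esub>}"

lemma gr_closed: "x \<in> gr K (q, a) \<Longrightarrow> x \<in> carrier K"
  using submoduleE(1)[OF submodule_gr] by blast

lemma d_closed: "x \<in> carrier K \<Longrightarrow> d x \<in> carrier K"
  and d_add: "\<lbrakk>x \<in> carrier K; y \<in> carrier K\<rbrakk> \<Longrightarrow> d (x \<oplus>\<^bsub>K\<^esub> y) = d x \<oplus>\<^bsub>K\<^esub> d y"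
  and d_smult: "\<lbrakk>r \<in> carrier R; x \<in> carrier K\<rbrakk> \<Longrightarrow> d (r \<odot>\<^bsub>K\<^esub> x) = r \<odot>\<^bsub>K\<^esub> d x"
  using d_hom by (auto simp: mod_hom_def)

lemma submodule_cycles: "submodule (cycles q a) R K"
proof (rule submoduleI)
  show "cycles q a \<subseteq> carrier K" using gr_closed by (auto simp: cycles_def)
  show "\<zero>\<^bsub>K\<^esub> \<in> cycles q a"
    using subgroup.one_closed[OF submodule.axioms(1)[OF submodule_gr]]
      mod_hom_zero[OF M.abelian_group_axioms d_hom] by (auto simp: cycles_def)
next
  fix x assume x: "x \<in> cycles q a"
  then have "x \<in> carrier K" using gr_closed by (auto simp: cycles_def)
  then show "\<ominus>\<^bsub>K\<^esub> x \<in> cycles q a"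
    using submoduleE(3)[OF submodule_gr, of x q a] mod_hom_uminus[OF M.abelian_group_axioms d_hom, of x] x
    by (auto simp: cycles_def)
next
  fix x y assume "x \<in> cycles q a" "y \<in> cycles q a"
  then show "x \<oplus>\<^bsub>K\<^esub> y \<in> cycles q a"
    using submoduleE(5)[OF submodule_gr, of x q a y] gr_closed by (auto simp: cycles_def d_add)
next
  fix r x assume "r \<in> carrier R" "x \<in> cycles q a"
  then show "r \<odot>\<^bsub>K\<^esub> x \<in> cycles q a"
    using submoduleE(4)[OF submodule_gr, of r x q a] gr_closed by (auto simp: cycles_def d_smult)
qed

lemma module_cycles: "module R (K\<lparr>carrier := cycles q a\<rparr>)"
  using submodule.submodule_is_module[OF submodule_cycles module_axioms] .

lemma boundary_in_cycles: "x \<in> gr K (Suc q, a) \<Longrightarrow> d x \<in> cycles q a"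
  by (auto simp: cycles_def d_gr d_d)

lemma a_inv_cycles [simp]:
  "\<ominus>\<^bsub>K\<lparr>carrier := cycles q a\<rparr>\<^esub> x = \<ominus>\<^bsub>K\<^esub> x" if "x \<in> cycles q a"
proof -
  interpret Z: module R "K\<lparr>carrier := cycles q a\<rparr>" by (rule module_cycles)
  have "\<ominus>\<^bsub>K\<^esub> x \<in> cycles q a" using submoduleE(3)[OF submodule_cycles that] .
  moreover have "x \<in> carrier K" using that gr_closed by (auto simp: cycles_def)
  ultimately show ?thesis using that by (intro Z.M.a_inv_eqI) (simp_all add: M.r_neg)
qed

lemma homology_setup: "module_with_submodule R (K\<lparr>carrier := cycles q a\<rparr>) (d ` gr K (Suc q, a))"
proof -
  interpret Z: module R "K\<lparr>carrier := cycles q a\<rparr>" by (rule module_cycles)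
  have "submodule (d ` gr K (Suc q, a)) R (K\<lparr>carrier := cycles q a\<rparr>)"
  proof (rule Z.submoduleI)
    show "d ` gr K (Suc q, a) \<subseteq> carrier (K\<lparr>carrier := cycles q a\<rparr>)"
      using boundary_in_cycles by auto
    have "\<zero>\<^bsub>K\<^esub> \<in> gr K (Suc q, a)" "d \<zero>\<^bsub>K\<^esub> = \<zero>\<^bsub>K\<^esub>"
      using subgroup.one_closed[OF submodule.axioms(1)[OF submodule_gr]]
        mod_hom_zero[OF M.abelian_group_axioms d_hom] by auto
    then show "\<zero>\<^bsub>K\<lparr>carrier := cycles q a\<rparr>\<^esub> \<in> d ` gr K (Suc q, a)"
      by (simp add: image_iff) metis
  next
    fix x assume "x \<in> d ` gr K (Suc q, a)"
    then obtain y where y: "y \<in> gr K (Suc q, a)" "x = d y" by auto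
    then have "\<ominus>\<^bsub>K\<^esub> y \<in> gr K (Suc q, a)" using submoduleE(3)[OF submodule_gr] by blast
    moreover have "d (\<ominus>\<^bsub>K\<^esub> y) = \<ominus>\<^bsub>K\<^esub> x"
      using mod_hom_uminus[OF M.abelian_group_axioms d_hom] y gr_closed by auto
    ultimately show "\<ominus>\<^bsub>K\<lparr>carrier := cycles q a\<rparr>\<^esub> x \<in> d ` gr K (Suc q, a)"
      using y boundary_in_cycles by (metis a_inv_cycles imageI)
  next
    fix x y assume "x \<in> d ` gr K (Suc q, a)" "y \<in> d ` gr K (Suc q, a)"
    then obtain u v where "u \<in> gr K (Suc q, a)" "x = d u" "v \<in> gr K (Suc q, a)" "y = d v" by auto
    then show "x \<oplus>\<^bsub>K\<lparr>carrier := cycles q a\<rparr>\<^esub> y \<in> d ` gr K (Suc q, a)"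
      using submoduleE(5)[OF submodule_gr, of u "Suc q" a v] gr_closed d_add[of u v]
      by (auto simp: image_iff intro: sym)
  next
    fix r x assume "r \<in> carrier R" "x \<in> d ` gr K (Suc q, a)"
    moreover from this obtain u where "u \<in> gr K (Suc q, a)" "x = d u" by auto
    ultimately show "r \<odot>\<^bsub>K\<lparr>carrier := cycles q a\<rparr>\<^esub> x \<in> d ` gr K (Suc q, a)"
      using submoduleE(4)[OF submodule_gr, of r u "Suc q" a] gr_closed d_smult[of r u]
      by (auto simp: image_iff intro: sym)
  qed
  then show ?thesis by (intro module_with_submodule.intro module_cycles)
qed

lemma homology_eq: "homology K d q a = quotient_module (K\<lparr>carrier := cycles q a\<rparr>) (d ` gr K (Suc q, a))"
  by (simp add: homology_def cycles_def)

end

text \<open>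
  For a map \<open>f\<close> with homotopy inverse \<open>g\<close> the last two premises are immediate: if \<open>f x = d' y\<close>, then
  \<open>g y\<close>, corrected by the homotopy, has boundary \<open>x\<close>; and \<open>g y\<close> is a preimage of the class of \<open>y\<close>.
\<close>

lemma homology_isomorphicI:
  assumes "module_complex R K d" "module_complex R K' d'"
    and f: "f \<in> mod_hom R K K'"
    and f_gr: "\<And>x. x \<in> gr K (q, a) \<Longrightarrow> f x \<in> gr K' (q, a')"
      "\<And>x. x \<in> gr K (Suc q, a) \<Longrightarrow> f x \<in> gr K' (Suc q, a')"
    and f_d: "\<And>x. x \<in> gr K (q, a) \<Longrightarrow> f (d x) = d' (f x)"
      "\<And>x. x \<in> gr K (Suc q, a) \<Longrightarrow> f (d x) = d' (f x)"
    and inj: "\<And>x y. \<lbrakk>x \<in> gr K (q, a); d x = \<zero>\<^bsub>K\<^esub>; y \<in> gr K' (Suc q, a'); f x = d' y\<rbrakk>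
      \<Longrightarrow> x \<in> d ` gr K (Suc q, a)"
    and surj: "\<And>y. \<lbrakk>y \<in> gr K' (q, a'); d' y = \<zero>\<^bsub>K'\<^esub>\<rbrakk>
      \<Longrightarrow> \<exists>x\<in>gr K (q, a). d x = \<zero>\<^bsub>K\<^esub> \<and> y \<oplus>\<^bsub>K'\<^esub> (\<ominus>\<^bsub>K'\<^esub> f x) \<in> d' ` gr K' (Suc q, a')"
  shows "module_isomorphic R (homology K d q a) (homology K' d' q a')"
proof -
  interpret K: module_complex R K d by fact
  interpret K': module_complex R K' d' by fact
  have f_Z: "f x \<in> K'.cycles q a'" if "x \<in> K.cycles q a" for x
    using that f_gr f_d(1)[of x] K.mod_hom_zero[OF K'.M.abelian_group_axioms f]
    by (auto simp: K.cycles_def K'.cycles_def)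
  show ?thesis
    unfolding K.homology_eq K'.homology_eq
  proof (rule quotient_module_isomorphic[OF K.homology_setup K'.homology_setup])
    show "f \<in> mod_hom R (K\<lparr>carrier := K.cycles q a\<rparr>) (K'\<lparr>carrier := K'.cycles q a'\<rparr>)"
      using f f_Z K.gr_closed by (auto simp: mod_hom_def K.cycles_def)
  next
    fix x assume "x \<in> d ` gr K (Suc q, a)"
    then show "f x \<in> d' ` gr K' (Suc q, a')" using f_gr f_d by auto
  next
    fix x assume "x \<in> carrier (K\<lparr>carrier := K.cycles q a\<rparr>)" "f x \<in> d' ` gr K' (Suc q, a')"
    then show "x \<in> d ` gr K (Suc q, a)" using inj by (auto simp: K.cycles_def)
  next
    fix y assume "y \<in> carrier (K'\<lparr>carrier := K'.cycles q a'\<rparr>)"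
    then have y: "y \<in> gr K' (q, a')" "d' y = \<zero>\<^bsub>K'\<^esub>" by (auto simp: K'.cycles_def)
    obtain x where x: "x \<in> gr K (q, a)" "d x = \<zero>\<^bsub>K\<^esub>"
        "y \<oplus>\<^bsub>K'\<^esub> (\<ominus>\<^bsub>K'\<^esub> f x) \<in> d' ` gr K' (Suc q, a')"
      using surj[OF y] by blast
    then have "x \<in> K.cycles q a" by (simp add: K.cycles_def)
    with x f_Z show "\<exists>x\<in>carrier (K\<lparr>carrier := K.cycles q a\<rparr>).
        y \<oplus>\<^bsub>K'\<lparr>carrier := K'.cycles q a'\<rparr>\<^esub> (\<ominus>\<^bsub>K'\<lparr>carrier := K'.cycles q a'\<rparr>\<^esub> f x) \<in> d' ` gr K' (Suc q, a')"
      by (intro bexI[of _ x]) simp_all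
  qed
qed

lemma module_complex_transport:
  assumes "module_complex R K d" and f: "f \<in> module_iso R K K'" and f0: "f \<zero>\<^bsub>K\<^esub> = \<zero>\<^bsub>K'\<^esub>"
    and gr: "\<And>q a. gr K' (q, a) = f ` gr K (q, a)"
    and d': "\<And>x. x \<in> carrier K \<Longrightarrow> d' (f x) = f (d x)"
  shows "module_complex R K' d'" "module_isomorphic R (homology K d q a) (homology K' d' q a)"
proof -
  interpret K: module_complex R K d by fact
  interpret K': module R K' by (rule module_transport[OF K.module_axioms f f0])
  have fh: "f \<in> mod_hom R K K'" and bij: "bij_betw f (carrier K) (carrier K')"
    using f by (auto simp: module_iso_def)
  have K': "carrier K' = f ` carrier K" using bij by (auto simp: bij_betw_def)
  have add: "f x \<oplus>\<^bsub>K'\<^esub> f y = f (x \<oplus>\<^bsub>K\<^esub> y)" if "x \<in> carrier K" "y \<in> carrier K" for x y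
    using fh that by (auto simp: mod_hom_def)
  have smult: "r \<odot>\<^bsub>K'\<^esub> f x = f (r \<odot>\<^bsub>K\<^esub> x)" if "r \<in> carrier R" "x \<in> carrier K" for r x
    using fh that by (auto simp: mod_hom_def)
  have neg: "\<ominus>\<^bsub>K'\<^esub> f x = f (\<ominus>\<^bsub>K\<^esub> x)" if "x \<in> carrier K" for x
    using K.mod_hom_uminus[OF K'.M.abelian_group_axioms fh that] by simp
  have "submodule (gr K' (q, a)) R K'" for q a
  proof -
    have sub: "submodule (gr K (q, a)) R K" by (rule K.submodule_gr)
    note E = K.submoduleE(3-5)[OF sub] subgroup.one_closed[OF submodule.axioms(1)[OF sub]]
    show ?thesis
      using E by (intro K'.submoduleI) (auto simp: gr K' add smult neg f0[symmetric] K.gr_closed)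
  qed
  moreover have "d' \<in> mod_hom R K' K'"
    by (auto simp: mod_hom_def K' add smult d' K.d_closed K.d_add K.d_smult)
  ultimately show K'_complex: "module_complex R K' d'"
    by (intro module_complex.intro module_complex_axioms.intro K'.module_axioms)
      (auto simp: gr d' K.d_closed K.d_gr K.d_d K.gr_closed f0)
  have "f x = f y \<longleftrightarrow> x = y" if "x \<in> carrier K" "y \<in> carrier K" for x y
    using bij that by (auto simp: bij_betw_def inj_on_def)
  then have inj: "x \<in> d ` gr K (Suc q, a)"
    if "x \<in> gr K (q, a)" "y \<in> gr K' (Suc q, a)" "f x = d' y" for x y
    using that K.gr_closed K.d_closed d' unfolding gr by (metis (no_types, lifting) imageE imageI)
  have surj: "\<exists>x\<in>gr K (q, a). d x = \<zero>\<^bsub>K\<^esub> \<and> y \<oplus>\<^bsub>K'\<^esub> (\<ominus>\<^bsub>K'\<^esub> f x) \<in> d' ` gr K' (Suc q, a)"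
    if y: "y \<in> gr K' (q, a)" "d' y = \<zero>\<^bsub>K'\<^esub>" for y
  proof -
    obtain x where x: "x \<in> gr K (q, a)" "y = f x" using y gr by auto
    then have "f (d x) = f \<zero>\<^bsub>K\<^esub>" using y d' K.gr_closed f0 by auto
    then have "d x = \<zero>\<^bsub>K\<^esub>"
      using bij x K.gr_closed K.d_closed by (auto simp: bij_betw_def inj_on_def)
    moreover have "y \<oplus>\<^bsub>K'\<^esub> (\<ominus>\<^bsub>K'\<^esub> f x) \<in> d' ` gr K' (Suc q, a)"
    proof -
      have z: "\<zero>\<^bsub>K\<^esub> \<in> gr K (Suc q, a)"
        using subgroup.one_closed[OF submodule.axioms(1)[OF K.submodule_gr]] by auto
      have "y \<oplus>\<^bsub>K'\<^esub> (\<ominus>\<^bsub>K'\<^esub> f x) = \<zero>\<^bsub>K'\<^esub>"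
        using x K.gr_closed K' by (auto intro!: K'.M.r_neg)
      also have "\<dots> = d' (f \<zero>\<^bsub>K\<^esub>)"
        using K.mod_hom_zero[OF K.M.abelian_group_axioms K.d_hom] d'[of "\<zero>\<^bsub>K\<^esub>"] by (simp add: f0)
      finally show ?thesis using z gr by blast
    qed
    ultimately show ?thesis using x by blast
  qed
  show "module_isomorphic R (homology K d q a) (homology K' d' q a)"
    by (rule homology_isomorphicI[OF assms(1) K'_complex fh _ _ _ _ inj surj])
      (auto simp: gr d' K.gr_closed)
qed

section \<open>Tensoring a free module with the ground ring\<close>

lemma graded_free_module_simps [simp]:
  "carrier (graded_free_module m B dg) = carrier (free_module (mpoly_ring m) B)"
  "add (graded_free_module m B dg) = (+)"
  "ring.zero (graded_free_module m B dg) = 0"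
  "module.smult (graded_free_module m B dg) = pm_scale"
  by (simp_all add: graded_free_module_def with_grading_def module.defs graded_module.defs free_module_def)

lemma base_module_simps [simp]:
  "carrier base_module = UNIV"
  "add base_module = (+)"
  "ring.zero base_module = 0"
  "module.smult base_module = (\<lambda>p c. Poly_Mapping.lookup p 0 * c)"
  "gr base_module a = (if a = 0 then UNIV else {0})"
  by (simp_all add: base_module_def)

text \<open>
  The bilinear pairing that sends \<open>x \<otimes> y\<close> to \<open>y\<close> times the constant part of \<open>x\<close>, extended to the free
  module of which the tensor product is a quotient. Its fibres turn out to be the elements of
  \<open>F \<otimes> k\<close>.
\<close>

definition tensor_value :: "(('b \<Rightarrow>\<^sub>0 'k::comm_ring_1 mpoly) \<times> 'k \<Rightarrow>\<^sub>0 'k mpoly) \<Rightarrow> ('b \<Rightarrow>\<^sub>0 'k)" where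
  "tensor_value z = lin_ext (\<lambda>(x, y). pm_scale y (const_part x)) (const_part z)"

lemma tensor_value_add: "tensor_value (z + w) = tensor_value z + tensor_value w"
  by (simp add: tensor_value_def const_part_add lin_ext_add)

lemma tensor_value_diff: "tensor_value (z - w) = tensor_value z - tensor_value w"
  by (simp add: tensor_value_def const_part_diff lin_ext_diff)

lemma tensor_value_pm_scale: "tensor_value (pm_scale p z) = pm_scale (Poly_Mapping.lookup p 0) (tensor_value z)"
  by (simp add: tensor_value_def const_part_pm_scale lin_ext_scale)

lemma tensor_value_single [simp]:
  "tensor_value (Poly_Mapping.single (x, y) p) = pm_scale (Poly_Mapping.lookup p 0 * y) (const_part x)"
  by (simp add: tensor_value_def pm_scale_assoc)

lemma tensor_value_zero [simp]: "tensor_value 0 = 0"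
  by (simp add: tensor_value_def)

lemma keys_tensor_value:
  assumes "z \<in> carrier (free_module R (carrier (free_module S B) \<times> A))"
  shows "Poly_Mapping.keys (tensor_value z) \<subseteq> B"
proof -
  have "Poly_Mapping.keys (pm_scale y (const_part x)) \<subseteq> B" if "(x, y) \<in> Poly_Mapping.keys (const_part z)" for x y
  proof -
    have "(x, y) \<in> Poly_Mapping.keys z" using that keys_const_part[of z] by blast
    then have "x \<in> carrier (free_module S B)" using assms by (auto simp: mem_free_module[of z])
    then have "Poly_Mapping.keys x \<subseteq> B" by (simp add: mem_free_module)
    then show ?thesis using keys_pm_scale[of y "const_part x"] keys_const_part[of x] by blast
  qed
  then show ?thesis
    unfolding tensor_value_def
    using keys_lin_ext[of "\<lambda>(x, y). pm_scale y (const_part x)" "const_part z"] by fast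
qed

lemma const_coeffs_closed:
  assumes "Poly_Mapping.keys g \<subseteq> B"
  shows "const_coeffs (g :: 'b \<Rightarrow>\<^sub>0 'k::comm_ring_1) \<in> carrier (free_module (mpoly_ring m) B)"
  using assms by (simp add: mem_free_module lookup_const_coeffs mpoly_closed)

text \<open>
  Every formal tensor can be brought to the normal form \<open>g \<otimes> 1\<close> by the bilinearity relations alone.
  The coefficient and the second factor are moved into the first factor through the action on \<open>k\<close>;
  then each coefficient \<open>p\<close> of the first factor can be replaced by its constant term, because both
  act on \<open>1\<close> in the same way. Hence two tensors with equal value are congruent modulo any submodule
  that contains the relations.
\<close>

lemma tensor_kernel_subset:
  fixes B :: "'b set" and m :: nat
  defines "W \<equiv> carrier (free_module (mpoly_ring m :: 'k::comm_ring_1 mpoly ring)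
      (carrier (free_module (mpoly_ring m) B) \<times> (UNIV :: 'k set)))"
  assumes S: "submodule S (mpoly_ring m) (free_module (mpoly_ring m) (carrier (free_module (mpoly_ring m) B) \<times> UNIV))"
    and rel: "tensor_relations (mpoly_ring m) (graded_free_module m B dg) base_module \<subseteq> S"
    and z: "z \<in> W"
  shows "z - Poly_Mapping.single (const_coeffs (tensor_value z), 1) 1 \<in> S"
proof -
  let ?R = "mpoly_ring m :: 'k mpoly ring"
  let ?F = "carrier (free_module ?R B)"
  interpret W: module ?R "free_module ?R (?F \<times> UNIV)" by (rule module_free_mpoly)
  interpret F: module ?R "free_module ?R B" by (rule module_free_mpoly)
  define E where "E x = (Poly_Mapping.single (x, 1) 1 :: ('b \<Rightarrow>\<^sub>0 'k mpoly) \<times> 'k \<Rightarrow>\<^sub>0 'k mpoly)" for x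
  have SW: "S \<subseteq> carrier (free_module ?R (?F \<times> UNIV))" using W.submoduleE(1)[OF S] .
  have S_add: "x + y \<in> S" if "x \<in> S" "y \<in> S" for x y
    using W.submoduleE(5)[OF S that] by simp
  have S_neg: "- x \<in> S" if "x \<in> S" for x
    using W.submoduleE(3)[OF S that] a_inv_free_module[OF module_free_mpoly subsetD[OF SW that]] by simp
  have S_diff: "x - y \<in> S" if "x \<in> S" "y \<in> S" for x y
    using S_add[OF that(1) S_neg[OF that(2)]] by simp
  have S_scale: "pm_scale p x \<in> S" if "p \<in> carrier ?R" "x \<in> S" for p x
    using W.submoduleE(4)[OF S that] by simp
  have S_0: "0 \<in> S"
    using subgroup.one_closed[OF submodule.axioms(1)[OF S]] by simp
  have F_add: "x + y \<in> ?F" if "x \<in> ?F" "y \<in> ?F" for x y using F.M.a_closed[OF that] by simp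
  have F_scale: "pm_scale p x \<in> ?F" if "p \<in> carrier ?R" "x \<in> ?F" for p x
    using F.smult_closed[OF that] by simp
  have rel_add: "Poly_Mapping.single (x + x', y) 1 - Poly_Mapping.single (x, y) 1 - Poly_Mapping.single (x', y) 1 \<in> S"
    if "x \<in> ?F" "x' \<in> ?F" for x x' y
    using rel that unfolding tensor_relations_def by simp blast
  have rel_l: "Poly_Mapping.single (pm_scale p x, y) 1 - Poly_Mapping.single (x, y) p \<in> S"
    if "p \<in> carrier ?R" "x \<in> ?F" for p x y
    using rel that unfolding tensor_relations_def by simp blast
  have rel_r: "Poly_Mapping.single (x, Poly_Mapping.lookup p 0 * y) 1 - Poly_Mapping.single (x, y) p \<in> S"
    if "p \<in> carrier ?R" "x \<in> ?F" for p x y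
    using rel that unfolding tensor_relations_def by simp blast
  \<comment> \<open>Both \<open>p x \<otimes> 1\<close> and \<open>p(0) x \<otimes> 1\<close> are congruent to \<open>x \<otimes> p(0)\<close>.\<close>
  have E_const: "E (pm_scale p x) - E (pm_scale (Poly_Mapping.single 0 (Poly_Mapping.lookup p 0)) x) \<in> S"
    if p: "p \<in> carrier ?R" and x: "x \<in> ?F" for p x
  proof -
    let ?q = "Poly_Mapping.single 0 (Poly_Mapping.lookup p 0)"
    have q: "?q \<in> carrier ?R" by (simp add: mpoly_closed)
    let ?w = "Poly_Mapping.single (x, Poly_Mapping.lookup p 0) 1"
    have 1: "(E (pm_scale p x) - Poly_Mapping.single (x, 1) p) - (?w - Poly_Mapping.single (x, 1) p) \<in> S"
      using S_diff[OF rel_l[OF p x, of 1] rel_r[OF p x, of 1]] by (simp add: E_def)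
    have 2: "(E (pm_scale ?q x) - Poly_Mapping.single (x, 1) ?q) - (?w - Poly_Mapping.single (x, 1) ?q) \<in> S"
      using S_diff[OF rel_l[OF q x, of 1] rel_r[OF q x, of 1]] by (simp add: E_def)
    show ?thesis using S_diff[OF 1 2] by simp
  qed
  have E_const_part: "E x - E (const_coeffs (const_part x)) \<in> S \<and> x \<in> ?F" if x: "x \<in> ?F" for x
  proof (rule poly_mapping_induct_on[where f = x and B = B and C = "carrier ?R"])
    show "\<And>b. b \<in> Poly_Mapping.keys x \<Longrightarrow> b \<in> B \<and> Poly_Mapping.lookup x b \<in> carrier ?R"
      using x by (auto simp: mem_free_module)
    show "E 0 - E (const_coeffs (const_part 0)) \<in> S \<and> 0 \<in> ?F"
      using S_0 F.M.zero_closed by simp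
  next
    fix b and p :: "'k mpoly" assume b: "b \<in> B" "p \<in> carrier ?R"
    have "Poly_Mapping.single b 1 \<in> ?F" "Poly_Mapping.single b p \<in> ?F"
      using b by (auto simp: mem_free_module lookup_single when_def mpoly_closed)
    with E_const[OF b(2) this(1)]
    show "E (Poly_Mapping.single b p) - E (const_coeffs (const_part (Poly_Mapping.single b p))) \<in> S \<and>
        Poly_Mapping.single b p \<in> ?F"
      by simp
  next
    fix x y assume x: "E x - E (const_coeffs (const_part x)) \<in> S \<and> x \<in> ?F"
      and y: "E y - E (const_coeffs (const_part y)) \<in> S \<and> y \<in> ?F"
    have cc: "const_coeffs (const_part x) \<in> ?F" if "x \<in> ?F" for x
      using that keys_const_part[of x] by (intro const_coeffs_closed) (auto simp: mem_free_module)
    have 1: "E (x + y) - E x - E y \<in> S"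
      using x y rel_add[of x y 1] by (simp add: E_def)
    have 2: "E (const_coeffs (const_part (x + y))) - E (const_coeffs (const_part x)) - E (const_coeffs (const_part y)) \<in> S"
      using x y rel_add[of "const_coeffs (const_part x)" "const_coeffs (const_part y)" 1] cc
      by (simp add: E_def const_part_add const_coeffs_add)
    have "(E (x + y) - E x - E y)
        - (E (const_coeffs (const_part (x + y))) - E (const_coeffs (const_part x)) - E (const_coeffs (const_part y)))
        + ((E x - E (const_coeffs (const_part x))) + (E y - E (const_coeffs (const_part y)))) \<in> S"
      using S_add[OF S_diff[OF 1 2] S_add] x y by blast
    also have "(E (x + y) - E x - E y)
        - (E (const_coeffs (const_part (x + y))) - E (const_coeffs (const_part x)) - E (const_coeffs (const_part y)))
        + ((E x - E (const_coeffs (const_part x))) + (E y - E (const_coeffs (const_part y))))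
        = E (x + y) - E (const_coeffs (const_part (x + y)))"
      by simp
    finally show "E (x + y) - E (const_coeffs (const_part (x + y))) \<in> S \<and> x + y \<in> ?F"
      using x y F_add by simp
  qed
  have single: "Poly_Mapping.single (x, y) p - E (const_coeffs (tensor_value (Poly_Mapping.single (x, y) p))) \<in> S"
    if x: "x \<in> ?F" and p: "p \<in> carrier ?R" for x y p
  proof -
    let ?c = "Poly_Mapping.lookup p 0 * y"
    let ?q = "Poly_Mapping.single 0 ?c"
    have q: "?q \<in> carrier ?R" by (simp add: mpoly_closed)
    let ?w = "Poly_Mapping.single (x, ?c) 1"
    have 1: "(Poly_Mapping.single (pm_scale ?q x, 1) 1 - Poly_Mapping.single (x, 1) ?q)
        - (?w - Poly_Mapping.single (x, 1) ?q) \<in> S"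
      using S_diff[OF rel_l[OF q x, of 1] rel_r[OF q x, of 1]] by simp
    have "- (?w - Poly_Mapping.single (x, y) p) -
        ((Poly_Mapping.single (pm_scale ?q x, 1) 1 - Poly_Mapping.single (x, 1) ?q)
        - (?w - Poly_Mapping.single (x, 1) ?q)) \<in> S"
      by (rule S_diff[OF S_neg[OF rel_r[OF p x, of y]] 1])
    then have "Poly_Mapping.single (x, y) p - E (pm_scale ?q x) \<in> S" by (simp add: E_def)
    moreover have "E (pm_scale ?q x) - E (const_coeffs (const_part (pm_scale ?q x))) \<in> S"
      using E_const_part F_scale[OF q x] by blast
    ultimately have "(Poly_Mapping.single (x, y) p - E (pm_scale ?q x)) +
        (E (pm_scale ?q x) - E (const_coeffs (const_part (pm_scale ?q x)))) \<in> S"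
      by (rule S_add)
    then show ?thesis by (simp add: const_part_pm_scale)
  qed
  have "z - E (const_coeffs (tensor_value z)) \<in> S \<and> z \<in> W"
  proof (rule poly_mapping_induct_on[where f = z and B = "?F \<times> UNIV" and C = "carrier ?R"])
    show "\<And>b. b \<in> Poly_Mapping.keys z \<Longrightarrow> b \<in> ?F \<times> UNIV \<and> Poly_Mapping.lookup z b \<in> carrier ?R"
      using z by (auto simp: mem_free_module[of z] W_def)
    show "0 - E (const_coeffs (tensor_value 0)) \<in> S \<and> 0 \<in> W"
      using single[of 0 0 0] F.M.zero_closed W.M.zero_closed W.R.zero_closed by (simp add: W_def)
  next
    fix b and p :: "'k mpoly" assume b: "b \<in> ?F \<times> (UNIV :: 'k set)" "p \<in> carrier ?R"
    moreover have "Poly_Mapping.single b p \<in> W"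
      using b by (auto simp: mem_free_module[of _ _ "?F \<times> UNIV"] lookup_single when_def mpoly_closed W_def)
    ultimately show "Poly_Mapping.single b p - E (const_coeffs (tensor_value (Poly_Mapping.single b p))) \<in> S \<and>
        Poly_Mapping.single b p \<in> W"
      using single by (cases b) auto
  next
    fix x y assume x: "x - E (const_coeffs (tensor_value x)) \<in> S \<and> x \<in> W"
      and y: "y - E (const_coeffs (tensor_value y)) \<in> S \<and> y \<in> W"
    have cc: "const_coeffs (tensor_value x) \<in> ?F" if "x \<in> W" for x
      using that keys_tensor_value unfolding W_def by (intro const_coeffs_closed) blast
    have "E (const_coeffs (tensor_value (x + y))) - E (const_coeffs (tensor_value x)) - E (const_coeffs (tensor_value y)) \<in> S"
      using x y rel_add[of "const_coeffs (tensor_value x)" "const_coeffs (tensor_value y)" 1] cc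
      by (simp add: E_def tensor_value_add const_coeffs_add)
    with x y S_add have "((x - E (const_coeffs (tensor_value x))) + (y - E (const_coeffs (tensor_value y))))
        - (E (const_coeffs (tensor_value (x + y))) - E (const_coeffs (tensor_value x)) - E (const_coeffs (tensor_value y))) \<in> S"
      by (intro S_diff[OF S_add]) blast+
    also have "((x - E (const_coeffs (tensor_value x))) + (y - E (const_coeffs (tensor_value y))))
        - (E (const_coeffs (tensor_value (x + y))) - E (const_coeffs (tensor_value x)) - E (const_coeffs (tensor_value y)))
        = x + y - E (const_coeffs (tensor_value (x + y)))"
      by simp
    finally show "x + y - E (const_coeffs (tensor_value (x + y))) \<in> S \<and> x + y \<in> W"
      using x y W.M.a_closed[of x y] by (simp add: W_def)
  qed
  then show ?thesis by (simp add: E_def)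
qed

lemma submodule_tensor_value_zero:
  fixes B :: "'b set"
  shows "submodule {z \<in> carrier (free_module (mpoly_ring m :: 'k::comm_ring_1 mpoly ring)
        (carrier (free_module (mpoly_ring m) B) \<times> (UNIV :: 'k set))). tensor_value z = 0}
     (mpoly_ring m) (free_module (mpoly_ring m) (carrier (free_module (mpoly_ring m) B) \<times> UNIV))"
    (is "submodule ?N _ _")
proof -
  let ?R = "mpoly_ring m :: 'k mpoly ring"
  let ?F = "carrier (free_module ?R B)"
  interpret W: module ?R "free_module ?R (?F \<times> (UNIV :: 'k set))" by (rule module_free_mpoly)
  show "submodule ?N ?R (free_module ?R (?F \<times> UNIV))"
  proof (rule W.submoduleI)
    show "\<zero>\<^bsub>free_module ?R (?F \<times> UNIV)\<^esub> \<in> ?N" using W.M.zero_closed by simp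
  next
    fix z assume z: "z \<in> ?N"
    then show "\<ominus>\<^bsub>free_module ?R (?F \<times> UNIV)\<^esub> z \<in> ?N"
      using W.M.a_inv_closed[of z] a_inv_free_module[OF module_free_mpoly, of z]
        tensor_value_diff[of 0 z] by auto
  next
    fix z w assume "z \<in> ?N" "w \<in> ?N"
    then show "z \<oplus>\<^bsub>free_module ?R (?F \<times> UNIV)\<^esub> w \<in> ?N"
      using W.M.a_closed[of z w] by (simp add: tensor_value_add)
  next
    fix p z assume "p \<in> carrier ?R" "z \<in> ?N"
    then show "p \<odot>\<^bsub>free_module ?R (?F \<times> UNIV)\<^esub> z \<in> ?N"
      using W.smult_closed[of p z] by (simp add: tensor_value_pm_scale)
  qed auto
qed

text \<open>
  The relations have value zero, which gives one inclusion; the other one is the normal form above,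
  applied to \<open>z\<close> and to \<open>0\<close>, whose normal forms coincide.
\<close>

lemma tensor_kernel_eq:
  fixes B :: "'b set"
  shows "tensor_kernel (mpoly_ring m :: 'k::comm_ring_1 mpoly ring) (graded_free_module m B dg) base_module =
     {z \<in> carrier (free_module (mpoly_ring m) (carrier (free_module (mpoly_ring m) B) \<times> UNIV)).
        tensor_value z = 0}" (is "?T = ?N")
proof
  let ?R = "mpoly_ring m :: 'k mpoly ring"
  let ?F = "carrier (free_module ?R B)"
  interpret W: module ?R "free_module ?R (?F \<times> (UNIV :: 'k set))" by (rule module_free_mpoly)
  interpret F: module ?R "free_module ?R B" by (rule module_free_mpoly)
  have sing: "Poly_Mapping.single (x, y) p \<in> carrier (free_module ?R (?F \<times> UNIV))"
    if "x \<in> ?F" "p \<in> carrier ?R" for x p and y :: 'k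
    using that by (auto simp: mem_free_module[of _ _ "?F \<times> UNIV"] lookup_single when_def mpoly_closed)
  have diff: "u - v \<in> carrier (free_module ?R (?F \<times> UNIV))"
    if "u \<in> carrier (free_module ?R (?F \<times> UNIV))" "v \<in> carrier (free_module ?R (?F \<times> UNIV))"
    for u v :: "('b \<Rightarrow>\<^sub>0 'k mpoly) \<times> 'k \<Rightarrow>\<^sub>0 'k mpoly"
    using W.M.a_closed[OF that(1) W.M.a_inv_closed[OF that(2)]] a_inv_free_module[OF module_free_mpoly that(2)] by simp
  have F_add: "x + y \<in> ?F" if "x \<in> ?F" "y \<in> ?F" for x y using F.M.a_closed[OF that] by simp
  have F_scale: "pm_scale p x \<in> ?F" if "p \<in> carrier ?R" "x \<in> ?F" for p x
    using F.smult_closed[OF that] by simp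
  have 1: "(1 :: 'k mpoly) \<in> carrier ?R" by (rule mpoly_closed)
  have zeroW: "0 \<in> carrier (free_module ?R (?F \<times> (UNIV :: 'k set)))" using W.M.zero_closed by simp
  have "submodule ?N ?R (free_module ?R (?F \<times> UNIV))" by (rule submodule_tensor_value_zero)
  moreover have "tensor_relations ?R (graded_free_module m B dg) base_module \<subseteq> ?N"
    unfolding tensor_relations_def
    by (auto intro!: diff sing F_add F_scale 1 simp: tensor_value_diff const_part_add const_part_pm_scale
        pm_scale_add_right pm_scale_add pm_scale_assoc mult.commute)
  ultimately show "?T \<subseteq> ?N"
    unfolding tensor_kernel_def by auto
  show "?N \<subseteq> ?T"
    unfolding tensor_kernel_def
  proof (intro subsetI InterI)
    fix z S assume z: "z \<in> ?N"
      and "S \<in> {S. submodule S ?R (free_module ?R (carrier (graded_free_module m B dg) \<times> carrier base_module)) \<and>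
        tensor_relations ?R (graded_free_module m B dg) base_module \<subseteq> S}"
    then have S: "submodule S ?R (free_module ?R (?F \<times> UNIV))"
      and rel: "tensor_relations ?R (graded_free_module m B dg) base_module \<subseteq> S"
      by auto
    have "z - Poly_Mapping.single (0, 1) 1 \<in> S"
      using tensor_kernel_subset[OF S rel, of z] z by simp
    moreover have "0 - Poly_Mapping.single (0, 1) 1 \<in> S"
      using tensor_kernel_subset[OF S rel, of 0] W.M.zero_closed by simp
    ultimately have "z - Poly_Mapping.single (0, 1) 1 \<oplus>\<^bsub>free_module ?R (?F \<times> UNIV)\<^esub>
        (\<ominus>\<^bsub>free_module ?R (?F \<times> UNIV)\<^esub> (0 - Poly_Mapping.single (0, 1) 1)) \<in> S"
      using W.submoduleE(3,5)[OF S] by blast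
    moreover have "Poly_Mapping.single (0, 1) 1 \<in> carrier (free_module ?R (?F \<times> (UNIV :: 'k set)))"
      using sing F.M.zero_closed 1 by simp
    ultimately show "z \<in> S"
      using a_inv_free_module[OF module_free_mpoly diff[OF zeroW], of "Poly_Mapping.single (0, 1) 1"]
      by simp
  qed
qed

text \<open>
  The free \<open>k\<close>-module that \<open>F \<otimes> k\<close> is identified with, bigraded by the degrees of the basis elements.
\<close>

definition reduced_module :: "'b set \<Rightarrow> ('b \<Rightarrow> nat \<times> expo) \<Rightarrow> ('k::comm_ring_1, 'b \<Rightarrow>\<^sub>0 'k, nat \<times> expo) graded_module" where
  "reduced_module B dg = with_grading (free_module base_ring B)
     (\<lambda>d. carrier (free_module base_ring {b \<in> B. dg b = d}))"

lemma carrier_free_base: "carrier (free_module base_ring B) = {f. Poly_Mapping.keys f \<subseteq> B}"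
  by (auto simp: free_module_def)

lemma reduced_module_simps [simp]:
  "carrier (reduced_module B dg) = {f. Poly_Mapping.keys f \<subseteq> B}"
  "add (reduced_module B dg) = (+)"
  "ring.zero (reduced_module B dg) = 0"
  "module.smult (reduced_module B dg) = pm_scale"
  "gr (reduced_module B dg) d = {f. Poly_Mapping.keys f \<subseteq> {b \<in> B. dg b = d}}"
  by (simp_all add: reduced_module_def with_grading_def module.defs graded_module.defs
      carrier_free_base)

lemma module_reduced_module: "module base_ring (reduced_module B dg :: ('k::comm_ring_1, _, _) graded_module)"
proof -
  have "id \<in> module_iso base_ring (free_module (base_ring :: 'k ring) B) (reduced_module B dg)"
    by (simp add: module_iso_def mod_hom_def carrier_free_base)
  then show ?thesis
    by (rule module_transport[OF module_free_base]) simp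
qed

lemma restrict_scalars_simps [simp]:
  "carrier (restrict_scalars h M) = carrier M"
  "add (restrict_scalars h M) = add M"
  "ring.zero (restrict_scalars h M) = ring.zero M"
  "module.smult (restrict_scalars h M) = (\<lambda>c. module.smult M (h c))"
  "gr (restrict_scalars h M) = gr M"
  by (simp_all add: restrict_scalars_def)

lemma graded_tensor_simps [simp]:
  "carrier (graded_tensor m M N) = carrier (tensor_module (mpoly_ring m) M N)"
  "add (graded_tensor m M N) = add (tensor_module (mpoly_ring m) M N)"
  "ring.zero (graded_tensor m M N) = ring.zero (tensor_module (mpoly_ring m) M N)"
  "module.smult (graded_tensor m M N) = module.smult (tensor_module (mpoly_ring m) M N)"
  by (simp_all add: graded_tensor_def with_grading_def module.defs graded_module.defs)

lemma gr_graded_tensor: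
  "gr (graded_tensor m M N) (q, a) = generate (add_monoid (tensor_module (mpoly_ring m) M N))
        {tensor_elt (mpoly_ring m) M N x y | x y b c. x \<in> gr M (q, b) \<and> y \<in> gr N c \<and> b + c = a}"
  by (simp add: graded_tensor_def with_grading_def module.defs graded_module.defs)

text \<open>
  The element \<open>g \<otimes> 1\<close>; for the basis of the Taylor complex this is the canonical map out of \<open>\<Lambda>[P]\<close>.
\<close>

definition base_tensor :: "nat \<Rightarrow> 'b set \<Rightarrow> ('b \<Rightarrow> nat \<times> expo) \<Rightarrow> ('b \<Rightarrow>\<^sub>0 'k::comm_ring_1)
    \<Rightarrow> (('b \<Rightarrow>\<^sub>0 'k mpoly) \<times> 'k \<Rightarrow>\<^sub>0 'k mpoly) set" where
  "base_tensor m B dg g = tensor_elt (mpoly_ring m) (graded_free_module m B dg) base_module (const_coeffs g) 1"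

text \<open>
  \<open>W\<close> is the free module on pairs and \<open>T\<close> the submodule of relations, so that \<open>W\<close> modulo \<open>T\<close> is the
  tensor product of \<open>F\<close> with \<open>k\<close>.
\<close>

locale free_tensor =
  fixes m :: nat and B :: "'b set" and dg :: "'b \<Rightarrow> nat \<times> expo" and F :: "('k::comm_ring_1 mpoly, 'b \<Rightarrow>\<^sub>0 'k mpoly, nat \<times> expo) graded_module"
    and W and T
  defines "F \<equiv> graded_free_module m B dg"
    and "W \<equiv> free_module (mpoly_ring m :: 'k mpoly ring) (carrier (free_module (mpoly_ring m :: 'k mpoly ring) B) \<times> (UNIV :: 'k set))"
    and "T \<equiv> tensor_kernel (mpoly_ring m) F (base_module :: ('k mpoly, 'k, expo) graded_module)"
begin

abbreviation "R \<equiv> mpoly_ring m :: 'k mpoly ring"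
abbreviation "\<kappa> \<equiv> base_tensor m B dg :: ('b \<Rightarrow>\<^sub>0 'k) \<Rightarrow> _"

abbreviation "N \<equiv> base_module :: ('k mpoly, 'k, expo) graded_module"

lemma T_eq: "T = {z \<in> carrier W. tensor_value z = 0}"
  unfolding T_def F_def W_def by (rule tensor_kernel_eq)

sublocale W: module_with_submodule R W T
  unfolding T_eq W_def
  by (intro module_with_submodule.intro module_free_mpoly submodule_tensor_value_zero)

lemma W_simps [simp]: "add W = (+)" "ring.zero W = 0" "module.smult W = pm_scale"
  by (simp_all add: W_def)

lemma tensor_module_eq: "tensor_module R F N = quotient_module W T"
  by (simp add: tensor_module_def F_def W_def T_def)

lemma coset_eq_iff: "\<lbrakk>z \<in> carrier W; w \<in> carrier W\<rbrakk> \<Longrightarrow> T +>\<^bsub>W\<^esub> z = T +>\<^bsub>W\<^esub> w \<longleftrightarrow> tensor_value z = tensor_value w"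
proof -
  assume z: "z \<in> carrier W" and w: "w \<in> carrier W"
  have neg: "\<ominus>\<^bsub>W\<^esub> w = - w" using w unfolding W_def by (rule a_inv_free_module[OF module_free_mpoly])
  have "z - w \<in> carrier W" using W.M.a_closed[OF z W.M.a_inv_closed[OF w]]
    by (simp only: neg W_simps diff_conv_add_uminus)
  then have "z - w \<in> T \<longleftrightarrow> tensor_value z = tensor_value w" 
    by (simp only: T_eq mem_Collect_eq tensor_value_diff right_minus_eq simp_thms)
  moreover have "z \<oplus>\<^bsub>W\<^esub> (\<ominus>\<^bsub>W\<^esub> w) = z - w" by (simp add: neg)
  ultimately show ?thesis using W.coset_eq_iff[OF z w] by (simp only:)
qed

lemma single_closed: "\<lbrakk>x \<in> carrier (free_module R B); p \<in> carrier R\<rbrakk> \<Longrightarrow> Poly_Mapping.single (x, y) p \<in> carrier W"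
  unfolding W_def by (auto simp: mem_free_module[of _ _ "_ \<times> _"] lookup_single when_def mpoly_closed)

lemma base_tensor_eq:
  assumes "z \<in> carrier W"
  shows "\<kappa> (tensor_value z) = T +>\<^bsub>W\<^esub> z"
proof -
  have "const_coeffs (tensor_value z) \<in> carrier (free_module R B)"
    using assms unfolding W_def by (intro const_coeffs_closed keys_tensor_value)
  then have "Poly_Mapping.single (const_coeffs (tensor_value z), 1) 1 \<in> carrier W"
    by (intro single_closed mpoly_closed)
  then have "T +>\<^bsub>W\<^esub> Poly_Mapping.single (const_coeffs (tensor_value z), 1) 1 = T +>\<^bsub>W\<^esub> z"
    using assms by (simp add: coset_eq_iff)
  then show ?thesis
    by (simp add: base_tensor_def tensor_elt_def T_def F_def W_def)
qed

lemma ex_value: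
  assumes "Poly_Mapping.keys g \<subseteq> B"
  obtains z where "z \<in> carrier W" "tensor_value z = g"
  using that[of "Poly_Mapping.single (const_coeffs g, 1) 1"] assms
  by (simp add: single_closed const_coeffs_closed mpoly_closed)

lemma tensor_carrier: "carrier (tensor_module R F N) = \<kappa> ` {g. Poly_Mapping.keys g \<subseteq> B}"
proof -
  have "(\<lambda>z. T +>\<^bsub>W\<^esub> z) ` carrier W = \<kappa> ` {g. Poly_Mapping.keys g \<subseteq> B}"
  proof (intro equalityI subsetI)
    fix C assume "C \<in> (\<lambda>z. T +>\<^bsub>W\<^esub> z) ` carrier W"
    then obtain z where z: "z \<in> carrier W" "C = \<kappa> (tensor_value z)" using base_tensor_eq by auto
    then have "Poly_Mapping.keys (tensor_value z) \<subseteq> B" unfolding W_def by (intro keys_tensor_value)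
    with z show "C \<in> \<kappa> ` {g. Poly_Mapping.keys g \<subseteq> B}" by blast
  next
    fix C assume "C \<in> \<kappa> ` {g. Poly_Mapping.keys g \<subseteq> B}"
    then obtain g where g: "Poly_Mapping.keys g \<subseteq> B" "C = \<kappa> g" by auto
    from ex_value[OF g(1)] show "C \<in> (\<lambda>z. T +>\<^bsub>W\<^esub> z) ` carrier W"
      using base_tensor_eq g(2) by (metis image_eqI)
  qed
  then show ?thesis by (simp add: tensor_module_eq W.quotient_module_simps)
qed

lemma base_tensor_add:
  assumes "Poly_Mapping.keys g \<subseteq> B" "Poly_Mapping.keys h \<subseteq> B"
  shows "\<kappa> g \<oplus>\<^bsub>tensor_module R F N\<^esub> \<kappa> h = \<kappa> (g + h)"
proof -
  obtain z where z: "z \<in> carrier W" "tensor_value z = g" using ex_value[OF assms(1)] .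
  obtain w where w: "w \<in> carrier W" "tensor_value w = h" using ex_value[OF assms(2)] .
  have "z + w \<in> carrier W" using W.M.a_closed[OF z(1) w(1)] by simp
  then show ?thesis
    using z w base_tensor_eq[of z] base_tensor_eq[of w] base_tensor_eq[of "z + w"]
    by (simp add: tensor_module_eq W.quotient_module_simps tensor_value_add)
qed

lemma base_tensor_smult:
  assumes "p \<in> carrier R" "Poly_Mapping.keys g \<subseteq> B"
  shows "p \<odot>\<^bsub>tensor_module R F N\<^esub> \<kappa> g = \<kappa> (pm_scale (Poly_Mapping.lookup p 0) g)"
proof -
  obtain z where z: "z \<in> carrier W" "tensor_value z = g" using ex_value[OF assms(2)] .
  have "pm_scale p z \<in> carrier W" using module.smult_closed[OF W.module_axioms assms(1) z(1)] by simp
  then show ?thesis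
    using z base_tensor_eq[of z] base_tensor_eq[of "pm_scale p z"] assms
    by (simp add: tensor_module_eq W.quotient_module_simps tensor_value_pm_scale)
qed

lemma base_tensor_zero: "\<kappa> 0 = \<zero>\<^bsub>tensor_module R F N\<^esub>"
proof -
  have 0: "0 \<in> carrier W" "0 \<in> T" using W.M.zero_closed W.quot.zero_closed by simp_all
  have "T +>\<^bsub>W\<^esub> 0 = T" by (rule W.quot.a_rcos_const[OF 0(2)])
  then show ?thesis
    using base_tensor_eq[OF 0(1)] by (simp add: tensor_module_eq quotient_module_def)
qed

lemma base_tensor_inj:
  assumes "Poly_Mapping.keys g \<subseteq> B" "Poly_Mapping.keys h \<subseteq> B" "\<kappa> g = \<kappa> h"
  shows "g = h"
proof -
  obtain z where z: "z \<in> carrier W" "tensor_value z = g" using ex_value[OF assms(1)] .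
  obtain w where w: "w \<in> carrier W" "tensor_value w = h" using ex_value[OF assms(2)] .
  show ?thesis using z w assms(3) base_tensor_eq[of z] base_tensor_eq[of w] by (simp add: coset_eq_iff)
qed

lemma tensor_elt_eq:
  assumes "x \<in> carrier (free_module R B)"
  shows "tensor_elt R F N x y = \<kappa> (pm_scale y (const_part x))"
proof -
  have "Poly_Mapping.single (x, y) 1 \<in> carrier W" using assms by (intro single_closed mpoly_closed)
  from base_tensor_eq[OF this] show ?thesis
    by (simp add: tensor_elt_def T_def W_def F_def)
qed

lemma base_tensor_iso:
  "\<kappa> \<in> module_iso base_ring (reduced_module B dg) (over_base (graded_tensor m F N))"
proof -
  have "bij_betw \<kappa> {f. Poly_Mapping.keys f \<subseteq> B} (carrier (tensor_module R F N))"
    unfolding tensor_carrier bij_betw_def using base_tensor_inj by (auto simp: inj_on_def)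
  moreover have "\<kappa> \<in> mod_hom base_ring (reduced_module B dg) (over_base (graded_tensor m F N))"
    using tensor_carrier by (auto simp: mod_hom_def base_tensor_add base_tensor_smult mpoly_closed)
  ultimately show ?thesis by (simp add: module_iso_def)
qed

text \<open>
  A homogeneous \<open>x\<close> of degree \<open>(q, b)\<close> has constant terms only at basis elements of exactly that
  degree, and a nonzero \<open>y\<close> has degree \<open>0\<close>; so the generators \<open>x \<otimes> y\<close> of the component come from basis
  elements of degree \<open>(q, a)\<close>. When \<open>y = 0\<close> its degree is arbitrary, but then the tensor vanishes.
\<close>

lemma gr_tensor: "gr (graded_tensor m F N) (q, a) = \<kappa> ` gr (reduced_module B dg) (q, a)"
proof -
  let ?M = "add_monoid (tensor_module R F N)"
  let ?G = "{g :: 'b \<Rightarrow>\<^sub>0 'k. Poly_Mapping.keys g \<subseteq> {b \<in> B. dg b = (q, a)}}"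
  let ?H = "{tensor_elt R F N x y | x y b c.
      x \<in> gr F (q, b) \<and> y \<in> gr N c \<and> b + c = a}"
  interpret reduced: module base_ring "reduced_module B dg :: ('k, _, _) graded_module"
    by (rule module_reduced_module)
  interpret M': abelian_group "tensor_module R F N"
    by (rule abelian_group_transport[OF reduced.M.abelian_group_axioms, where f = \<kappa>])
      (simp_all add: tensor_carrier base_tensor_zero base_tensor_add)
  have H: "h \<in> \<kappa> ` ?G" if hH: "h \<in> ?H" for h
  proof -
    obtain x y b c where h: "h = tensor_elt R F N x y" "x \<in> gr F (q, b)" "y \<in> gr N c" "b + c = a"
      using hH by blast
    have x: "x \<in> carrier (free_module R B)" "\<forall>b'\<in>Poly_Mapping.keys x. fst (dg b') = q \<and>
        (\<forall>t\<in>Poly_Mapping.keys (Poly_Mapping.lookup x b'). t + snd (dg b') = b)"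
      using h(2) by (auto simp: F_def gr_graded_free_module mem_free_module)
    have "Poly_Mapping.keys (pm_scale y (const_part x)) \<subseteq> {b \<in> B. dg b = (q, a)}"
    proof
      fix b' assume b': "b' \<in> Poly_Mapping.keys (pm_scale y (const_part x))"
      then have "y \<noteq> 0" "Poly_Mapping.lookup (Poly_Mapping.lookup x b') 0 \<noteq> 0"
        by (auto simp: in_keys_iff lookup_pm_scale lookup_const_part)
      then have "c = 0" "b' \<in> Poly_Mapping.keys x" "0 \<in> Poly_Mapping.keys (Poly_Mapping.lookup x b')"
        using h(3) by (auto simp: in_keys_iff split: if_splits)
      then show "b' \<in> {b \<in> B. dg b = (q, a)}"
        using x h(4) by (cases "dg b'") (fastforce simp: mem_free_module)
    qed
    then show ?thesis using h(1) tensor_elt_eq[OF x(1)] by auto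
  qed
  have "generate ?M ?H \<subseteq> \<kappa> ` ?G"
  proof
    fix x assume "x \<in> generate ?M ?H"
    then show "x \<in> \<kappa> ` ?G"
    proof induction
      case one
      show ?case using base_tensor_zero by (auto intro!: image_eqI[of _ _ 0])
    next
      case (incl h)
      then show ?case by (rule H)
    next
      case (inv h)
      then obtain g where g: "g \<in> ?G" "h = \<kappa> g" using H by blast
      then have gB: "Poly_Mapping.keys g \<subseteq> B" by auto
      have "inv\<^bsub>?M\<^esub> h = \<ominus>\<^bsub>tensor_module R F N\<^esub> h" by (simp add: a_inv_def)
      also have "\<dots> = \<kappa> (- g)"
      proof (rule M'.a_inv_eqI)
        show "h \<oplus>\<^bsub>tensor_module R F N\<^esub> \<kappa> (- g) = \<zero>\<^bsub>tensor_module R F N\<^esub>"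
          using base_tensor_add[of g "- g"] gB g(2) base_tensor_zero by simp
      qed (use g gB tensor_carrier in auto)
      finally show ?case using g(1) by auto
    next
      case (eng h1 h2)
      then obtain g1 g2 where g: "g1 \<in> ?G" "h1 = \<kappa> g1" "g2 \<in> ?G" "h2 = \<kappa> g2" by blast
      have "g1 + g2 \<in> ?G" using g Poly_Mapping.keys_add[of g1 g2] by blast
      moreover have "Poly_Mapping.keys g1 \<subseteq> B" "Poly_Mapping.keys g2 \<subseteq> B" using g by auto
      ultimately show ?case using base_tensor_add[of g1 g2] g by auto
    qed
  qed
  moreover have "\<kappa> g \<in> generate ?M ?H" if g: "g \<in> ?G" for g
  proof (rule generate.incl)
    have "const_coeffs g \<in> gr F (q, a)"
      using g by (auto simp: F_def gr_graded_free_module lookup_const_coeffs mpoly_closed split: if_splits)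
    moreover have "\<kappa> g = tensor_elt R F N (const_coeffs g) 1"
      by (simp add: base_tensor_def F_def)
    moreover have "1 \<in> gr N 0" "a + 0 = a" by simp_all
    ultimately show "\<kappa> g \<in> ?H" by blast
  qed
  ultimately show ?thesis
    unfolding gr_graded_tensor reduced_module_simps by blast
qed

lemma tensor_map_base_tensor:
  assumes \<delta>: "\<And>b. b \<in> B \<Longrightarrow> \<delta> b \<in> carrier (free_module R B)" and g: "Poly_Mapping.keys g \<subseteq> B"
  shows "tensor_map R F N (lin_ext \<delta>) (\<kappa> g) = \<kappa> (lin_ext (\<lambda>b. const_part (\<delta> b)) g)"
proof -
  interpret F: module R "free_module R B" by (rule module_free_mpoly)
  let ?D = "lin_ext (\<lambda>(x, y). Poly_Mapping.single (lin_ext \<delta> x, y) 1)"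
  have D_closed: "lin_ext \<delta> x \<in> carrier (free_module R B)" if "x \<in> carrier (free_module R B)" for x
  proof (rule poly_mapping_induct_on[where f = x and B = B and C = "carrier R"])
    show "\<And>b. b \<in> Poly_Mapping.keys x \<Longrightarrow> b \<in> B \<and> Poly_Mapping.lookup x b \<in> carrier R"
      using that by (auto simp: mem_free_module)
    show "lin_ext \<delta> (x + y) \<in> carrier (free_module R B)"
      if "lin_ext \<delta> x \<in> carrier (free_module R B)" "lin_ext \<delta> y \<in> carrier (free_module R B)" for x y
      using F.M.a_closed[OF that] by (simp add: lin_ext_add)
    show "lin_ext \<delta> (Poly_Mapping.single b c) \<in> carrier (free_module R B)" if "b \<in> B" "c \<in> carrier R" for b c
      using F.smult_closed[OF that(2) \<delta>[OF that(1)]] by simp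
  qed (use F.M.zero_closed in simp)
  have W_closed: "?D z \<in> carrier W" if "z \<in> carrier W" for z
  proof (rule poly_mapping_induct_on[where f = z and B = "carrier (free_module R B) \<times> UNIV" and C = "carrier R"])
    show "\<And>b. b \<in> Poly_Mapping.keys z \<Longrightarrow> b \<in> carrier (free_module R B) \<times> UNIV \<and> Poly_Mapping.lookup z b \<in> carrier R"
      using that unfolding W_def by (auto simp: mem_free_module[of z])
    show "?D (x + y) \<in> carrier W" if "?D x \<in> carrier W" "?D y \<in> carrier W" for x y
      using W.M.a_closed[OF that] by (simp add: lin_ext_add)
    show "?D (Poly_Mapping.single b c) \<in> carrier W"
      if "b \<in> carrier (free_module R B) \<times> UNIV" "c \<in> carrier R" for b c
      using that D_closed by (cases b) (auto intro!: single_closed)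
  qed (use W.M.zero_closed in simp)
  have val: "tensor_value (?D z) = lin_ext (\<lambda>b. const_part (\<delta> b)) (tensor_value z)" for z
    by (rule additive_eq_on[of z UNIV "\<lambda>z. tensor_value (?D z)"])
      (auto simp: lin_ext_add tensor_value_add const_part_lin_ext lin_ext_scale)
  obtain z where z: "z \<in> carrier W" "tensor_value z = g" using ex_value[OF g] .
  have g_coset: "\<kappa> g = T +>\<^bsub>W\<^esub> z" using base_tensor_eq[OF z(1)] z(2) by simp
  have "T +>\<^bsub>W\<^esub> ?D w = \<kappa> (lin_ext (\<lambda>b. const_part (\<delta> b)) g)" if w: "w \<in> \<kappa> g" for w
  proof -
    have "w \<in> carrier W" using W.quot.a_elemrcos_carrier[OF z(1)] w g_coset by simp
    moreover from this have "tensor_value w = g"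
      using w g_coset z W.quot.a_repr_independence'[OF _ z(1), of w] coset_eq_iff[of z w] by simp
    ultimately show ?thesis using base_tensor_eq[OF W_closed[of w]] val[of w] by simp
  qed
  moreover have "z \<in> \<kappa> g" using g_coset W.quot.a_rcos_self[OF z(1)] by simp
  ultimately have "(\<Union>w\<in>\<kappa> g. T +>\<^bsub>W\<^esub> ?D w) = \<kappa> (lin_ext (\<lambda>b. const_part (\<delta> b)) g)" by blast
  then show ?thesis
    by (simp add: tensor_map_def T_def W_def F_def)
qed

end

section \<open>Comparison of graded free resolutions\<close>

lemma homogeneous_closed:
  fixes m :: nat and B :: "'b set" and dg :: "'b \<Rightarrow> nat \<times> expo"
  defines "F \<equiv> graded_free_module m B dg :: ('k::comm_ring_1 mpoly, _, _) graded_module"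
  shows homogeneous_zero: "0 \<in> gr F (q, a)"
    and homogeneous_add: "\<lbrakk>x \<in> gr F (q, a); y \<in> gr F (q, a)\<rbrakk> \<Longrightarrow> x + y \<in> gr F (q, a)"
    and homogeneous_diff: "\<lbrakk>x \<in> gr F (q, a); y \<in> gr F (q, a)\<rbrakk> \<Longrightarrow> x - y \<in> gr F (q, a)"
proof -
  show "0 \<in> gr F (q, a)" by (simp add: F_def gr_graded_free_module mpoly_closed)
  have *: "z \<in> gr F (q, a)"
    if xy: "x \<in> gr F (q, a)" "y \<in> gr F (q, a)"
      and z: "\<And>b. Poly_Mapping.lookup z b \<in> carrier (mpoly_ring m)"
        "\<And>b. Poly_Mapping.keys (Poly_Mapping.lookup z b) \<subseteq>
          Poly_Mapping.keys (Poly_Mapping.lookup x b) \<union> Poly_Mapping.keys (Poly_Mapping.lookup y b)"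
    for x y z :: "'b \<Rightarrow>\<^sub>0 'k mpoly"
  proof -
    have key: "b \<in> Poly_Mapping.keys x \<or> b \<in> Poly_Mapping.keys y" if "b \<in> Poly_Mapping.keys z" for b
      using that z(2)[of b] by (auto simp: in_keys_iff[of b])
    have t: "t + snd (dg b) = a" if "t \<in> Poly_Mapping.keys (Poly_Mapping.lookup z b)" for b t
    proof -
      from that z(2)[of b] consider "t \<in> Poly_Mapping.keys (Poly_Mapping.lookup x b)"
        | "t \<in> Poly_Mapping.keys (Poly_Mapping.lookup y b)" by blast
      then show ?thesis
      proof cases
        case 1
        then have "b \<in> Poly_Mapping.keys x" by (auto simp: in_keys_iff[of b])
        with 1 xy(1) show ?thesis by (auto simp: F_def gr_graded_free_module)
      next
        case 2
        then have "b \<in> Poly_Mapping.keys y" by (auto simp: in_keys_iff[of b])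
        with 2 xy(2) show ?thesis by (auto simp: F_def gr_graded_free_module)
      qed
    qed
    have "b \<in> B \<and> fst (dg b) = q" if "b \<in> Poly_Mapping.keys z" for b
      using key[OF that] xy by (auto simp: F_def gr_graded_free_module)
    then show ?thesis using t z(1) by (auto simp: F_def gr_graded_free_module)
  qed
  show "x + y \<in> gr F (q, a)" if "x \<in> gr F (q, a)" "y \<in> gr F (q, a)"
    by (rule *[OF that])
      (use that in \<open>simp add: F_def gr_graded_free_module lookup_add mpoly_closed\<close>,
        simp only: lookup_add Poly_Mapping.keys_add)
  show "x - y \<in> gr F (q, a)" if "x \<in> gr F (q, a)" "y \<in> gr F (q, a)"
    by (rule *[OF that])
      (use that in \<open>simp add: F_def gr_graded_free_module lookup_minus mpoly_closed\<close>,
        simp only: lookup_minus keys_diff)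
qed

text \<open>
  The homological degree may change, which covers differentials, chain maps and homotopies at once;
  the internal degree is preserved.
\<close>

lemma homogeneous_lin_ext:
  assumes z: "z \<in> gr (graded_free_module m B dg) (q, a)"
    and \<phi>: "\<And>b. \<lbrakk>b \<in> B; fst (dg b) = q\<rbrakk> \<Longrightarrow> \<phi> b \<in> gr (graded_free_module m C eg) (q', snd (dg b))"
  shows "lin_ext \<phi> z \<in> gr (graded_free_module m C eg :: ('k::comm_ring_1 mpoly, _, _) graded_module) (q', a)"
proof -
  have summand: "pm_scale (Poly_Mapping.lookup z b) (\<phi> b) \<in> gr (graded_free_module m C eg) (q', a)"
    if b: "b \<in> Poly_Mapping.keys z" for b
  proof -
    have zb: "b \<in> B" "fst (dg b) = q" "Poly_Mapping.lookup z b \<in> carrier (mpoly_ring m)"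
      "\<And>t. t \<in> Poly_Mapping.keys (Poly_Mapping.lookup z b) \<Longrightarrow> t + snd (dg b) = a"
      using z b by (auto simp: gr_graded_free_module)
    have \<phi>b: "Poly_Mapping.keys (\<phi> b) \<subseteq> C" "\<And>c. Poly_Mapping.lookup (\<phi> b) c \<in> carrier (mpoly_ring m)"
      "\<And>c. c \<in> Poly_Mapping.keys (\<phi> b) \<Longrightarrow> fst (eg c) = q'"
      "\<And>c t. \<lbrakk>c \<in> Poly_Mapping.keys (\<phi> b); t \<in> Poly_Mapping.keys (Poly_Mapping.lookup (\<phi> b) c)\<rbrakk>
        \<Longrightarrow> t + snd (eg c) = snd (dg b)"
      using \<phi>[OF zb(1,2)] by (auto simp: gr_graded_free_module)
    have "c \<in> C \<and> fst (eg c) = q'" "t + snd (eg c) = a"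
      if "c \<in> Poly_Mapping.keys (pm_scale (Poly_Mapping.lookup z b) (\<phi> b))"
        "t \<in> Poly_Mapping.keys (Poly_Mapping.lookup (pm_scale (Poly_Mapping.lookup z b) (\<phi> b)) c)" for c t
    proof -
      have c: "c \<in> Poly_Mapping.keys (\<phi> b)" by (rule subsetD[OF keys_pm_scale that(1)])
      show "c \<in> C \<and> fst (eg c) = q'" using \<phi>b(1,3) c by blast
      have "t \<in> Poly_Mapping.keys (Poly_Mapping.lookup z b * Poly_Mapping.lookup (\<phi> b) c)"
        using that(2) by (simp only: lookup_pm_scale)
      then obtain u v where t: "t = u + v" and uv: "u \<in> Poly_Mapping.keys (Poly_Mapping.lookup z b)"
          "v \<in> Poly_Mapping.keys (Poly_Mapping.lookup (\<phi> b) c)"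
        using Poly_Mapping.keys_mult[of "Poly_Mapping.lookup z b" "Poly_Mapping.lookup (\<phi> b) c"] by blast
      have "u + snd (dg b) = a" "v + snd (eg c) = snd (dg b)"
        by (rule zb(4)[OF uv(1)], rule \<phi>b(4)[OF c uv(2)])
      then show "t + snd (eg c) = a" using t by (simp add: add.assoc)
    qed
    moreover have "Poly_Mapping.keys (pm_scale (Poly_Mapping.lookup z b) (\<phi> b)) \<subseteq> C"
      "\<forall>c\<in>Poly_Mapping.keys (pm_scale (Poly_Mapping.lookup z b) (\<phi> b)). fst (eg c) = q'"
      using keys_pm_scale[of "Poly_Mapping.lookup z b" "\<phi> b"] \<phi>b(1,3) by blast+
    moreover have "Poly_Mapping.lookup (pm_scale (Poly_Mapping.lookup z b) (\<phi> b)) c \<in> carrier (mpoly_ring m)" for c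
      using zb(3) \<phi>b(2) by (simp add: lookup_pm_scale mpoly_closed)
    ultimately show ?thesis by (auto simp: gr_graded_free_module)
  qed
  have "(\<Sum>b\<in>A. pm_scale (Poly_Mapping.lookup z b) (\<phi> b)) \<in> gr (graded_free_module m C eg) (q', a)"
    if "finite A" "A \<subseteq> Poly_Mapping.keys z" for A
    using that by (induction A) (auto intro: homogeneous_zero homogeneous_add summand)
  then show ?thesis unfolding lin_ext_def by simp
qed

lemma const_part_homogeneous:
  assumes "z \<in> gr (graded_free_module m B dg) (q, a)"
  shows "const_part z \<in> gr (reduced_module B dg) (q, a)"
proof -
  have "b \<in> B \<and> dg b = (q, a)" if b: "b \<in> Poly_Mapping.keys (const_part z)" for b
  proof -
    have "b \<in> Poly_Mapping.keys z" by (rule subsetD[OF keys_const_part b])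
    moreover have "0 \<in> Poly_Mapping.keys (Poly_Mapping.lookup z b)"
      using b by (simp add: in_keys_iff lookup_const_part)
    ultimately have "b \<in> B" "fst (dg b) = q" "0 + snd (dg b) = a"
      using assms by (auto simp only: gr_graded_free_module mem_Collect_eq)
    then show ?thesis by (cases "dg b") auto
  qed
  then show ?thesis by auto
qed

lemma const_coeffs_homogeneous:
  assumes "x \<in> gr (reduced_module B dg) (q, a)"
  shows "const_coeffs x \<in> gr (graded_free_module m B dg :: ('k::comm_ring_1 mpoly, _, _) graded_module) (q, a)"
  using assms by (auto simp: gr_graded_free_module lookup_const_coeffs mpoly_closed split: if_splits)

lemma reduced_lin_ext:
  "lin_ext (\<lambda>b. const_part (\<phi> b)) x = const_part (lin_ext \<phi> (const_coeffs x))"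
  by (simp add: const_part_lin_ext)

lemma reduced_homogeneous:
  assumes "x \<in> gr (reduced_module B dg) (q, a)"
    and "\<And>b. \<lbrakk>b \<in> B; fst (dg b) = q\<rbrakk> \<Longrightarrow> \<phi> b \<in> gr (graded_free_module m C eg) (q', snd (dg b))"
  shows "lin_ext (\<lambda>b. const_part (\<phi> b)) x \<in> gr (reduced_module C eg) (q', a)"
  unfolding reduced_lin_ext
  by (rule const_part_homogeneous[OF homogeneous_lin_ext[OF const_coeffs_homogeneous[OF assms(1)] assms(2)]])

lemma submodule_gr_reduced: "submodule (gr (reduced_module B dg) d) base_ring (reduced_module B dg :: ('k::comm_ring_1, _, _) graded_module)"
proof -
  interpret module base_ring "reduced_module B dg :: ('k, _, _) graded_module" by (rule module_reduced_module)
  have neg: "\<ominus>\<^bsub>reduced_module B dg\<^esub> x = - x" if "Poly_Mapping.keys x \<subseteq> B" for x :: "'a \<Rightarrow>\<^sub>0 'k"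
    using that by (intro M.a_inv_eqI) auto
  show ?thesis
  proof (rule submoduleI)
    fix x :: "'a \<Rightarrow>\<^sub>0 'k" assume "x \<in> gr (reduced_module B dg) d"
    moreover from this have "Poly_Mapping.keys x \<subseteq> B" by auto
    ultimately show "\<ominus>\<^bsub>reduced_module B dg\<^esub> x \<in> gr (reduced_module B dg) d" by (simp add: neg)
  next
    fix x y :: "'a \<Rightarrow>\<^sub>0 'k" assume "x \<in> gr (reduced_module B dg) d" "y \<in> gr (reduced_module B dg) d"
    then show "x \<oplus>\<^bsub>reduced_module B dg\<^esub> y \<in> gr (reduced_module B dg) d"
      using Poly_Mapping.keys_add[of x y] by auto
  next
    fix r :: 'k and x :: "'a \<Rightarrow>\<^sub>0 'k" assume "x \<in> gr (reduced_module B dg) d"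
    then show "r \<odot>\<^bsub>reduced_module B dg\<^esub> x \<in> gr (reduced_module B dg) d"
      using keys_pm_scale[of r x] by auto
  qed auto
qed

lemma mod_hom_reduced_lin_ext:
  assumes "\<And>b. b \<in> B \<Longrightarrow> Poly_Mapping.keys (\<phi> b) \<subseteq> C"
  shows "lin_ext \<phi> \<in> mod_hom base_ring (reduced_module B dg) (reduced_module C eg)"
proof -
  have "Poly_Mapping.keys (lin_ext \<phi> x) \<subseteq> C" if "Poly_Mapping.keys x \<subseteq> B" for x
    using keys_lin_ext[of \<phi> x] assms that by blast
  then show ?thesis by (auto simp: mod_hom_def lin_ext_add lin_ext_scale)
qed

text \<open>
  The value of an augmentation to \<open>k[x]/I\<close> is represented by a polynomial, with \<open>r b\<close> representing the
  value on the basis element \<open>b\<close>.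
\<close>

definition augment :: "('b \<Rightarrow> 'k mpoly) \<Rightarrow> ('b \<Rightarrow>\<^sub>0 'k::comm_ring_1 mpoly) \<Rightarrow> 'k mpoly" where
  "augment r z = (\<Sum>b\<in>Poly_Mapping.keys z. Poly_Mapping.lookup z b * r b)"

text \<open>
  An augmentation is a linear extension with values in the free module on one generator, so its
  linearity is a special case of that of \<open>lin_ext\<close>.
\<close>

lemma augment_lin_ext_unit: "augment r z = Poly_Mapping.lookup (lin_ext (\<lambda>b. Poly_Mapping.single () (r b)) z) ()"
  by (simp add: augment_def lin_ext_def lookup_sum)

lemma augment_simps [simp]:
  "augment r 0 = 0" "augment r (x + y) = augment r x + augment r y"
  "augment r (x - y) = augment r x - augment r y"
  "augment r (Poly_Mapping.single b p) = p * r b"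
  by (simp_all add: augment_lin_ext_unit lin_ext_add lin_ext_diff lookup_add lookup_minus)

lemma augment_lin_ext: "augment r (lin_ext \<phi> z) = augment (\<lambda>b. augment r (\<phi> b)) z"
  by (simp add: augment_lin_ext_unit lin_ext_lin_ext)
    (simp add: lin_ext_def lookup_sum lookup_pm_scale)

lemma ideal_mpoly_closed:
  fixes I :: "'k::comm_ring_1 mpoly set"
  assumes "ideal I (mpoly_ring m)"
  shows "0 \<in> I" "\<lbrakk>p \<in> I; q \<in> I\<rbrakk> \<Longrightarrow> p + q \<in> I" "\<lbrakk>p \<in> carrier (mpoly_ring m); q \<in> I\<rbrakk> \<Longrightarrow> p * q \<in> I"
    "\<lbrakk>p \<in> I; q \<in> I\<rbrakk> \<Longrightarrow> p - q \<in> I" "p \<in> I \<Longrightarrow> - p \<in> I"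
proof -
  interpret ideal I "mpoly_ring m" by fact
  show "0 \<in> I" using additive_subgroup.zero_closed[OF is_additive_subgroup] by simp
  show add: "p + q \<in> I" if "p \<in> I" "q \<in> I" for p q
    using additive_subgroup.a_closed[OF is_additive_subgroup that] by simp
  show mult: "p * q \<in> I" if "p \<in> carrier (mpoly_ring m)" "q \<in> I" for p q
    using I_l_closed[OF that(2,1)] by simp
  show neg: "- p \<in> I" if "p \<in> I" for p
    using mult[OF mpoly_closed(5)[OF mpoly_closed(2)] that] by simp
  show "p - q \<in> I" if "p \<in> I" "q \<in> I"
    using add[OF that(1) neg[OF that(2)]] by simp
qed

lemma augment_lin_ext_congruent:
  assumes I: "ideal I (mpoly_ring m)"
    and z: "\<And>c. c \<in> Poly_Mapping.keys z \<Longrightarrow> Poly_Mapping.lookup z c \<in> carrier (mpoly_ring m)"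
    and \<phi>: "\<And>c. c \<in> Poly_Mapping.keys z \<Longrightarrow> augment s (\<phi> c) - r c \<in> I"
  shows "augment s (lin_ext \<phi> z) - augment r z \<in> I"
proof -
  have "augment s (lin_ext \<phi> z) - augment r z =
      (\<Sum>c\<in>Poly_Mapping.keys z. Poly_Mapping.lookup z c * (augment s (\<phi> c) - r c))"
    unfolding augment_lin_ext unfolding augment_def sum_subtractf[symmetric]
    by (simp add: right_diff_distrib)
  moreover have "(\<Sum>c\<in>A. Poly_Mapping.lookup z c * (augment s (\<phi> c) - r c)) \<in> I"
    if "finite A" "A \<subseteq> Poly_Mapping.keys z" for A
    using that by (induction A) (auto intro: ideal_mpoly_closed[OF I] z \<phi>)
  ultimately show ?thesis by simp
qed

text \<open>
  A graded free resolution of \<open>k[x]/I\<close> with a chosen basis \<open>B\<close>. Exactness is required for homogeneous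
  elements only, and in degree \<open>0\<close> the kernel of the augmentation is expressed by \<open>augment r z \<in> I\<close>.
\<close>

locale graded_free_resolution =
  fixes m :: nat and I :: "'k::comm_ring_1 mpoly set" and B :: "'b set" and dg :: "'b \<Rightarrow> nat \<times> expo"
    and \<delta> :: "'b \<Rightarrow> ('b \<Rightarrow>\<^sub>0 'k mpoly)" and r :: "'b \<Rightarrow> 'k mpoly"
  assumes ideal: "ideal I (mpoly_ring m)"
    and boundary: "\<lbrakk>b \<in> B; dg b = (Suc q, a)\<rbrakk> \<Longrightarrow> \<delta> b \<in> gr (graded_free_module m B dg) (q, a)"
    and boundary_0: "\<lbrakk>b \<in> B; fst (dg b) = 0\<rbrakk> \<Longrightarrow> \<delta> b = 0"
    and boundary_boundary: "b \<in> B \<Longrightarrow> lin_ext \<delta> (\<delta> b) = 0"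
    and generator: "\<lbrakk>b \<in> B; dg b = (0, a)\<rbrakk> \<Longrightarrow> r b \<in> carrier (mpoly_ring m) \<and> Poly_Mapping.keys (r b) \<subseteq> {a}"
    and augment_boundary: "\<lbrakk>b \<in> B; dg b = (1, a)\<rbrakk> \<Longrightarrow> augment r (\<delta> b) \<in> I"
    and exact: "\<lbrakk>z \<in> gr (graded_free_module m B dg) (q, a);
      if q = 0 then augment r z \<in> I else lin_ext \<delta> z = 0\<rbrakk>
      \<Longrightarrow> z \<in> lin_ext \<delta> ` gr (graded_free_module m B dg) (Suc q, a)"
    and augment_onto: "\<lbrakk>p \<in> carrier (mpoly_ring m); Poly_Mapping.keys p \<subseteq> {a}\<rbrakk>
      \<Longrightarrow> \<exists>z\<in>gr (graded_free_module m B dg) (0, a). augment r z - p \<in> I"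
begin

abbreviation "F \<equiv> graded_free_module m B dg :: ('k mpoly, _, _) graded_module"

lemma boundary_keys:
  assumes "b \<in> B" "c \<in> Poly_Mapping.keys (\<delta> b)"
  shows "c \<in> B" "fst (dg b) = Suc (fst (dg c))"
proof -
  obtain q a where d: "dg b = (q, a)" by (cases "dg b")
  show "c \<in> B" "fst (dg b) = Suc (fst (dg c))"
    using boundary[of b] boundary_0[of b] assms d
    by (cases q; force simp: gr_graded_free_module)+
qed

lemma boundary_closed: "b \<in> B \<Longrightarrow> \<delta> b \<in> carrier (free_module (mpoly_ring m) B)"
proof -
  assume b: "b \<in> B"
  obtain q a where d: "dg b = (q, a)" by (cases "dg b")
  show ?thesis
    using boundary[OF b] boundary_0[OF b] d
    by (cases q) (auto simp: gr_graded_free_module mem_free_module mpoly_closed)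
qed

lemma boundary_degree_0: "z \<in> gr F (0, a) \<Longrightarrow> lin_ext \<delta> z = 0"
  by (auto simp: lin_ext_def gr_graded_free_module boundary_0 intro!: sum.neutral)

lemma reduced_complex: "module_complex base_ring (reduced_module B dg) (lin_ext (\<lambda>b. const_part (\<delta> b)))"
proof (intro module_complex.intro module_complex_axioms.intro module_reduced_module submodule_gr_reduced)
  have "Poly_Mapping.keys (const_part (\<delta> b)) \<subseteq> B" if "b \<in> B" for b
    using boundary_keys(1)[OF that] keys_const_part[of "\<delta> b"] by blast
  then show "lin_ext (\<lambda>b. const_part (\<delta> b)) \<in> mod_hom base_ring (reduced_module B dg) (reduced_module B dg)"
    by (rule mod_hom_reduced_lin_ext)
next
  fix x :: "'b \<Rightarrow>\<^sub>0 'k" and q a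
  assume x: "x \<in> gr (reduced_module B dg) (Suc q, a)"
  show "lin_ext (\<lambda>b. const_part (\<delta> b)) x \<in> gr (reduced_module B dg) (q, a)"
    by (rule reduced_homogeneous[OF x, where m = m])
      (use boundary[of _ q "snd (dg _)"] in \<open>simp add: prod_eq_iff\<close>)
  have "lin_ext \<delta> (lin_ext \<delta> (const_coeffs x)) = lin_ext (\<lambda>b. 0) (const_coeffs x)"
    unfolding lin_ext_lin_ext by (rule lin_ext_cong) (use x in \<open>auto simp: boundary_boundary\<close>)
  also have "\<dots> = 0" by (simp add: lin_ext_def)
  finally show "lin_ext (\<lambda>b. const_part (\<delta> b)) (lin_ext (\<lambda>b. const_part (\<delta> b)) x) = \<zero>\<^bsub>reduced_module B dg\<^esub>"
    by (simp add: const_part_lin_ext[symmetric] reduced_lin_ext[of _ x])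
qed

text \<open>
  This is the form in which \<open>Tor\<close> is defined: for the standard resolution the right-hand side is
  \<open>Tor\<close> by definition.
\<close>

lemma tensor_complex:
  "module_isomorphic base_ring
    (homology (reduced_module B dg) (lin_ext (\<lambda>b. const_part (\<delta> b))) q a)
    (homology (over_base (graded_tensor m F base_module)) (tensor_map (mpoly_ring m) F base_module (lin_ext \<delta>)) q a)"
proof -
  interpret free_tensor m B dg F "free_module (mpoly_ring m :: 'k mpoly ring) (carrier (free_module (mpoly_ring m :: 'k mpoly ring) B) \<times> (UNIV :: 'k set))"
    "tensor_kernel (mpoly_ring m) F (base_module :: ('k mpoly, 'k, expo) graded_module)"
    by unfold_locales simp_all
  show ?thesis
    by (rule module_complex_transport(2)[OF reduced_complex base_tensor_iso])
      (simp_all add: base_tensor_zero gr_tensor del: reduced_module_simps(5), simp add: tensor_map_base_tensor boundary_closed)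
qed

end

text \<open>
  A chain map given by its values on the basis that induces the identity of \<open>k[x]/I\<close>.
\<close>

definition lifts_identity where
  "lifts_identity m I B dg \<delta> r C eg \<epsilon> s \<phi> \<longleftrightarrow> (\<forall>b\<in>B. \<phi> b \<in> gr (graded_free_module m C eg) (dg b) \<and>
     lin_ext \<epsilon> (\<phi> b) = lin_ext \<phi> (\<delta> b) \<and> (fst (dg b) = 0 \<longrightarrow> augment s (\<phi> b) - r b \<in> I))"

text \<open>
  The value on a basis element is chosen by recursion on its homological degree: the chain map
  sends the boundary of \<open>b\<close> to a cycle, and by exactness of the target this cycle is a boundary.
\<close>

lemma chain_map_exists:
  fixes I :: "'k::comm_ring_1 mpoly set" and dg :: "'b \<Rightarrow> nat \<times> expo" and eg :: "'c \<Rightarrow> nat \<times> expo"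
  assumes "graded_free_resolution m I B dg \<delta> r" "graded_free_resolution m I C eg \<epsilon> s"
  obtains \<phi> where "lifts_identity m I B dg \<delta> r C eg \<epsilon> s \<phi>"
proof -
  interpret F: graded_free_resolution m I B dg \<delta> r by fact
  interpret G: graded_free_resolution m I C eg \<epsilon> s by fact
  note idl = ideal_mpoly_closed[OF F.ideal]
  define Q where "Q \<phi> b y \<longleftrightarrow> (b \<in> B \<longrightarrow> y \<in> gr G.F (dg b) \<and> lin_ext \<epsilon> y = lin_ext \<phi> (\<delta> b) \<and>
    (fst (dg b) = 0 \<longrightarrow> augment s y - r b \<in> I))" for \<phi> :: "'b \<Rightarrow> ('c \<Rightarrow>\<^sub>0 'k mpoly)" and b y
  have "\<exists>\<phi>. \<forall>b. Q \<phi> b (\<phi> b)"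
  proof (rule dependent_wf_choice[of "measure (\<lambda>b. fst (dg b))"])
    fix \<phi> \<psi> :: "'b \<Rightarrow> ('c \<Rightarrow>\<^sub>0 'k mpoly)" and b y assume "\<And>c. (c, b) \<in> measure (\<lambda>b. fst (dg b)) \<Longrightarrow> \<phi> c = \<psi> c"
    then have "lin_ext \<phi> (\<delta> b) = lin_ext \<psi> (\<delta> b)" if "b \<in> B"
      using F.boundary_keys[OF that] by (intro lin_ext_cong) auto
    then show "Q \<phi> b y = Q \<psi> b y" by (auto simp: Q_def)
  next
    fix b and \<phi> :: "'b \<Rightarrow> ('c \<Rightarrow>\<^sub>0 'k mpoly)" assume IH: "\<And>c. (c, b) \<in> measure (\<lambda>b. fst (dg b)) \<Longrightarrow> Q \<phi> c (\<phi> c)"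
    show "\<exists>y. Q \<phi> b y"
    proof (cases "b \<in> B")
      case b: True
      have IHb: "\<phi> c \<in> gr G.F (dg c)" "lin_ext \<epsilon> (\<phi> c) = lin_ext \<phi> (\<delta> c)"
          "fst (dg c) = 0 \<Longrightarrow> augment s (\<phi> c) - r c \<in> I"
        if "c \<in> B" "fst (dg b) = Suc (fst (dg c))" for c
        using IH[of c] that by (auto simp: Q_def)
      obtain q a where d: "dg b = (q, a)" by (cases "dg b")
      show ?thesis
      proof (cases q)
        case 0
        then obtain y where "y \<in> gr G.F (0, a)" "augment s y - r b \<in> I"
          using F.generator[OF b, of a] G.augment_onto[of "r b" a] d by auto
        then show ?thesis using d 0 b by (auto simp: Q_def F.boundary_0 G.boundary_degree_0)
      next
        case (Suc p)
        let ?w = "lin_ext \<phi> (\<delta> b)"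
        have \<delta>b: "\<delta> b \<in> gr F.F (p, a)" using F.boundary[OF b] d Suc by simp
        have w: "?w \<in> gr G.F (p, a)"
          by (rule homogeneous_lin_ext[OF \<delta>b]) (use IHb(1) d Suc in \<open>metis fst_conv prod.collapse\<close>)
        have "if p = 0 then augment s ?w \<in> I else lin_ext \<epsilon> ?w = 0"
        proof (cases "p = 0")
          case True
          have "augment s ?w - augment r (\<delta> b) \<in> I"
          proof (rule augment_lin_ext_congruent[OF F.ideal])
            fix c assume c: "c \<in> Poly_Mapping.keys (\<delta> b)"
            show "augment s (\<phi> c) - r c \<in> I"
              using F.boundary_keys[OF b c] IHb(3) True d Suc by simp
          qed (use \<delta>b in \<open>auto simp: gr_graded_free_module\<close>)
          moreover have "augment r (\<delta> b) \<in> I"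
            using F.augment_boundary[OF b, of a] d Suc True by simp
          ultimately have "(augment s ?w - augment r (\<delta> b)) + augment r (\<delta> b) \<in> I"
            by (rule idl)
          then show ?thesis using True by simp
        next
          case False
          have "lin_ext \<epsilon> ?w = lin_ext (\<lambda>c. lin_ext \<phi> (\<delta> c)) (\<delta> b)"
            unfolding lin_ext_lin_ext using F.boundary_keys[OF b] IHb(2) by (intro lin_ext_cong) auto
          also have "\<dots> = 0" by (simp add: lin_ext_lin_ext[symmetric] F.boundary_boundary[OF b])
          finally show ?thesis using False by simp
        qed
        from G.exact[OF w this] obtain y where "y \<in> gr G.F (Suc p, a)" "lin_ext \<epsilon> y = ?w" by auto
        then show ?thesis using d Suc by (auto simp: Q_def)
      qed
    qed (simp add: Q_def)
  qed simp
  then show ?thesis using that by (auto simp: Q_def lifts_identity_def)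
qed

text \<open>
  The same recursion, applied to a chain map \<open>\<chi>\<close> that induces zero: \<open>\<chi> b - h (\<delta> b)\<close> is a cycle, so it is
  the boundary of an element that can serve as \<open>h b\<close>.
\<close>

lemma null_homotopy_exists:
  fixes I :: "'k::comm_ring_1 mpoly set" and dg :: "'b \<Rightarrow> nat \<times> expo" and eg :: "'c \<Rightarrow> nat \<times> expo"
  assumes "graded_free_resolution m I B dg \<delta> r" "graded_free_resolution m I C eg \<epsilon> s"
    and \<chi>: "\<And>b. b \<in> B \<Longrightarrow> \<chi> b \<in> gr (graded_free_module m C eg) (dg b)"
      "\<And>b. b \<in> B \<Longrightarrow> lin_ext \<epsilon> (\<chi> b) = lin_ext \<chi> (\<delta> b)"
      "\<And>b. \<lbrakk>b \<in> B; fst (dg b) = 0\<rbrakk> \<Longrightarrow> augment s (\<chi> b) \<in> I"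
  obtains h where "\<And>b. b \<in> B \<Longrightarrow> h b \<in> gr (graded_free_module m C eg) (Suc (fst (dg b)), snd (dg b))"
    and "\<And>b. b \<in> B \<Longrightarrow> lin_ext \<epsilon> (h b) = \<chi> b - lin_ext h (\<delta> b)"
proof -
  interpret F: graded_free_resolution m I B dg \<delta> r by fact
  interpret G: graded_free_resolution m I C eg \<epsilon> s by fact
  define Q where "Q h b y \<longleftrightarrow> (b \<in> B \<longrightarrow> y \<in> gr G.F (Suc (fst (dg b)), snd (dg b)) \<and>
    lin_ext \<epsilon> y = \<chi> b - lin_ext h (\<delta> b))" for h :: "'b \<Rightarrow> ('c \<Rightarrow>\<^sub>0 'k mpoly)" and b y
  have "\<exists>h. \<forall>b. Q h b (h b)"
  proof (rule dependent_wf_choice[of "measure (\<lambda>b. fst (dg b))"])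
    fix h k :: "'b \<Rightarrow> ('c \<Rightarrow>\<^sub>0 'k mpoly)" and b y assume "\<And>c. (c, b) \<in> measure (\<lambda>b. fst (dg b)) \<Longrightarrow> h c = k c"
    then have "lin_ext h (\<delta> b) = lin_ext k (\<delta> b)" if "b \<in> B"
      using F.boundary_keys[OF that] by (intro lin_ext_cong) auto
    then show "Q h b y = Q k b y" by (auto simp: Q_def)
  next
    fix b and h :: "'b \<Rightarrow> ('c \<Rightarrow>\<^sub>0 'k mpoly)" assume IH: "\<And>c. (c, b) \<in> measure (\<lambda>b. fst (dg b)) \<Longrightarrow> Q h c (h c)"
    show "\<exists>y. Q h b y"
    proof (cases "b \<in> B")
      case b: True
      have IHb: "h c \<in> gr G.F (Suc (fst (dg c)), snd (dg c))" "lin_ext \<epsilon> (h c) = \<chi> c - lin_ext h (\<delta> c)"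
        if "c \<in> B" "fst (dg b) = Suc (fst (dg c))" for c
        using IH[of c] that by (auto simp: Q_def)
      obtain q a where d: "dg b = (q, a)" by (cases "dg b")
      let ?w = "\<chi> b - lin_ext h (\<delta> b)"
      have "lin_ext h (\<delta> b) \<in> gr G.F (q, a)"
      proof (cases q)
        case 0
        then show ?thesis using F.boundary_0[OF b] d homogeneous_zero by simp
      next
        case (Suc p)
        then have "\<delta> b \<in> gr F.F (p, a)" using F.boundary[OF b] d by simp
        then show ?thesis by (rule homogeneous_lin_ext) (use IHb(1) d Suc in auto)
      qed
      then have w: "?w \<in> gr G.F (q, a)" using \<chi>(1)[OF b] d by (intro homogeneous_diff) simp_all
      have "if q = 0 then augment s ?w \<in> I else lin_ext \<epsilon> ?w = 0"
      proof (cases "q = 0")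
        case True
        then show ?thesis using \<chi>(3)[OF b] F.boundary_0[OF b] d by simp
      next
        case False
        have "lin_ext \<epsilon> (lin_ext h (\<delta> b)) = lin_ext (\<lambda>c. \<chi> c - lin_ext h (\<delta> c)) (\<delta> b)"
          unfolding lin_ext_lin_ext using F.boundary_keys[OF b] IHb(2) by (intro lin_ext_cong) auto
        also have "\<dots> = lin_ext \<chi> (\<delta> b)"
          by (simp add: lin_ext_fun_diff lin_ext_lin_ext[symmetric] F.boundary_boundary[OF b])
        finally show ?thesis using False \<chi>(2)[OF b] by (simp add: lin_ext_diff)
      qed
      from G.exact[OF w this] obtain y where "y \<in> gr G.F (Suc q, a)" "lin_ext \<epsilon> y = ?w" by auto
      then show ?thesis using d by (auto simp: Q_def)
    qed (simp add: Q_def)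
  qed simp
  then show ?thesis using that by (auto simp: Q_def)
qed

lemma round_trip_homotopy:
  fixes I :: "'k::comm_ring_1 mpoly set" and dg :: "'b \<Rightarrow> nat \<times> expo" and eg :: "'c \<Rightarrow> nat \<times> expo"
  assumes "graded_free_resolution m I B dg \<delta> r" "graded_free_resolution m I C eg \<epsilon> s"
    and \<phi>: "lifts_identity m I B dg \<delta> r C eg \<epsilon> s \<phi>" and \<psi>: "lifts_identity m I C eg \<epsilon> s B dg \<delta> r \<psi>"
  obtains h where "\<And>b. b \<in> B \<Longrightarrow> h b \<in> gr (graded_free_module m B dg) (Suc (fst (dg b)), snd (dg b))"
    and "\<And>b. b \<in> B \<Longrightarrow> lin_ext \<delta> (h b) + lin_ext h (\<delta> b) = lin_ext \<psi> (\<phi> b) - Poly_Mapping.single b 1"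
proof -
  interpret F: graded_free_resolution m I B dg \<delta> r by fact
  interpret G: graded_free_resolution m I C eg \<epsilon> s by fact
  note idl = ideal_mpoly_closed[OF F.ideal]
  define \<chi> where "\<chi> b = lin_ext \<psi> (\<phi> b) - Poly_Mapping.single b 1" for b
  have \<phi>b: "\<phi> b \<in> gr G.F (dg b)" "lin_ext \<epsilon> (\<phi> b) = lin_ext \<phi> (\<delta> b)"
    "fst (dg b) = 0 \<Longrightarrow> augment s (\<phi> b) - r b \<in> I" if "b \<in> B" for b
    using \<phi> that by (auto simp: lifts_identity_def)
  have \<psi>c: "\<psi> c \<in> gr F.F (dg' , a)" if "c \<in> C" "eg c = (dg', a)" for c dg' a
    using \<psi> that by (auto simp: lifts_identity_def)
  have \<psi>c': "lin_ext \<delta> (\<psi> c) = lin_ext \<psi> (\<epsilon> c)"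
    "fst (eg c) = 0 \<Longrightarrow> augment r (\<psi> c) - s c \<in> I" if "c \<in> C" for c
    using \<psi> that by (auto simp: lifts_identity_def)
  have \<phi>_keys: "c \<in> C \<and> fst (eg c) = fst (dg b) \<and> Poly_Mapping.lookup (\<phi> b) c \<in> carrier (mpoly_ring m)"
    if "b \<in> B" "c \<in> Poly_Mapping.keys (\<phi> b)" for b c
    using \<phi>b(1)[OF that(1)] that(2) by (cases "dg b") (auto simp: gr_graded_free_module)
  have 1: "\<chi> b \<in> gr F.F (dg b)" if b: "b \<in> B" for b
  proof -
    obtain q a where d: "dg b = (q, a)" by (cases "dg b")
    have "lin_ext \<psi> (\<phi> b) \<in> gr F.F (q, a)"
      by (rule homogeneous_lin_ext[where B = C and dg = eg])
        (use \<phi>b(1)[OF b] d in simp, metis \<psi>c prod.collapse)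
    moreover have "Poly_Mapping.single b 1 \<in> gr F.F (q, a)"
      using b d by (intro single_in_gr_graded_free_module)
    ultimately show ?thesis unfolding \<chi>_def d by (rule homogeneous_diff)
  qed
  have 2: "lin_ext \<delta> (\<chi> b) = lin_ext \<chi> (\<delta> b)" if b: "b \<in> B" for b
  proof -
    have "lin_ext \<delta> (lin_ext \<psi> (\<phi> b)) = lin_ext (\<lambda>c. lin_ext \<psi> (\<epsilon> c)) (\<phi> b)"
      unfolding lin_ext_lin_ext using \<phi>_keys[OF b] \<psi>c' by (intro lin_ext_cong) auto
    also have "\<dots> = lin_ext \<psi> (lin_ext \<phi> (\<delta> b))"
      using \<phi>b(2)[OF b] by (simp add: lin_ext_lin_ext[symmetric])
    finally show ?thesis
      by (simp add: \<chi>_def[abs_def] lin_ext_diff lin_ext_fun_diff lin_ext_id lin_ext_lin_ext)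
  qed
  have 3: "augment r (\<chi> b) \<in> I" if b: "b \<in> B" "fst (dg b) = 0" for b
  proof -
    have "augment r (lin_ext \<psi> (\<phi> b)) - augment s (\<phi> b) \<in> I"
      using \<phi>_keys[OF b(1)] \<psi>c'(2) b(2) by (intro augment_lin_ext_congruent[OF F.ideal]) auto
    then have "(augment r (lin_ext \<psi> (\<phi> b)) - augment s (\<phi> b)) + (augment s (\<phi> b) - r b) \<in> I"
      using \<phi>b(3)[OF b] by (rule idl)
    then show ?thesis by (simp add: \<chi>_def)
  qed
  obtain h where "\<And>b. b \<in> B \<Longrightarrow> h b \<in> gr F.F (Suc (fst (dg b)), snd (dg b))"
    "\<And>b. b \<in> B \<Longrightarrow> lin_ext \<delta> (h b) = \<chi> b - lin_ext h (\<delta> b)"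
    using null_homotopy_exists[OF assms(1,1) 1 2 3] by blast
  then show ?thesis using that[of h] by (simp add: \<chi>_def)
qed

text \<open>
  Chain maps and homotopies are determined by matrices over \<open>k[x]\<close>, and passing to constant terms
  respects products of matrices. So the homotopy equivalence over \<open>k[x]\<close> becomes one over \<open>k\<close>.
\<close>

lemma reduced_homology_isomorphic:
  fixes I :: "'k::comm_ring_1 mpoly set" and dg :: "'b \<Rightarrow> nat \<times> expo" and eg :: "'c \<Rightarrow> nat \<times> expo"
  assumes F: "graded_free_resolution m I B dg \<delta> r" and G: "graded_free_resolution m I C eg \<epsilon> s"
  shows "module_isomorphic base_ring
    (homology (reduced_module B dg) (lin_ext (\<lambda>b. const_part (\<delta> b))) q a)
    (homology (reduced_module C eg) (lin_ext (\<lambda>c. const_part (\<epsilon> c))) q a)"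
proof -
  interpret F: graded_free_resolution m I B dg \<delta> r by fact
  interpret G: graded_free_resolution m I C eg \<epsilon> s by fact
  interpret KF: module_complex base_ring "reduced_module B dg" "lin_ext (\<lambda>b. const_part (\<delta> b))"
    by (rule F.reduced_complex)
  interpret KG: module_complex base_ring "reduced_module C eg" "lin_ext (\<lambda>c. const_part (\<epsilon> c))"
    by (rule G.reduced_complex)
  obtain \<phi> where \<phi>: "lifts_identity m I B dg \<delta> r C eg \<epsilon> s \<phi>"
    using chain_map_exists[OF F G] .
  obtain \<psi> where \<psi>: "lifts_identity m I C eg \<epsilon> s B dg \<delta> r \<psi>"
    using chain_map_exists[OF G F] .
  obtain h where h: "\<And>b. b \<in> B \<Longrightarrow> h b \<in> gr F.F (Suc (fst (dg b)), snd (dg b))"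
    "\<And>b. b \<in> B \<Longrightarrow> lin_ext \<delta> (h b) + lin_ext h (\<delta> b) = lin_ext \<psi> (\<phi> b) - Poly_Mapping.single b 1"
    using round_trip_homotopy[OF F G \<phi> \<psi>] by blast
  obtain k where k: "\<And>c. c \<in> C \<Longrightarrow> k c \<in> gr G.F (Suc (fst (eg c)), snd (eg c))"
    "\<And>c. c \<in> C \<Longrightarrow> lin_ext \<epsilon> (k c) + lin_ext k (\<epsilon> c) = lin_ext \<phi> (\<psi> c) - Poly_Mapping.single c 1"
    using round_trip_homotopy[OF G F \<psi> \<phi>] by blast
  let ?d = "lin_ext (\<lambda>b. const_part (\<delta> b))" and ?e = "lin_ext (\<lambda>c. const_part (\<epsilon> c))"
  let ?f = "lin_ext (\<lambda>b. const_part (\<phi> b))" and ?g = "lin_ext (\<lambda>c. const_part (\<psi> c))"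
  let ?h = "lin_ext (\<lambda>b. const_part (h b))" and ?k = "lin_ext (\<lambda>c. const_part (k c))"
  have f_gr: "?f x \<in> gr (reduced_module C eg) (q, a)" if "x \<in> gr (reduced_module B dg) (q, a)" for x q a
    using \<phi> by (intro reduced_homogeneous[OF that, where m = m]) (metis lifts_identity_def prod.collapse)
  have g_gr: "?g x \<in> gr (reduced_module B dg) (q, a)" if "x \<in> gr (reduced_module C eg) (q, a)" for x q a
    using \<psi> by (intro reduced_homogeneous[OF that, where m = m]) (metis lifts_identity_def prod.collapse)
  have h_gr: "?h x \<in> gr (reduced_module B dg) (Suc q, a)" if "x \<in> gr (reduced_module B dg) (q, a)" for x q a
    using h(1) by (intro reduced_homogeneous[OF that, where m = m]) auto
  have k_gr: "?k x \<in> gr (reduced_module C eg) (Suc q, a)" if "x \<in> gr (reduced_module C eg) (q, a)" for x q a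
    using k(1) by (intro reduced_homogeneous[OF that, where m = m]) auto
  have comp: "lin_ext (\<lambda>c. const_part (\<beta> c)) (lin_ext (\<lambda>b. const_part (\<alpha> b)) x) =
      const_part (lin_ext (\<lambda>b. lin_ext \<beta> (\<alpha> b)) (const_coeffs x))"
    for \<alpha> :: "'x \<Rightarrow> ('y \<Rightarrow>\<^sub>0 'k mpoly)" and \<beta> :: "'y \<Rightarrow> ('z \<Rightarrow>\<^sub>0 'k mpoly)" and x
    by (simp add: const_part_lin_ext lin_ext_lin_ext)
  have f_d: "?f (?d x) = ?e (?f x)" if "Poly_Mapping.keys x \<subseteq> B" for x
    unfolding comp using \<phi> that
    by (intro arg_cong[where f = const_part] lin_ext_cong) (auto simp: lifts_identity_def)
  have g_d: "?g (?e x) = ?d (?g x)" if "Poly_Mapping.keys x \<subseteq> C" for x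
    unfolding comp using \<psi> that
    by (intro arg_cong[where f = const_part] lin_ext_cong) (auto simp: lifts_identity_def)
  have h_eq: "?d (?h x) + ?h (?d x) = ?g (?f x) - x" if "Poly_Mapping.keys x \<subseteq> B" for x
  proof -
    have "lin_ext (\<lambda>b. lin_ext \<delta> (h b) + lin_ext h (\<delta> b)) (const_coeffs x) =
        lin_ext (\<lambda>b. lin_ext \<psi> (\<phi> b) - Poly_Mapping.single b 1) (const_coeffs x)"
      using h(2) that by (intro lin_ext_cong) auto
    from arg_cong[OF this, of const_part] show ?thesis
      by (simp add: comp lin_ext_fun_add lin_ext_fun_diff lin_ext_id const_part_add const_part_diff)
  qed
  have k_eq: "?e (?k x) + ?k (?e x) = ?f (?g x) - x" if "Poly_Mapping.keys x \<subseteq> C" for x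
  proof -
    have "lin_ext (\<lambda>b. lin_ext \<epsilon> (k b) + lin_ext k (\<epsilon> b)) (const_coeffs x) =
        lin_ext (\<lambda>b. lin_ext \<phi> (\<psi> b) - Poly_Mapping.single b 1) (const_coeffs x)"
      using k(2) that by (intro lin_ext_cong) auto
    from arg_cong[OF this, of const_part] show ?thesis
      by (simp add: comp lin_ext_fun_add lin_ext_fun_diff lin_ext_id const_part_add const_part_diff)
  qed
  show ?thesis
  proof (rule homology_isomorphicI[OF F.reduced_complex G.reduced_complex, where f = ?f])
    show "?f \<in> mod_hom base_ring (reduced_module B dg) (reduced_module C eg)"
    proof (rule mod_hom_reduced_lin_ext)
      fix b assume "b \<in> B"
      then have "\<phi> b \<in> gr G.F (dg b)" using \<phi> by (simp add: lifts_identity_def)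
      then have "Poly_Mapping.keys (\<phi> b) \<subseteq> C" by (cases "dg b") (auto simp: gr_graded_free_module)
      then show "Poly_Mapping.keys (const_part (\<phi> b)) \<subseteq> C" using keys_const_part[of "\<phi> b"] by blast
    qed
  next
    fix x y assume x: "x \<in> gr (reduced_module B dg) (q, a)" "?d x = \<zero>\<^bsub>reduced_module B dg\<^esub>"
      and y: "y \<in> gr (reduced_module C eg) (Suc q, a)" "?f x = ?e y"
    have xB: "Poly_Mapping.keys x \<subseteq> B" and yC: "Poly_Mapping.keys y \<subseteq> C" using x y by auto
    have "?d (?g y - ?h x) = x"
      using h_eq[OF xB] g_d[OF yC] x(2) y(2) by (simp add: lin_ext_diff algebra_simps)
    moreover have "?g y - ?h x \<in> gr (reduced_module B dg) (Suc q, a)"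
      using g_gr[OF y(1)] h_gr[OF x(1)] keys_diff[of "?g y" "?h x"] by auto
    ultimately show "x \<in> ?d ` gr (reduced_module B dg) (Suc q, a)" by (metis imageI)
  next
    fix y assume y: "y \<in> gr (reduced_module C eg) (q, a)" "?e y = \<zero>\<^bsub>reduced_module C eg\<^esub>"
    have yC: "Poly_Mapping.keys y \<subseteq> C" using y by auto
    have gB: "?g y \<in> gr (reduced_module B dg) (q, a)" by (rule g_gr[OF y(1)])
    have "\<ominus>\<^bsub>reduced_module C eg\<^esub> ?f (?g y) = - ?f (?g y)"
      using f_gr[OF gB] by (intro KG.M.a_inv_eqI) auto
    then have eq: "y \<oplus>\<^bsub>reduced_module C eg\<^esub> (\<ominus>\<^bsub>reduced_module C eg\<^esub> ?f (?g y)) = ?e (- ?k y)"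
      using k_eq[OF yC] y(2) by (simp add: lin_ext_minus algebra_simps)
    have "- ?k y \<in> gr (reduced_module C eg) (Suc q, a)" using k_gr[OF y(1)] by simp
    then have "y \<oplus>\<^bsub>reduced_module C eg\<^esub> (\<ominus>\<^bsub>reduced_module C eg\<^esub> ?f (?g y))
        \<in> ?e ` gr (reduced_module C eg) (Suc q, a)"
      unfolding eq by (rule imageI)
    moreover have "?d (?g y) = \<zero>\<^bsub>reduced_module B dg\<^esub>" using g_d[OF yC] y(2) by simp
    ultimately show "\<exists>x\<in>gr (reduced_module B dg) (q, a). ?d x = \<zero>\<^bsub>reduced_module B dg\<^esub> \<and>
        y \<oplus>\<^bsub>reduced_module C eg\<^esub> (\<ominus>\<^bsub>reduced_module C eg\<^esub> ?f x) \<in> ?e ` gr (reduced_module C eg) (Suc q, a)"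
      by (intro bexI[OF _ gB] conjI)
  qed (use f_gr in \<open>auto intro!: f_d\<close>)
qed

section \<open>The standard resolution of a quotient of the polynomial ring\<close>

text \<open>
  A polynomial that represents the coset \<open>C\<close> carried by a generator \<open>Gen a C\<close>. It is chosen
  homogeneous of degree \<open>a\<close>, which is possible by the definition of the grading of \<open>k[x]/I\<close>.
\<close>

definition cell_rep :: "nat \<Rightarrow> 'k::comm_ring_1 mpoly set \<Rightarrow> ('k mpoly, 'k mpoly set) cell \<Rightarrow> 'k mpoly" where
  "cell_rep m I c = (case c of Gen a C \<Rightarrow>
      (SOME p. p \<in> carrier (mpoly_ring m) \<and> Poly_Mapping.keys p \<subseteq> {a} \<and> C = I +>\<^bsub>mpoly_ring m\<^esub> p)
    | Syz n a L \<Rightarrow> 0)"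

lemma std_basis_cases:
  assumes "b \<in> std_basis m M"
  obtains (Gen) a x where "b = Gen a x" "x \<in> gr M a"
  | (Syz) n a L where "b = Syz (Suc n) a L"
      "\<And>p c. (p, c) \<in> set L \<Longrightarrow> c \<in> std_basis m M \<and> fst (cell_deg c) = n \<and> p \<in> carrier (mpoly_ring m) \<and>
        (\<forall>t\<in>Poly_Mapping.keys p. t + snd (cell_deg c) = a)"
      "if n = 0 then std_aug M (lincomb L) = \<zero>\<^bsub>M\<^esub> else std_diff (lincomb L) = 0"
  using assms
proof (cases rule: std_basis.cases)
  case (Syz L n a)
  then show ?thesis by (intro that(2)[of n a L]) auto
qed (use that(1) in blast)

lemma lincomb_homogeneous:
  fixes dg :: "'b \<Rightarrow> nat \<times> expo"
  assumes "\<And>p c. (p, c) \<in> set L \<Longrightarrow> c \<in> B \<and> fst (dg c) = n \<and> p \<in> carrier (mpoly_ring m) \<and>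
        (\<forall>t\<in>Poly_Mapping.keys p. t + snd (dg c) = a)"
  shows "lincomb L \<in> gr (graded_free_module m B dg :: ('k::comm_ring_1 mpoly, _, _) graded_module) (n, a)"
  using assms
proof (induction L)
  case Nil
  show ?case by (simp add: lincomb_def homogeneous_zero)
next
  case (Cons pc L)
  obtain p c where pc: "pc = (p, c)" by (cases pc)
  have "Poly_Mapping.single c p \<in> gr (graded_free_module m B dg) (n, a)"
    using Cons.prems[of p c] pc
    by (auto simp: gr_graded_free_module lookup_single when_def mpoly_closed split: if_splits)
  moreover have "lincomb L \<in> gr (graded_free_module m B dg) (n, a)"
    by (rule Cons.IH) (rule Cons.prems, simp)
  moreover have "lincomb (pc # L) = Poly_Mapping.single c p + lincomb L"
    by (simp add: lincomb_def pc)
  ultimately show ?case by (simp add: homogeneous_add)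
qed

text \<open>
  Exactness and surjectivity hold by construction of the standard resolution. What has to be
  checked is that \<open>std_aug\<close>, a sum formed in the quotient, is the coset of the polynomial \<open>augment\<close>.
\<close>

lemma std_graded_free_resolution:
  fixes I :: "'k::comm_ring_1 mpoly set"
  assumes I: "ideal I (mpoly_ring m)"
  shows "graded_free_resolution m I (std_basis m (quot_ring_module m I)) cell_deg cell_boundary (cell_rep m I)"
proof -
  let ?M = "quot_ring_module m I" and ?R = "mpoly_ring m :: 'k mpoly ring"
  let ?F = "graded_free_module m (std_basis m ?M) cell_deg"
  let ?r = "cell_rep m I"
  interpret R: cring ?R by (rule cring_mpoly_ring)
  interpret I: ideal I ?R by fact
  note idl = ideal_mpoly_closed[OF I]
  have coset_mem: "p \<in> I +>\<^bsub>?R\<^esub> q \<longleftrightarrow> p - q \<in> I" for p q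
    unfolding a_r_coset_def' by (auto simp: algebra_simps) (metis diff_add_cancel)
  have coset_eq: "I +>\<^bsub>?R\<^esub> p = I +>\<^bsub>?R\<^esub> q \<longleftrightarrow> p - q \<in> I"
    if "p \<in> carrier ?R" "q \<in> carrier ?R" for p q
    using I.a_repr_independence'[OF _ that(2), of p] I.a_repr_independenceD[OF that(1), of q] coset_mem[of p q] by metis
  have coset_0: "I +>\<^bsub>?R\<^esub> 0 = I"
    using I.a_rcos_const[OF idl(1)] .
  have M_zero: "\<zero>\<^bsub>?M\<^esub> = I +>\<^bsub>?R\<^esub> 0" unfolding coset_0 by (simp add: quot_ring_module_def FactRing_def)
  have M_add: "(I +>\<^bsub>?R\<^esub> p) \<oplus>\<^bsub>?M\<^esub> (I +>\<^bsub>?R\<^esub> q) = I +>\<^bsub>?R\<^esub> (p + q)" if "p \<in> carrier ?R" "q \<in> carrier ?R" for p q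
    using I.a_rcos_sum[OF that] by (simp add: quot_ring_module_def FactRing_def)
  have M_smult: "p \<odot>\<^bsub>?M\<^esub> (I +>\<^bsub>?R\<^esub> q) = I +>\<^bsub>?R\<^esub> (p * q)" if "p \<in> carrier ?R" "q \<in> carrier ?R" for p q
    using I.rcoset_mult_add[OF that] by (simp add: quot_ring_module_def FactRing_def)
  have M_carrier: "carrier ?M = (\<lambda>p. I +>\<^bsub>?R\<^esub> p) ` carrier ?R"
    by (auto simp: quot_ring_module_def FactRing_def A_RCOSETS_def')
  interpret M: abelian_group ?M
    by (rule abelian_group_transport[OF R.abelian_group_axioms M_carrier])
      (simp_all add: M_zero M_add)
  have rep: "?r (Gen a C) \<in> carrier ?R \<and> Poly_Mapping.keys (?r (Gen a C)) \<subseteq> {a} \<and> C = I +>\<^bsub>?R\<^esub> ?r (Gen a C)"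
    if C: "C \<in> gr ?M a" for a C
  proof -
    have "\<exists>p. p \<in> carrier ?R \<and> Poly_Mapping.keys p \<subseteq> {a} \<and> C = I +>\<^bsub>?R\<^esub> p"
      using C by (auto simp: quot_ring_module_def)
    from someI_ex[OF this] show ?thesis by (simp add: cell_rep_def)
  qed
  have gen_value: "?r b \<in> carrier ?R \<and> gen_value b = I +>\<^bsub>?R\<^esub> ?r b"
    if "b \<in> std_basis m ?M" "fst (cell_deg b) = 0" for b
    using that(1) by (cases rule: std_basis_cases) (use that(2) rep in auto)
  have std_aug: "std_aug ?M z = I +>\<^bsub>?R\<^esub> augment ?r z \<and> augment ?r z \<in> carrier ?R"
    if z: "z \<in> gr ?F (0, a)" for z a
  proof -
    have "(\<Oplus>\<^bsub>?M\<^esub>b\<in>A. Poly_Mapping.lookup z b \<odot>\<^bsub>?M\<^esub> gen_value b) =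
        I +>\<^bsub>?R\<^esub> (\<Sum>b\<in>A. Poly_Mapping.lookup z b * ?r b) \<and> (\<Sum>b\<in>A. Poly_Mapping.lookup z b * ?r b) \<in> carrier ?R"
      if "finite A" "A \<subseteq> Poly_Mapping.keys z" for A
      using that
    proof (induction A)
      case empty
      then show ?case by (simp add: M_zero mpoly_closed)
    next
      case (insert c A)
      have zc: "Poly_Mapping.lookup z b \<in> carrier ?R" for b using z by (auto simp: gr_graded_free_module)
      have gv: "Poly_Mapping.lookup z b \<odot>\<^bsub>?M\<^esub> gen_value b = I +>\<^bsub>?R\<^esub> (Poly_Mapping.lookup z b * ?r b)
          \<and> Poly_Mapping.lookup z b * ?r b \<in> carrier ?R" if "b \<in> insert c A" for b
      proof -
        have "b \<in> std_basis m ?M" "fst (cell_deg b) = 0"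
          using that insert.prems z by (auto simp: gr_graded_free_module)
        then show ?thesis using gen_value[of b] M_smult[OF zc[of b], of "?r b"] zc[of b] by (simp add: mpoly_closed)
      qed
      have "(\<Oplus>\<^bsub>?M\<^esub>b\<in>insert c A. Poly_Mapping.lookup z b \<odot>\<^bsub>?M\<^esub> gen_value b) =
        Poly_Mapping.lookup z c \<odot>\<^bsub>?M\<^esub> gen_value c \<oplus>\<^bsub>?M\<^esub> (\<Oplus>\<^bsub>?M\<^esub>b\<in>A. Poly_Mapping.lookup z b \<odot>\<^bsub>?M\<^esub> gen_value b)"
        using insert.hyps gv by (intro M.finsum_insert) (auto simp: M_carrier)
      then show ?case
        using insert.IH insert.prems insert.hyps gv[of c] by (simp add: M_add mpoly_closed)
    qed
    then show ?thesis unfolding std_aug_def augment_def by simp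
  qed
  have std_aug_0: "std_aug ?M z = \<zero>\<^bsub>?M\<^esub> \<longleftrightarrow> augment ?r z \<in> I" if "z \<in> gr ?F (0, a)" for z a
    using std_aug[OF that] coset_eq[of "augment ?r z" 0] by (simp add: M_zero mpoly_closed)
  show ?thesis
  proof
    fix b q a assume b: "b \<in> std_basis m ?M" "cell_deg b = (Suc q, a)"
    from b(1) show "cell_boundary b \<in> gr ?F (q, a)"
    proof (cases rule: std_basis_cases)
      case (Syz n a' L)
      have "lincomb L \<in> gr ?F (n, a')"
        by (rule lincomb_homogeneous) (use Syz(2) in blast)
      then show ?thesis using Syz(1) b(2) by simp
    qed (use b in simp)
  next
    fix b assume "b \<in> std_basis m ?M" "fst (cell_deg b) = 0"
    then show "cell_boundary b = 0" by (cases rule: std_basis_cases) auto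
  next
    fix b assume "b \<in> std_basis m ?M"
    then show "lin_ext cell_boundary (cell_boundary b) = 0"
      using std_diff_std_diff[of "Poly_Mapping.single b 1" m ?M] by (simp add: std_diff_def)
  next
    fix b a assume b: "b \<in> std_basis m ?M" "cell_deg b = (0, a)"
    from b(1) show "?r b \<in> carrier ?R \<and> Poly_Mapping.keys (?r b) \<subseteq> {a}"
      by (cases rule: std_basis_cases) (use b(2) rep in auto)
  next
    fix b a assume b: "b \<in> std_basis m ?M" "cell_deg b = (1, a)"
    from b(1) show "augment ?r (cell_boundary b) \<in> I"
    proof (cases rule: std_basis_cases)
      case (Syz n a' L)
      have "lincomb L \<in> gr ?F (n, a')"
        by (rule lincomb_homogeneous) (use Syz(2) in blast)
      then show ?thesis using Syz(1,3) b(2) std_aug_0 by simp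
    qed (use b in simp)
  next
    fix z q a assume z: "z \<in> gr ?F (q, a)" and cycle: "if q = 0 then augment ?r z \<in> I else lin_ext cell_boundary z = 0"
    have "if q = 0 then std_aug ?M z = \<zero>\<^bsub>?M\<^esub> else std_diff z = 0"
      using cycle z std_aug_0 by (simp add: std_diff_def split: if_splits)
    then show "z \<in> lin_ext cell_boundary ` gr ?F (Suc q, a)"
      using std_resolution_exact[of z m ?M q a] z by (simp add: std_resolution_def std_diff_def)
  next
    fix p :: "'k mpoly" and a assume p: "p \<in> carrier ?R" "Poly_Mapping.keys p \<subseteq> {a}"
    then have C: "I +>\<^bsub>?R\<^esub> p \<in> gr ?M a" by (auto simp: quot_ring_module_def)
    let ?b = "Gen a (I +>\<^bsub>?R\<^esub> p)"
    have "Poly_Mapping.single ?b 1 \<in> gr ?F (0, a)"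
      by (rule single_in_gr_graded_free_module) (use C in \<open>auto intro: std_basis.Gen\<close>)
    moreover have "augment ?r (Poly_Mapping.single ?b 1) - p \<in> I"
      using rep[OF C] coset_eq[of "?r ?b" p] p(1) by simp
    ultimately show "\<exists>z\<in>gr ?F (0, a). augment ?r z - p \<in> I" by blast
  qed
qed

section \<open>The simplicial boundary on lists\<close>

text \<open>
  The augmented simplicial boundary, with the sign convention \<open>(-1)\<^sup>i\<close> for omitting the \<open>i\<close>-th vertex,
  counted from \<open>1\<close>. Arbitrary lists are admitted as simplices, which makes the recursion
  \<open>face_sum_Cons\<close> unconditional.
\<close>

definition face_sum :: "nat list \<Rightarrow> (nat list \<Rightarrow>\<^sub>0 'r::comm_ring_1)" where
  "face_sum u = (\<Sum>i = 1..length u. Poly_Mapping.single (del_gen i u) ((-1) ^ i))"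

abbreviation prepend :: "nat \<Rightarrow> (nat list \<Rightarrow>\<^sub>0 'r) \<Rightarrow> (nat list \<Rightarrow>\<^sub>0 'r::comm_ring_1)" where
  "prepend j \<equiv> lin_ext (\<lambda>u. Poly_Mapping.single (j # u) 1)"

lemma face_sum_Nil [simp]: "face_sum [] = 0"
  by (simp add: face_sum_def)

lemma face_sum_Cons: "face_sum (j # u) = - Poly_Mapping.single u 1 - prepend j (face_sum u)"
proof -
  have "face_sum (j # u) = Poly_Mapping.single (del_gen 1 (j # u)) (-1) +
      (\<Sum>i = 1..length u. Poly_Mapping.single (del_gen (Suc i) (j # u)) ((-1) ^ Suc i))"
    unfolding face_sum_def length_Cons
    by (subst sum.atLeast_Suc_atMost, simp, subst sum.atLeast_Suc_atMost_Suc_shift) (simp add: comp_def)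
  also have "(\<Sum>i = 1..length u. Poly_Mapping.single (del_gen (Suc i) (j # u)) ((-1) ^ Suc i)) =
      - prepend j (face_sum u)"
  proof -
    have "del_gen (Suc i) (j # u) = j # del_gen i u" if "i \<in> {1..length u}" for i
      using that by (cases i) (auto simp: del_gen_def)
    then show ?thesis
      by (simp add: face_sum_def lin_ext_sum sum_negf[symmetric] single_uminus)
  qed
  finally show ?thesis by (simp add: del_gen_def single_uminus)
qed

text \<open>
  Induction with \<open>face_sum_Cons\<close> replaces the usual cancellation in a double sum: writing \<open>d\<close> for
  \<open>face_sum\<close>, one gets \<open>d (d (j u)) = - d u - d (j (d u)) = - d u + d u + j (d (d u))\<close>.
\<close>

lemma face_sum_face_sum: "lin_ext face_sum (face_sum u) = (0 :: nat list \<Rightarrow>\<^sub>0 'r::comm_ring_1)"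
proof (induction u)
  case (Cons j u)
  have "lin_ext face_sum (prepend j (face_sum u)) =
      (- face_sum u - prepend j (lin_ext face_sum (face_sum u)) :: nat list \<Rightarrow>\<^sub>0 'r)"
    by (simp add: lin_ext_lin_ext face_sum_Cons lin_ext_fun_diff lin_ext_fun_minus lin_ext_id)
  then show ?case by (simp add: face_sum_Cons[of j u] lin_ext_diff lin_ext_minus Cons)
qed simp

lemma keys_face_sum:
  assumes "v \<in> Poly_Mapping.keys (face_sum u :: nat list \<Rightarrow>\<^sub>0 'r::comm_ring_1)"
  obtains i where "i \<in> {1..length u}" "v = del_gen i u"
proof -
  have "v \<in> (\<Union>i\<in>{1..length u}. Poly_Mapping.keys (Poly_Mapping.single (del_gen i u) ((-1) ^ i :: 'r)))"
    using assms keys_sum[of "\<lambda>i. Poly_Mapping.single (del_gen i u) ((-1) ^ i :: 'r)" "{1..length u}"]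
    unfolding face_sum_def by blast
  then show ?thesis using that by (auto split: if_splits)
qed

lemma del_gen_props:
  assumes "i \<in> {1..length u}"
  shows "length (del_gen i u) = length u - 1" "set (del_gen i u) \<subseteq> set u"
    "sorted_wrt (<) u \<Longrightarrow> sorted_wrt (<) (del_gen i u)"
proof -
  show "length (del_gen i u) = length u - 1" using assms by (auto simp: del_gen_def min_def)
  show "set (del_gen i u) \<subseteq> set u"
    using set_take_subset[of "i - 1" u] set_drop_subset[of i u] by (auto simp: del_gen_def)
  assume s: "sorted_wrt (<) u"
  then have "sorted_wrt (<) (take (i - 1) u @ drop (i - 1) u)" by simp
  moreover have "set (drop i u) \<subseteq> set (drop (i - 1) u)" by (rule set_drop_subset_set_drop) simp
  ultimately show "sorted_wrt (<) (del_gen i u)"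
    using s unfolding del_gen_def sorted_wrt_append by (blast intro: sorted_wrt_drop)
qed

text \<open>
  Coning with apex \<open>j\<close>. The minus sign compensates the sign \<open>(-1)\<^sup>1\<close> of the face that omits the first
  vertex. If \<open>j\<close> is at most every vertex of a sorted list, then the list contains \<open>j\<close> exactly if it
  starts with \<open>j\<close>.
\<close>

definition cone :: "nat \<Rightarrow> nat list \<Rightarrow> (nat list \<Rightarrow>\<^sub>0 'r::comm_ring_1)" where
  "cone j u = (if u \<noteq> [] \<and> hd u = j then 0 else - Poly_Mapping.single (j # u) 1)"

lemma cone_homotopy:
  assumes u: "sorted_wrt (<) u" and j: "\<And>x. x \<in> set u \<Longrightarrow> j \<le> x"
  shows "lin_ext face_sum (cone j u) + lin_ext (cone j) (face_sum u) = Poly_Mapping.single u 1"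
proof (cases "u \<noteq> [] \<and> hd u = j")
  case True
  then obtain v where v: "u = j # v" by (cases u) auto
  have "cone j v = (- Poly_Mapping.single (j # v) 1 :: nat list \<Rightarrow>\<^sub>0 'a)"
    using u v by (cases v) (auto simp: cone_def)
  moreover have "lin_ext (cone j) (prepend j f) = (0 :: nat list \<Rightarrow>\<^sub>0 'a)" for f
    by (simp add: lin_ext_lin_ext cone_def) (simp add: lin_ext_def)
  ultimately show ?thesis
    by (simp add: v face_sum_Cons lin_ext_diff lin_ext_minus) (simp add: cone_def)
next
  case False
  have notin: "j \<notin> set u"
  proof
    assume "j \<in> set u"
    then obtain x v where "u = x # v" by (cases u) auto
    with \<open>j \<in> set u\<close> False u j[of x] show False by auto
  qed
  have "lin_ext (cone j) (face_sum u) = lin_ext (\<lambda>v. - Poly_Mapping.single (j # v) 1) (face_sum u :: nat list \<Rightarrow>\<^sub>0 'a)"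
  proof (rule lin_ext_cong)
    fix v assume "v \<in> Poly_Mapping.keys (face_sum u :: nat list \<Rightarrow>\<^sub>0 'a)"
    then obtain i where "i \<in> {1..length u}" "v = del_gen i u" by (rule keys_face_sum)
    then have "set v \<subseteq> set u" using del_gen_props(2) by simp
    then show "cone j v = - Poly_Mapping.single (j # v) 1" using notin by (cases v) (auto simp: cone_def)
  qed
  also have "\<dots> = - prepend j (face_sum u)" by (rule lin_ext_fun_minus)
  finally have "lin_ext (cone j) (face_sum u) = (- prepend j (face_sum u) :: nat list \<Rightarrow>\<^sub>0 'a)" .
  moreover have "cone j u = (- Poly_Mapping.single (j # u) 1 :: nat list \<Rightarrow>\<^sub>0 'a)"
    using False by (auto simp: cone_def)
  ultimately show ?thesis by (simp add: lin_ext_minus face_sum_Cons)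
qed

section \<open>Squarefree exponents and monomial ideals\<close>

lemma lookup_set_expo:
  assumes "finite \<sigma>"
  shows "Poly_Mapping.lookup (set_expo \<sigma>) i = (if i \<in> \<sigma> then 1 else 0)"
  using assms by (simp add: set_expo_def lookup_sum lookup_single when_def)

lemma keys_set_expo: "finite \<sigma> \<Longrightarrow> Poly_Mapping.keys (set_expo \<sigma>) = \<sigma>"
  by (simp add: set_eq_iff in_keys_iff lookup_set_expo)

lemma set_expo_diff_add:
  assumes "\<tau> \<subseteq> \<sigma>" "finite \<sigma>"
  shows "set_expo (\<sigma> - \<tau>) + set_expo \<tau> = set_expo \<sigma>"
  by (rule poly_mapping_eqI) (use assms finite_subset[OF assms] in \<open>auto simp add: lookup_add lookup_set_expo\<close>)

lemma set_expo_divides_iff: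
  assumes "finite \<sigma>"
  shows "(\<exists>t. a = t + set_expo \<sigma>) \<longleftrightarrow> \<sigma> \<subseteq> Poly_Mapping.keys a"
proof
  assume "\<sigma> \<subseteq> Poly_Mapping.keys a"
  then have "Poly_Mapping.lookup (set_expo \<sigma>) i \<le> Poly_Mapping.lookup a i" for i
    by (auto simp: lookup_set_expo assms in_keys_iff Suc_le_eq)
  then have "a = (a - set_expo \<sigma>) + set_expo \<sigma>"
    by (intro poly_mapping_eqI) (simp add: lookup_add lookup_minus)
  then show "\<exists>t. a = t + set_expo \<sigma>" by blast
qed (auto simp: keys_expo_add keys_set_expo assms)

lemma set_monom_closed: "\<sigma> \<subseteq> {1..m} \<Longrightarrow> set_monom \<sigma> \<in> carrier (mpoly_ring m :: 'k::comm_ring_1 mpoly ring)"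
  unfolding set_monom_def by (rule mpoly_closed) (simp add: keys_set_expo finite_subset[of \<sigma> "{1..m}"])

lemma set_monom_image_closed:
  "\<forall>\<sigma>\<in>S. \<sigma> \<subseteq> {1..m} \<Longrightarrow> set_monom ` S \<subseteq> carrier (mpoly_ring m :: 'k::comm_ring_1 mpoly ring)"
  by (intro image_subsetI set_monom_closed) blast

lemma ideal_complement_ideal:
  assumes "\<forall>\<tau>\<in>set P. \<tau> \<subseteq> {1..m}"
  shows "ideal (complement_ideal m P :: 'k::comm_ring_1 mpoly set) (mpoly_ring m)"
proof -
  interpret cring "mpoly_ring m :: 'k mpoly ring" by (rule cring_mpoly_ring)
  show ?thesis unfolding complement_ideal_def
    by (intro genideal_ideal set_monom_image_closed assms)
qed

lemma set_monom_in_complement_ideal: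
  assumes "\<forall>\<tau>\<in>set P. \<tau> \<subseteq> {1..m}" "\<tau> \<in> set P"
  shows "set_monom \<tau> \<in> (complement_ideal m P :: 'k::comm_ring_1 mpoly set)"
proof -
  interpret cring "mpoly_ring m :: 'k mpoly ring" by (rule cring_mpoly_ring)
  show ?thesis unfolding complement_ideal_def
    by (rule subsetD[OF genideal_self[OF set_monom_image_closed[OF assms(1)]]]) (use assms(2) in blast)
qed

text \<open>
  The polynomials whose exponents all contain some \<open>\<tau>\<close> in their support form an ideal that contains
  the generators.
\<close>

lemma keys_complement_ideal:
  assumes P: "\<forall>\<tau>\<in>set P. \<tau> \<subseteq> {1..m}"
    and p: "p \<in> (complement_ideal m P :: 'k::comm_ring_1 mpoly set)" "t \<in> Poly_Mapping.keys p"
  shows "\<exists>\<tau>\<in>set P. \<tau> \<subseteq> Poly_Mapping.keys t"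
proof -
  interpret cring "mpoly_ring m :: 'k mpoly ring" by (rule cring_mpoly_ring)
  let ?J = "{p \<in> carrier (mpoly_ring m :: 'k mpoly ring). \<forall>t\<in>Poly_Mapping.keys p. \<exists>\<tau>\<in>set P. \<tau> \<subseteq> Poly_Mapping.keys t}"
  have mult: "p * q \<in> ?J" if pq: "p \<in> ?J" "q \<in> carrier (mpoly_ring m)" for p q
  proof -
    have "\<exists>\<tau>\<in>set P. \<tau> \<subseteq> Poly_Mapping.keys t" if t: "t \<in> Poly_Mapping.keys (p * q)" for t
    proof -
      obtain u v where u: "t = u + v" "u \<in> Poly_Mapping.keys p"
        using t Poly_Mapping.keys_mult[of p q] by blast
      moreover obtain \<tau> where "\<tau> \<in> set P" "\<tau> \<subseteq> Poly_Mapping.keys u" using pq(1) u(2) by blast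
      ultimately show ?thesis by (metis keys_expo_add le_supI1)
    qed
    then show ?thesis using pq by (simp add: mpoly_closed)
  qed
  have "ideal ?J (mpoly_ring m)"
  proof (rule idealI)
    show "subgroup ?J (add_monoid (mpoly_ring m))"
    proof (rule add.subgroupI)
      show "?J \<noteq> {}" using mpoly_closed(1) by (auto intro!: exI[of _ 0])
      fix p q assume p: "p \<in> ?J"
      have "\<ominus>\<^bsub>mpoly_ring m\<^esub> p = - p"
        using p by (intro a_inv_eqI) (simp_all add: mpoly_closed)
      then show "\<ominus>\<^bsub>mpoly_ring m\<^esub> p \<in> ?J" using p by (simp add: mpoly_closed)
      assume "q \<in> ?J"
      then show "p \<oplus>\<^bsub>mpoly_ring m\<^esub> q \<in> ?J"
        using p Poly_Mapping.keys_add[of p q] by (simp add: mpoly_closed) blast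
    qed auto
  qed (use mult ring_axioms in \<open>simp_all add: mult.commute\<close>)
  moreover have "set_monom ` set P \<subseteq> ?J"
  proof
    fix p :: "'k mpoly" assume "p \<in> set_monom ` set P"
    then obtain \<tau> where \<tau>: "\<tau> \<in> set P" "p = set_monom \<tau>" by blast
    then have "\<tau> \<subseteq> {1..m}" using P by blast
    then have "p \<in> carrier (mpoly_ring m)" "Poly_Mapping.keys (set_expo \<tau>) = \<tau>"
      using \<tau>(2) set_monom_closed keys_set_expo finite_subset by blast+
    then show "p \<in> ?J" using \<tau> by (auto simp: set_monom_def)
  qed
  ultimately have "complement_ideal m P \<subseteq> ?J"
    unfolding complement_ideal_def by (rule genideal_minimal)
  then show ?thesis using p by blast
qed

text \<open>
  Each generator of the complement ideal belongs to a non-face, and for a non-face \<open>\<sigma>\<close> that contains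
  \<open>\<tau>\<close> from \<open>P\<close> the monomial of \<open>\<sigma>\<close> is the monomial of \<open>\<sigma> - \<tau>\<close> times that of \<open>\<tau>\<close>.
\<close>

lemma face_ideal_complement_complex:
  assumes P: "\<forall>\<tau>\<in>set P. \<tau> \<subseteq> {1..m}"
  shows "(face_ideal m (complement_complex m P) :: 'k::comm_ring_1 mpoly set) = complement_ideal m P"
proof -
  interpret cring "mpoly_ring m :: 'k mpoly ring" by (rule cring_mpoly_ring)
  let ?N = "{\<sigma>. \<sigma> \<subseteq> {1..m} \<and> \<sigma> \<notin> complement_complex m P}"
  have "set_monom \<sigma> \<in> (complement_ideal m P :: 'k mpoly set)" if \<sigma>: "\<sigma> \<in> ?N" for \<sigma>
  proof -
    obtain \<tau> where \<tau>: "\<tau> \<in> set P" "\<tau> \<subseteq> \<sigma>" using \<sigma> by (auto simp: complement_complex_def)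
    have fin: "finite \<sigma>" using \<sigma> finite_subset by auto
    have "set_monom (\<sigma> - \<tau>) * set_monom \<tau> = (set_monom \<sigma> :: 'k mpoly)"
      using set_expo_diff_add[OF \<tau>(2) fin] by (simp add: set_monom_def mult_single)
    moreover have "set_monom (\<sigma> - \<tau>) \<in> carrier (mpoly_ring m :: 'k mpoly ring)"
      using \<sigma> by (intro set_monom_closed) auto
    ultimately show ?thesis
      using ideal_mpoly_closed(3)[OF ideal_complement_ideal[OF P]] set_monom_in_complement_ideal[OF P \<tau>(1)]
      by metis
  qed
  then have "face_ideal m (complement_complex m P) \<subseteq> (complement_ideal m P :: 'k mpoly set)"
    unfolding face_ideal_def by (intro genideal_minimal ideal_complement_ideal P) auto
  moreover have "set_monom ` set P \<subseteq> (set_monom ` ?N :: 'k mpoly set)"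
    using P by (auto simp: complement_complex_def)
  then have "complement_ideal m P \<subseteq> (face_ideal m (complement_complex m P) :: 'k mpoly set)"
    unfolding complement_ideal_def face_ideal_def
    by (intro subset_Idl_subset set_monom_image_closed) auto
  ultimately show ?thesis by blast
qed

section \<open>The Taylor resolution\<close>

definition taylor_deg :: "nat set list \<Rightarrow> nat list \<Rightarrow> nat \<times> expo" where
  "taylor_deg P u = (length u, set_expo (total_set P u))"

definition taylor_boundary :: "nat set list \<Rightarrow> nat list \<Rightarrow> (nat list \<Rightarrow>\<^sub>0 'k::comm_ring_1 mpoly)" where
  "taylor_boundary P u = (\<Sum>i = 1..length u. Poly_Mapping.single (del_gen i u)
       ((-1) ^ i * set_monom (total_set P u - total_set P (del_gen i u))))"

lemma taylor_eq: "taylor m P = graded_free_module m (ext_gens P) (taylor_deg P)"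
  by (simp add: taylor_def taylor_deg_def[abs_def])

lemma taylor_diff_eq: "taylor_diff P = lin_ext (taylor_boundary P)"
  by (simp add: taylor_diff_def taylor_boundary_def[abs_def])

text \<open>
  The component of multidegree \<open>a\<close> of the Taylor complex has the basis \<open>x\<^sup>b u\<close> with \<open>b\<close> the difference of
  \<open>a\<close> and the exponent of the total set of \<open>u\<close>; this map sends \<open>u\<close> to that basis element. The
  subtraction of exponents is truncated, so it is meaningful only if the total set of \<open>u\<close> lies in the
  support of \<open>a\<close>.
\<close>

definition homogenize :: "nat set list \<Rightarrow> expo \<Rightarrow> (nat list \<Rightarrow>\<^sub>0 'k::comm_ring_1) \<Rightarrow> (nat list \<Rightarrow>\<^sub>0 'k mpoly)" where
  "homogenize P a w = Poly_Mapping.mapp (\<lambda>u. Poly_Mapping.single (a - set_expo (total_set P u))) w"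

lemma lookup_homogenize:
  "Poly_Mapping.lookup (homogenize P a w) u = Poly_Mapping.single (a - set_expo (total_set P u)) (Poly_Mapping.lookup w u)"
  by (simp add: homogenize_def Poly_Mapping.lookup_mapp when_def in_keys_iff)

lemma homogenize_add: "homogenize P a (v + w) = homogenize P a v + homogenize P a w"
  by (rule poly_mapping_eqI) (simp add: lookup_homogenize lookup_add single_add)

lemma homogenize_single:
  "homogenize P a (Poly_Mapping.single u c) = Poly_Mapping.single u (Poly_Mapping.single (a - set_expo (total_set P u)) c)"
  by (rule poly_mapping_eqI) (simp add: lookup_homogenize lookup_single when_def)

lemma homogenize_0 [simp]: "homogenize P a 0 = 0"
  by (rule poly_mapping_eqI) (simp add: lookup_homogenize)

lemma homogenize_sum: "homogenize P a (\<Sum>i\<in>A. f i) = (\<Sum>i\<in>A. homogenize P a (f i))"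
  by (induction A rule: infinite_finite_induct) (auto simp: homogenize_add)

lemma keys_homogenize: "Poly_Mapping.keys (homogenize P a w) = Poly_Mapping.keys w"
  by (auto simp: in_keys_iff lookup_homogenize single_eq_0_iff)

lemma homogenize_eq_0_iff: "homogenize P a w = 0 \<longleftrightarrow> w = 0"
  by (metis keys_eq_empty keys_homogenize)

locale simplicial_complement =
  fixes m :: nat and P :: "nat set list"
  assumes P: "\<forall>\<tau>\<in>set P. \<tau> \<subseteq> {1..m}"
begin

lemma total_set_subset: "u \<in> ext_gens P \<Longrightarrow> total_set P u \<subseteq> {1..m}"
  using P by (fastforce simp: ext_gens_def total_set_def)

lemma finite_total_set: "u \<in> ext_gens P \<Longrightarrow> finite (total_set P u)"
  using total_set_subset finite_subset by blast

lemma del_gen_ext_gens: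
  assumes "u \<in> ext_gens P" "i \<in> {1..length u}"
  shows "del_gen i u \<in> ext_gens P" "total_set P (del_gen i u) \<subseteq> total_set P u"
  using assms del_gen_props[OF assms(2)] by (auto simp: ext_gens_def total_set_def)

text \<open>
  The monomial coefficients of the Taylor differential are exactly those that keep the multidegree,
  so on the component of multidegree \<open>a\<close> only the signs remain.
\<close>

lemma taylor_homogenize:
  assumes "\<And>u. u \<in> Poly_Mapping.keys w \<Longrightarrow> u \<in> ext_gens P \<and> total_set P u \<subseteq> Poly_Mapping.keys a"
  shows "lin_ext (taylor_boundary P) (homogenize P a w) = homogenize P a (lin_ext face_sum (w :: nat list \<Rightarrow>\<^sub>0 'k::comm_ring_1))"
proof (rule additive_eq_on[of w "{u \<in> ext_gens P. total_set P u \<subseteq> Poly_Mapping.keys a}"])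
  fix u and c :: 'k assume u: "u \<in> {u \<in> ext_gens P. total_set P u \<subseteq> Poly_Mapping.keys a}"
  let ?t = "a - set_expo (total_set P u)"
  obtain t where t: "a = t + set_expo (total_set P u)"
    using u set_expo_divides_iff[OF finite_total_set, of u a] by auto
  have "pm_scale (Poly_Mapping.single ?t c) (Poly_Mapping.single (del_gen i u)
       ((-1) ^ i * set_monom (total_set P u - total_set P (del_gen i u)))) =
      homogenize P a (Poly_Mapping.single (del_gen i u) (c * (-1) ^ i))" if i: "i \<in> {1..length u}" for i
  proof -
    have "t + set_expo (total_set P u - total_set P (del_gen i u)) = a - set_expo (total_set P (del_gen i u))"
      unfolding t using set_expo_diff_add[OF del_gen_ext_gens(2)[OF _ i] finite_total_set] u
      by (metis (no_types, lifting) add.assoc add_diff_cancel_right' mem_Collect_eq)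
    then have "Poly_Mapping.single ?t c * set_monom (total_set P u - total_set P (del_gen i u)) =
        Poly_Mapping.single (a - set_expo (total_set P (del_gen i u))) c"
      by (simp add: set_monom_def mult_single t)
    then have "Poly_Mapping.single ?t c * ((-1) ^ i * set_monom (total_set P u - total_set P (del_gen i u))) =
        Poly_Mapping.single (a - set_expo (total_set P (del_gen i u))) (c * (-1) ^ i)"
      by (cases "even i") (simp_all add: single_uminus)
    then show ?thesis by (simp add: homogenize_single)
  qed
  then show "lin_ext (taylor_boundary P) (homogenize P a (Poly_Mapping.single u c)) =
      homogenize P a (lin_ext face_sum (Poly_Mapping.single u c))"
    by (simp add: homogenize_single taylor_boundary_def face_sum_def pm_scale_sum_right homogenize_sum)
qed (use assms in \<open>auto simp: homogenize_add lin_ext_add\<close>)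

lemma homogenize_in_taylor:
  assumes "\<And>u. u \<in> Poly_Mapping.keys w \<Longrightarrow> u \<in> ext_gens P \<and> length u = q \<and> total_set P u \<subseteq> Poly_Mapping.keys a"
    and a: "Poly_Mapping.keys a \<subseteq> {1..m}"
  shows "homogenize P a (w :: nat list \<Rightarrow>\<^sub>0 'k::comm_ring_1) \<in> gr (graded_free_module m (ext_gens P) (taylor_deg P)) (q, a)"
proof -
  have t: "a - set_expo (total_set P u) + set_expo (total_set P u) = a" if u: "u \<in> Poly_Mapping.keys w" for u
  proof -
    obtain t where "a = t + set_expo (total_set P u)"
      using assms(1)[OF u] set_expo_divides_iff[OF finite_total_set, of u a] by auto
    then show ?thesis by simp
  qed
  have "Poly_Mapping.lookup (homogenize P a w) u \<in> carrier (mpoly_ring m)" for u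
  proof (cases "u \<in> Poly_Mapping.keys w")
    case True
    have "Poly_Mapping.keys (a - set_expo (total_set P u)) \<subseteq> Poly_Mapping.keys a"
      using t[OF True] keys_expo_add by (metis Un_upper1)
    then show ?thesis using a unfolding lookup_homogenize by (intro mpoly_closed) blast
  qed (simp add: lookup_homogenize in_keys_iff mpoly_closed)
  then show ?thesis
    using assms(1) t by (auto simp: gr_graded_free_module keys_homogenize taylor_deg_def lookup_homogenize split: if_splits)
qed

lemma single_homogenize:
  assumes "u \<in> ext_gens P"
  shows "homogenize P (set_expo (total_set P u)) (Poly_Mapping.single u 1) = (Poly_Mapping.single u 1 :: nat list \<Rightarrow>\<^sub>0 'k::comm_ring_1 mpoly)"
  using homogenize_single[of P "set_expo (total_set P u)" u "1 :: 'k"] by simp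

text \<open>
  Since \<open>u\<close> is the homogenization of itself in its own multidegree, statements about the Taylor
  boundary reduce to statements about \<open>face_sum\<close>.
\<close>

lemma taylor_boundary_eq:
  assumes u: "u \<in> ext_gens P"
  shows "taylor_boundary P u = homogenize P (set_expo (total_set P u)) (face_sum u :: nat list \<Rightarrow>\<^sub>0 'k::comm_ring_1)"
proof -
  have "lin_ext (taylor_boundary P) (homogenize P (set_expo (total_set P u)) (Poly_Mapping.single u 1)) =
      homogenize P (set_expo (total_set P u)) (lin_ext face_sum (Poly_Mapping.single u (1 :: 'k)))"
    by (rule taylor_homogenize) (use u in \<open>auto simp: keys_set_expo finite_total_set\<close>)
  then show ?thesis by (simp add: single_homogenize[OF u])
qed

lemma keys_face_sum_ext_gens:
  assumes "u \<in> ext_gens P" "v \<in> Poly_Mapping.keys (face_sum u :: nat list \<Rightarrow>\<^sub>0 'k::comm_ring_1)"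
  shows "v \<in> ext_gens P" "total_set P v \<subseteq> total_set P u" "length u = Suc (length v)"
proof -
  obtain i where i: "i \<in> {1..length u}" "v = del_gen i u" using assms(2) by (rule keys_face_sum)
  show "v \<in> ext_gens P" "total_set P v \<subseteq> total_set P u" "length u = Suc (length v)"
    using del_gen_ext_gens[OF assms(1) i(1)] del_gen_props(1)[OF i(1)] i by auto
qed

lemma taylor_graded_free_resolution:
  "graded_free_resolution m (complement_ideal m P :: 'k::comm_ring_1 mpoly set) (ext_gens P) (taylor_deg P)
     (taylor_boundary P) (\<lambda>u. 1)"
proof -
  let ?I = "complement_ideal m P :: 'k mpoly set"
  let ?F = "graded_free_module m (ext_gens P) (taylor_deg P) :: ('k mpoly, _, _) graded_module"
  have Nil: "[] \<in> ext_gens P" "taylor_deg P [] = (0, 0)"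
    by (simp_all add: ext_gens_def taylor_deg_def total_set_def set_expo_def)
  have keys_a: "total_set P u \<subseteq> Poly_Mapping.keys (set_expo (total_set P u))"
    "Poly_Mapping.keys (set_expo (total_set P u)) \<subseteq> {1..m}" if "u \<in> ext_gens P" for u
    using that total_set_subset by (simp_all add: keys_set_expo finite_total_set)
  show ?thesis
  proof (rule graded_free_resolution.intro)
    show "ideal ?I (mpoly_ring m)" by (rule ideal_complement_ideal[OF P])
  next
    fix u q a assume u: "u \<in> ext_gens P" "taylor_deg P u = (Suc q, a)"
    then have a: "a = set_expo (total_set P u)" "length u = Suc q" by (auto simp: taylor_deg_def)
    show "taylor_boundary P u \<in> gr ?F (q, a)"
      unfolding taylor_boundary_eq[OF u(1)] a(1)
    proof (rule homogenize_in_taylor[OF _ keys_a(2)[OF u(1)]])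
      fix v assume "v \<in> Poly_Mapping.keys (face_sum u :: nat list \<Rightarrow>\<^sub>0 'k)"
      from keys_face_sum_ext_gens[OF u(1) this] keys_a(1)[OF u(1)] a(2)
      show "v \<in> ext_gens P \<and> length v = q \<and> total_set P v \<subseteq> Poly_Mapping.keys (set_expo (total_set P u))"
        by simp
    qed
  next
    fix u assume "u \<in> ext_gens P" "fst (taylor_deg P u) = 0"
    then show "taylor_boundary P u = (0 :: nat list \<Rightarrow>\<^sub>0 'k mpoly)"
      by (simp add: taylor_boundary_def taylor_deg_def)
  next
    fix u assume u: "u \<in> ext_gens P"
    have "lin_ext (taylor_boundary P) (taylor_boundary P u) =
        homogenize P (set_expo (total_set P u)) (lin_ext face_sum (face_sum u :: nat list \<Rightarrow>\<^sub>0 'k))"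
      unfolding taylor_boundary_eq[OF u]
      by (rule taylor_homogenize) (use keys_face_sum_ext_gens[OF u] keys_a[OF u] in blast)
    then show "lin_ext (taylor_boundary P) (taylor_boundary P u) = (0 :: nat list \<Rightarrow>\<^sub>0 'k mpoly)"
      by (simp add: face_sum_face_sum)
  next
    fix u a assume "u \<in> ext_gens P" "taylor_deg P u = (0, a)"
    then show "1 \<in> carrier (mpoly_ring m) \<and> Poly_Mapping.keys (1 :: 'k mpoly) \<subseteq> {a}"
      using Nil by (auto simp: taylor_deg_def mpoly_closed)
  next
    fix u a assume u: "u \<in> ext_gens P" "taylor_deg P u = (1, a)"
    then obtain i where i: "u = [i]" by (auto simp: taylor_deg_def length_Suc_conv)
    then have "P ! i \<in> set P" using u(1) by (auto simp: ext_gens_def)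
    then have "set_monom (P ! i) \<in> ?I" by (rule set_monom_in_complement_ideal[OF P])
    then show "augment (\<lambda>u. 1) (taylor_boundary P u :: nat list \<Rightarrow>\<^sub>0 'k mpoly) \<in> ?I"
      using ideal_mpoly_closed(5)[OF ideal_complement_ideal[OF P]]
      by (simp add: taylor_boundary_def i total_set_def del_gen_def)
  next
    fix z q a assume z: "z \<in> gr ?F (q, a)" and cycle: "if q = 0 then augment (\<lambda>u. 1) z \<in> ?I else lin_ext (taylor_boundary P) z = 0"
    show "z \<in> lin_ext (taylor_boundary P) ` gr ?F (Suc q, a)"
    proof (cases "z = 0")
      case True
      then show ?thesis using homogeneous_zero by (auto intro!: image_eqI[of _ _ 0])
    next
      case False
      have zu: "u \<in> ext_gens P" "length u = q" "Poly_Mapping.lookup z u \<in> carrier (mpoly_ring m)"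
          "\<And>t. t \<in> Poly_Mapping.keys (Poly_Mapping.lookup z u) \<Longrightarrow> t + set_expo (total_set P u) = a"
        if "u \<in> Poly_Mapping.keys z" for u
        using z that by (auto simp: gr_graded_free_module taylor_deg_def)
      \<comment> \<open>A nonzero \<open>z\<close> forces \<open>a\<close> to be an exponent in the variables \<open>1\<close> to \<open>m\<close>.\<close>
      obtain u0 where u0: "u0 \<in> Poly_Mapping.keys z" using False keys_eq_empty by blast
      then obtain t0 where t0: "t0 \<in> Poly_Mapping.keys (Poly_Mapping.lookup z u0)"
        by (metis all_not_in_conv in_keys_iff keys_eq_empty)
      have "Poly_Mapping.keys t0 \<subseteq> {1..m}" using zu(3)[OF u0] t0 by (simp add: mem_mpoly_ring)
      then have a: "Poly_Mapping.keys a \<subseteq> {1..m}"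
        using zu(4)[OF u0 t0] keys_a(2)[OF zu(1)[OF u0]] by (metis keys_expo_add le_sup_iff)
      \<comment> \<open>Dehomogenization: \<open>w\<close> collects the scalars in front of the basis of multidegree \<open>a\<close>.\<close>
      define w where "w = Poly_Mapping.mapp (\<lambda>u p. Poly_Mapping.lookup p (a - set_expo (total_set P u))) z"
      have lookup_w: "Poly_Mapping.lookup w u = Poly_Mapping.lookup (Poly_Mapping.lookup z u) (a - set_expo (total_set P u))" for u
        by (auto simp: w_def Poly_Mapping.lookup_mapp when_def in_keys_iff)
      have keys_w: "u \<in> Poly_Mapping.keys z \<and> total_set P u \<subseteq> Poly_Mapping.keys a" if "u \<in> Poly_Mapping.keys w" for u
      proof -
        have *: "a - set_expo (total_set P u) \<in> Poly_Mapping.keys (Poly_Mapping.lookup z u)"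
          using that by (simp add: in_keys_iff lookup_w)
        then have u: "u \<in> Poly_Mapping.keys z" by (auto simp: in_keys_iff[of u])
        from zu(4)[OF u *] show ?thesis
          using u set_expo_divides_iff[OF finite_total_set[OF zu(1)[OF u]], of a] by metis
      qed
      have zw: "homogenize P a w = z"
      proof (rule poly_mapping_eqI)
        fix u
        show "Poly_Mapping.lookup (homogenize P a w) u = Poly_Mapping.lookup z u"
        proof (cases "u \<in> Poly_Mapping.keys z")
          case True
          show ?thesis
          proof (rule poly_mapping_eqI)
            fix t
            show "Poly_Mapping.lookup (Poly_Mapping.lookup (homogenize P a w) u) t = Poly_Mapping.lookup (Poly_Mapping.lookup z u) t"
            proof (cases "t = a - set_expo (total_set P u)")
              case False
              then have "t + set_expo (total_set P u) \<noteq> a" by auto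
              then have "t \<notin> Poly_Mapping.keys (Poly_Mapping.lookup z u)" using zu(4)[OF True] by blast
              then show ?thesis using False by (simp add: lookup_homogenize lookup_single in_keys_iff)
            qed (simp add: lookup_homogenize lookup_w)
          qed
        qed (simp add: lookup_homogenize lookup_w in_keys_iff)
      qed
      \<comment> \<open>The vertices of the simplex whose chain complex is the component of multidegree \<open>a\<close>.\<close>
      define J where "J = {i. i < length P \<and> P ! i \<subseteq> Poly_Mapping.keys a}"
      have set_u: "set u \<subseteq> J" if "u \<in> ext_gens P" "total_set P u \<subseteq> Poly_Mapping.keys a" for u
        using that by (auto simp: J_def ext_gens_def total_set_def)
      have w_ext: "u \<in> ext_gens P" "length u = q" "total_set P u \<subseteq> Poly_Mapping.keys a" "set u \<subseteq> J"
        if "u \<in> Poly_Mapping.keys w" for u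
        using keys_w[OF that] zu set_u by auto
      have "J \<noteq> {}"
      proof
        assume J: "J = {}"
        have "u = []" if "u \<in> Poly_Mapping.keys z" for u
          using w_ext(4)[of u] that J by (simp add: zw[symmetric] keys_homogenize)
        then have z_Nil: "Poly_Mapping.keys z \<subseteq> {[]}" "q = 0" using zu(2)[OF u0] u0 by auto
        then have "Poly_Mapping.keys z = {[]}" using u0 by blast
        then have "augment (\<lambda>u. 1) z = Poly_Mapping.lookup z []" by (simp add: augment_def)
        then have "Poly_Mapping.lookup z [] \<in> ?I" using cycle z_Nil by simp
        moreover have "u0 = []" using u0 z_Nil by auto
        moreover have "t0 = a" using zu(4)[OF u0 t0] \<open>u0 = []\<close> by (simp add: total_set_def set_expo_def)
        ultimately obtain \<tau> where "\<tau> \<in> set P" "\<tau> \<subseteq> Poly_Mapping.keys a"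
          using keys_complement_ideal[OF P, of "Poly_Mapping.lookup z []" a] t0 by blast
        then show False using J by (auto simp: J_def in_set_conv_nth)
      qed
      define j where "j = Min J"
      have "finite J" by (simp add: J_def)
      then have j: "j \<in> J" "\<And>x. x \<in> J \<Longrightarrow> j \<le> x" using \<open>J \<noteq> {}\<close> by (auto simp: j_def)
      have "lin_ext face_sum w = 0"
      proof (cases "q = 0")
        case True
        then have "lin_ext face_sum w = lin_ext (\<lambda>u. 0) w" using w_ext(2)
          by (intro lin_ext_cong) (metis face_sum_Nil length_0_conv)
        then show ?thesis by (simp add: lin_ext_def)
      next
        case False
        have "homogenize P a (lin_ext face_sum w) = lin_ext (taylor_boundary P) (homogenize P a w)"
          by (rule taylor_homogenize[symmetric]) (use w_ext in blast)
        then show ?thesis using cycle False zw by (simp add: homogenize_eq_0_iff)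
      qed
      then have "lin_ext face_sum (lin_ext (cone j) w) =
          lin_ext face_sum (lin_ext (cone j) w) + lin_ext (cone j) (lin_ext face_sum w)" by simp
      also have "\<dots> = lin_ext (\<lambda>u. lin_ext face_sum (cone j u) + lin_ext (cone j) (face_sum u)) w"
        by (simp add: lin_ext_lin_ext lin_ext_fun_add)
      also have "\<dots> = lin_ext (\<lambda>u. Poly_Mapping.single u 1) w"
      proof (rule lin_ext_cong)
        fix u assume "u \<in> Poly_Mapping.keys w"
        then show "lin_ext face_sum (cone j u) + lin_ext (cone j) (face_sum u) = Poly_Mapping.single u (1 :: 'k)"
          using w_ext[of u] j(2) by (intro cone_homotopy) (auto simp: ext_gens_def)
      qed
      finally have hw: "lin_ext face_sum (lin_ext (cone j) w) = w" by (simp add: lin_ext_id)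
      have keys_hw: "v \<in> ext_gens P \<and> length v = Suc q \<and> total_set P v \<subseteq> Poly_Mapping.keys a"
        if "v \<in> Poly_Mapping.keys (lin_ext (cone j) w)" for v
      proof -
        have "v \<in> (\<Union>u\<in>Poly_Mapping.keys w. Poly_Mapping.keys (cone j u :: nat list \<Rightarrow>\<^sub>0 'k))"
          by (rule subsetD[OF keys_lin_ext that])
        then obtain u where u: "u \<in> Poly_Mapping.keys w" "v \<in> Poly_Mapping.keys (cone j u :: nat list \<Rightarrow>\<^sub>0 'k)"
          by blast
        then have v: "v = j # u" "\<not> (u \<noteq> [] \<and> hd u = j)" by (auto simp: cone_def split: if_splits)
        have "j < x" if "x \<in> set u" for x
        proof (cases u)
          case (Cons y ys)
          then have "j < y" using v(2) j(2)[of y] w_ext(4)[OF u(1)] by auto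
          then show ?thesis using that Cons w_ext(1)[OF u(1)] by (auto simp: ext_gens_def)
        qed (use that in simp)
        then show ?thesis
          using w_ext[OF u(1)] j(1) v(1) by (auto simp: ext_gens_def J_def total_set_def)
      qed
      have "lin_ext (taylor_boundary P) (homogenize P a (lin_ext (cone j) w)) = homogenize P a w"
        using taylor_homogenize[of "lin_ext (cone j) w" a] keys_hw hw by simp
      moreover have "homogenize P a (lin_ext (cone j) w) \<in> gr ?F (Suc q, a)"
        by (rule homogenize_in_taylor[OF _ a]) (use keys_hw in blast)
      ultimately show ?thesis using zw by (metis imageI)
    qed
  next
    fix p :: "'k mpoly" and a assume p: "p \<in> carrier (mpoly_ring m)" "Poly_Mapping.keys p \<subseteq> {a}"
    have "Poly_Mapping.single [] p \<in> gr ?F (0, a)"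
      using p Nil by (auto simp: gr_graded_free_module lookup_single when_def mpoly_closed split: if_splits)
    moreover have "augment (\<lambda>u. 1) (Poly_Mapping.single [] p :: nat list \<Rightarrow>\<^sub>0 _) - p \<in> ?I"
      using ideal_mpoly_closed(1)[OF ideal_complement_ideal[OF P]] by simp
    ultimately show "\<exists>z\<in>gr ?F (0, a). augment (\<lambda>u. 1) z - p \<in> ?I" by blast
  qed
qed

end

section \<open>The homology of a simplicial complement\<close>

lemma ext_module_simps [simp]:
  "carrier (ext_module P) = {f. Poly_Mapping.keys f \<subseteq> ext_gens P}"
  "add (ext_module P) = (+)"
  "ring.zero (ext_module P) = 0"
  "module.smult (ext_module P) = pm_scale"
  "gr (ext_module P) (q, \<sigma>) = {f. Poly_Mapping.keys f \<subseteq> {u \<in> ext_gens P. length u = q \<and> total_set P u = \<sigma>}}"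
  by (simp_all add: ext_module_def with_grading_def module.defs graded_module.defs carrier_free_base)

lemma quotient_module_cong:
  assumes "carrier M = carrier M'" "add M = add M'" "module.smult M = module.smult M'"
  shows "quotient_module M N = quotient_module M' N"
  using assms by (simp add: quotient_module_def A_RCOSETS_def' a_r_coset_def' set_add_def' fun_eq_iff)

text \<open>
  The differential of \<open>\<Lambda>[P]\<close> on generators, with the constant terms of the Taylor boundary as
  coefficients.
\<close>

definition ext_boundary :: "nat set list \<Rightarrow> nat list \<Rightarrow> (nat list \<Rightarrow>\<^sub>0 'k::comm_ring_1)" where
  "ext_boundary P u = const_part (taylor_boundary P u)"

context simplicial_complement
begin

lemma ext_boundary_eq:
  assumes u: "u \<in> ext_gens P"
  shows "ext_boundary P u = (\<Sum>i = 1..length u. Poly_Mapping.single (del_gen i u)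
            ((-1) ^ i * (if total_set P u = total_set P (del_gen i u) then 1 else 0 :: 'k::comm_ring_1)))"
  unfolding ext_boundary_def taylor_boundary_def const_part_sum
proof (rule sum.cong)
  fix i assume i: "i \<in> {1..length u}"
  let ?\<tau> = "total_set P u - total_set P (del_gen i u)"
  have fin: "finite ?\<tau>" using finite_total_set[OF u] by simp
  have sign: "Poly_Mapping.lookup ((-1) ^ i :: 'k mpoly) 0 = (-1) ^ i"
    by (cases "even i") simp_all
  have "set_expo ?\<tau> = 0 \<longleftrightarrow> ?\<tau> = {}"
    using keys_set_expo[OF fin] by (metis keys_eq_empty)
  also have "\<dots> \<longleftrightarrow> total_set P u = total_set P (del_gen i u)"
    using del_gen_ext_gens(2)[OF u i] by blast
  finally have "Poly_Mapping.lookup (set_monom ?\<tau> :: 'k mpoly) 0 =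
      (if total_set P u = total_set P (del_gen i u) then 1 else 0)"
    by (simp add: set_monom_def lookup_single when_def)
  then show "const_part (Poly_Mapping.single (del_gen i u) ((-1) ^ i * set_monom ?\<tau> :: 'k mpoly)) =
      Poly_Mapping.single (del_gen i u) ((-1) ^ i * (if total_set P u = total_set P (del_gen i u) then 1 else 0))"
    by (simp only: const_part_simps lookup_mult_zero sign)
qed simp

lemma keys_ext_boundary:
  assumes u: "u \<in> ext_gens P" and v: "v \<in> Poly_Mapping.keys (ext_boundary P u :: nat list \<Rightarrow>\<^sub>0 'k::comm_ring_1)"
  shows "v \<in> ext_gens P" "length u = Suc (length v)" "total_set P v = total_set P u"
proof -
  let ?f = "\<lambda>i. Poly_Mapping.single (del_gen i u)
            ((-1) ^ i * (if total_set P u = total_set P (del_gen i u) then 1 else 0 :: 'k))"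
  have "v \<in> (\<Union>i\<in>{1..length u}. Poly_Mapping.keys (?f i))"
    using v unfolding ext_boundary_eq[OF u] by (rule subsetD[OF keys_sum])
  then obtain i where i: "i \<in> {1..length u}" "v \<in> Poly_Mapping.keys (?f i)" by blast
  then have "v = del_gen i u" "total_set P u = total_set P (del_gen i u)"
    by (auto split: if_splits)
  then show "v \<in> ext_gens P" "length u = Suc (length v)" "total_set P v = total_set P u"
    using del_gen_ext_gens(1)[OF u i(1)] del_gen_props(1)[OF i(1)] i(1) by auto
qed

lemma ext_to_taylor_eq: "ext_to_taylor m P = base_tensor m (ext_gens P) (taylor_deg P)"
  by (simp add: ext_to_taylor_def base_tensor_def taylor_eq fun_eq_iff)

lemma taylor_boundary_closed:
  "u \<in> ext_gens P \<Longrightarrow> taylor_boundary P u \<in> carrier (free_module (mpoly_ring m :: 'k::comm_ring_1 mpoly ring) (ext_gens P))"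
  by (rule graded_free_resolution.boundary_closed[OF taylor_graded_free_resolution])

lemma taylor_deg_eq_iff:
  assumes "u \<in> ext_gens P" "\<sigma> \<subseteq> {1..m}"
  shows "taylor_deg P u = (q, set_expo \<sigma>) \<longleftrightarrow> length u = q \<and> total_set P u = \<sigma>"
proof -
  have "finite \<sigma>" using assms(2) finite_subset by blast
  then have "set_expo (total_set P u) = set_expo \<sigma> \<longleftrightarrow> total_set P u = \<sigma>"
    using keys_set_expo[OF finite_total_set[OF assms(1)]] keys_set_expo[of \<sigma>] by metis
  then show ?thesis by (simp add: taylor_deg_def)
qed

lemma gr_ext_module:
  assumes "\<sigma> \<subseteq> {1..m}"
  shows "gr (ext_module P) (q, \<sigma>) = gr (reduced_module (ext_gens P) (taylor_deg P)) (q, set_expo \<sigma>)"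
proof -
  have "{u \<in> ext_gens P. length u = q \<and> total_set P u = \<sigma>} = {u \<in> ext_gens P. taylor_deg P u = (q, set_expo \<sigma>)}"
    using taylor_deg_eq_iff[OF _ assms] by blast
  then show ?thesis by simp
qed

text \<open>
  The canonical map is an instance of \<open>base_tensor\<close>, so its properties are those of the
  identification of \<open>F \<otimes> k\<close> with a free \<open>k\<close>-module.
\<close>

lemma ext_to_taylor:
  shows ext_to_taylor_iso:
      "ext_to_taylor m P \<in> module_iso base_ring (ext_module P) (taylor_tensor m P :: ('k::comm_ring_1, _, _) graded_module)"
    and ext_to_taylor_gr: "\<sigma> \<subseteq> {1..m} \<Longrightarrow> ext_to_taylor m P ` gr (ext_module P) (q, \<sigma>)
      = gr (taylor_tensor m P :: ('k, _, _) graded_module) (q, set_expo \<sigma>)"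
    and taylor_tensor_diff_eq: "Poly_Mapping.keys f \<subseteq> ext_gens P \<Longrightarrow>
      taylor_tensor_diff m P (ext_to_taylor m P f) = ext_to_taylor m P (lin_ext (ext_boundary P) (f :: nat list \<Rightarrow>\<^sub>0 'k))"
proof -
  interpret free_tensor m "ext_gens P" "taylor_deg P" "taylor m P :: ('k mpoly, _, _) graded_module"
    "free_module (mpoly_ring m :: 'k mpoly ring) (carrier (free_module (mpoly_ring m :: 'k mpoly ring) (ext_gens P)) \<times> (UNIV :: 'k set))"
    "tensor_kernel (mpoly_ring m) (taylor m P) (base_module :: ('k mpoly, 'k, expo) graded_module)"
    by unfold_locales (simp_all add: taylor_eq)
  have "\<kappa> \<in> module_iso base_ring (ext_module P) (taylor_tensor m P :: ('k, _, _) graded_module)"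
    using base_tensor_iso by (simp add: module_iso_def mod_hom_def)
  then show "ext_to_taylor m P \<in> module_iso base_ring (ext_module P) (taylor_tensor m P :: ('k, _, _) graded_module)"
    by (simp only: ext_to_taylor_eq)
  show "ext_to_taylor m P ` gr (ext_module P) (q, \<sigma>)
      = gr (taylor_tensor m P :: ('k, _, _) graded_module) (q, set_expo \<sigma>)" if "\<sigma> \<subseteq> {1..m}"
    unfolding ext_to_taylor_eq gr_ext_module[OF that] restrict_scalars_simps gr_tensor ..
  show "taylor_tensor_diff m P (ext_to_taylor m P f) = ext_to_taylor m P (lin_ext (ext_boundary P) f)"
    if "Poly_Mapping.keys f \<subseteq> ext_gens P"
    unfolding ext_to_taylor_eq taylor_diff_eq ext_boundary_def[abs_def]
    by (rule tensor_map_base_tensor[OF taylor_boundary_closed that])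
qed

lemma keys_lin_ext_ext_boundary:
  assumes "Poly_Mapping.keys f \<subseteq> ext_gens P"
  shows "Poly_Mapping.keys (lin_ext (ext_boundary P) (f :: nat list \<Rightarrow>\<^sub>0 'k::comm_ring_1)) \<subseteq> ext_gens P"
  using keys_lin_ext[of "ext_boundary P" f] keys_ext_boundary(1) assms by blast

text \<open>
  The canonical map is injective, so the transported differential is determined by its image, which
  is given by constant terms.
\<close>

lemma ext_diff_eq:
  assumes f: "Poly_Mapping.keys f \<subseteq> ext_gens P"
  shows "ext_diff m P f = lin_ext (ext_boundary P) (f :: nat list \<Rightarrow>\<^sub>0 'k::comm_ring_1)"
proof -
  have "inj_on (ext_to_taylor m P) (carrier (ext_module P :: ('k, _, _) graded_module))"
    using ext_to_taylor_iso by (auto simp: module_iso_def bij_betw_def)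
  then show ?thesis
    unfolding ext_diff_def taylor_tensor_diff_eq[OF f]
    by (rule inv_into_f_f) (use keys_lin_ext_ext_boundary[OF f] in simp)
qed

lemma ext_diff_mod_hom: "ext_diff m P \<in> mod_hom base_ring (ext_module P) (ext_module P :: ('k::comm_ring_1, _, _) graded_module)"
proof -
  have "lin_ext (ext_boundary P) \<in> mod_hom base_ring (reduced_module (ext_gens P) (taylor_deg P) :: ('k, _, _) graded_module)
      (reduced_module (ext_gens P) (taylor_deg P))"
    using keys_ext_boundary(1) by (intro mod_hom_reduced_lin_ext) blast
  moreover have "Poly_Mapping.keys (x + y) \<subseteq> ext_gens P" "Poly_Mapping.keys (pm_scale r x) \<subseteq> ext_gens P"
    if "Poly_Mapping.keys x \<subseteq> ext_gens P" "Poly_Mapping.keys y \<subseteq> ext_gens P" for x y :: "nat list \<Rightarrow>\<^sub>0 'k" and r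
    using that Poly_Mapping.keys_add[of x y] keys_pm_scale[of r x] by blast+
  ultimately show ?thesis by (simp add: mod_hom_def ext_diff_eq Pi_iff)
qed

lemma ext_diff_gr:
  "ext_diff m P ` gr (ext_module P) (Suc q, \<sigma>) \<subseteq> gr (ext_module P :: ('k::comm_ring_1, _, _) graded_module) (q, \<sigma>)"
proof (intro image_subsetI)
  fix f :: "nat list \<Rightarrow>\<^sub>0 'k" assume "f \<in> gr (ext_module P) (Suc q, \<sigma>)"
  then have f: "Poly_Mapping.keys f \<subseteq> {u \<in> ext_gens P. length u = Suc q \<and> total_set P u = \<sigma>}" by simp
  have "v \<in> {u \<in> ext_gens P. length u = q \<and> total_set P u = \<sigma>}"
    if v: "v \<in> Poly_Mapping.keys (lin_ext (ext_boundary P) f)" for v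
  proof -
    have "v \<in> (\<Union>u\<in>Poly_Mapping.keys f. Poly_Mapping.keys (ext_boundary P u :: nat list \<Rightarrow>\<^sub>0 'k))"
      by (rule subsetD[OF keys_lin_ext v])
    then obtain u where u: "u \<in> Poly_Mapping.keys f" "v \<in> Poly_Mapping.keys (ext_boundary P u :: nat list \<Rightarrow>\<^sub>0 'k)" by blast
    then have "u \<in> ext_gens P" "length u = Suc q" "total_set P u = \<sigma>" using f by auto
    then show ?thesis using keys_ext_boundary[OF _ u(2)] by auto
  qed
  moreover have "ext_diff m P f = lin_ext (ext_boundary P) f" by (rule ext_diff_eq) (use f in blast)
  ultimately show "ext_diff m P f \<in> gr (ext_module P) (q, \<sigma>)" by auto
qed

text \<open>
  The two complexes differ only in the index of the grading, a subset of \<open>{1..m}\<close> or its exponent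
  vector, and such subsets are determined by their exponent vectors.
\<close>

lemma homology_ext_module:
  assumes "\<sigma> \<subseteq> {1..m}"
  shows "homology (ext_module P :: ('k::comm_ring_1, _, _) graded_module) (ext_diff m P) q \<sigma> =
    homology (reduced_module (ext_gens P) (taylor_deg P)) (lin_ext (ext_boundary P)) q (set_expo \<sigma>)"
proof -
  have eq: "ext_diff m P x = lin_ext (ext_boundary P) x"
    if "x \<in> gr (reduced_module (ext_gens P) (taylor_deg P)) d" for x :: "nat list \<Rightarrow>\<^sub>0 'k" and d
    by (rule ext_diff_eq) (use that in auto)
  have 1: "{x \<in> gr (ext_module P) (q, \<sigma>). ext_diff m P x = \<zero>\<^bsub>ext_module P\<^esub>} =
      {x \<in> gr (reduced_module (ext_gens P) (taylor_deg P)) (q, set_expo \<sigma>).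
        lin_ext (ext_boundary P) x = \<zero>\<^bsub>reduced_module (ext_gens P) (taylor_deg P) :: ('k, _, _) graded_module\<^esub>}"
    unfolding gr_ext_module[OF assms] using eq by (intro Collect_cong conj_cong refl) (simp only: ext_module_simps reduced_module_simps)
  have 2: "ext_diff m P ` gr (ext_module P) (Suc q, \<sigma>) =
      lin_ext (ext_boundary P) ` gr (reduced_module (ext_gens P) (taylor_deg P) :: ('k, _, _) graded_module) (Suc q, set_expo \<sigma>)"
    unfolding gr_ext_module[OF assms] using eq by (rule image_cong[OF refl])
  show ?thesis
    unfolding homology_def 1 2 by (rule quotient_module_cong) simp_all
qed

lemma homology_isomorphic_Tor:
  assumes "\<sigma> \<subseteq> {1..m}"
  shows "module_isomorphic base_ring
    (homology (ext_module P :: ('k::comm_ring_1, _, _) graded_module) (ext_diff m P) q \<sigma>)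
    (Tor m (quot_ring_module m (complement_ideal m P)) base_module q (set_expo \<sigma>))"
proof -
  let ?I = "complement_ideal m P :: 'k mpoly set"
  have std: "graded_free_resolution m ?I (std_basis m (quot_ring_module m ?I)) cell_deg cell_boundary (cell_rep m ?I)"
    by (rule std_graded_free_resolution[OF ideal_complement_ideal[OF P]])
  have "module_isomorphic base_ring
      (homology (reduced_module (ext_gens P) (taylor_deg P) :: ('k, _, _) graded_module) (lin_ext (\<lambda>u. const_part (taylor_boundary P u))) q (set_expo \<sigma>))
      (homology (reduced_module (std_basis m (quot_ring_module m ?I)) cell_deg) (lin_ext (\<lambda>c. const_part (cell_boundary c))) q (set_expo \<sigma>))"
    by (rule reduced_homology_isomorphic[OF taylor_graded_free_resolution std])
  from module_isomorphic_trans[OF this graded_free_resolution.tensor_complex[OF std]]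
  show ?thesis
    by (simp add: homology_ext_module[OF assms] ext_boundary_def[abs_def] Tor_def std_resolution_def std_diff_def[abs_def])
qed

end

theorem theorem2p7:
  fixes m :: nat and P :: "nat set list"
  assumes pid: "principal_domain (base_ring :: 'k::comm_ring_1 ring)"
    and P: "\<forall>\<tau>\<in>set P. \<tau> \<subseteq> {1..m}"
  shows
    "(face_ideal m (complement_complex m P) :: 'k mpoly set) = complement_ideal m P
     \<and> ext_to_taylor m P \<in> module_iso base_ring (ext_module P)
         (taylor_tensor m P :: ('k, _, _) graded_module)
     \<and> (\<forall>q \<sigma>. \<sigma> \<subseteq> {1..m} \<longrightarrow> ext_to_taylor m P ` gr (ext_module P) (q, \<sigma>)
         = gr (taylor_tensor m P :: ('k, _, _) graded_module) (q, set_expo \<sigma>))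
     \<and> (\<forall>f\<in>carrier (ext_module P :: ('k, _, _) graded_module).
         ext_to_taylor m P (ext_diff m P f) = taylor_tensor_diff m P (ext_to_taylor m P f))
     \<and> ext_diff m P \<in> mod_hom base_ring (ext_module P)
         (ext_module P :: ('k, _, _) graded_module)
     \<and> (\<forall>q \<sigma>. ext_diff m P ` gr (ext_module P) (Suc q, \<sigma>)
         \<subseteq> gr (ext_module P :: ('k, _, _) graded_module) (q, \<sigma>))
     \<and> (\<forall>u\<in>ext_gens P. ext_diff m P (Poly_Mapping.single u (1::'k)) =
         (\<Sum>i = 1..length u. Poly_Mapping.single (del_gen i u)
            ((-1) ^ i * (if total_set P u = total_set P (del_gen i u) then 1 else 0))))
     \<and> (\<forall>q \<sigma>. \<sigma> \<subseteq> {1..m} \<longrightarrow>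
         module_isomorphic base_ring
           (homology (ext_module P :: ('k, _, _) graded_module) (ext_diff m P) q \<sigma>)
           (Tor m (quot_ring_module m (complement_ideal m P)) base_module q (set_expo \<sigma>))
         \<and> module_isomorphic base_ring
           (Tor m (quot_ring_module m (complement_ideal m P)) base_module q (set_expo \<sigma>)
              :: ('k, _) module)
           (Tor m (face_ring m (complement_complex m P)) base_module q (set_expo \<sigma>)))"
proof -
  interpret simplicial_complement m P by unfold_locales (rule P)
  show ?thesis
  proof (intro conjI allI impI ballI)
    show "(face_ideal m (complement_complex m P) :: 'k mpoly set) = complement_ideal m P"
      by (rule face_ideal_complement_complex[OF P])
    show "ext_to_taylor m P \<in> module_iso base_ring (ext_module P) (taylor_tensor m P :: ('k, _, _) graded_module)"
      by (rule ext_to_taylor_iso)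
    show "ext_diff m P \<in> mod_hom base_ring (ext_module P) (ext_module P :: ('k, _, _) graded_module)"
      by (rule ext_diff_mod_hom)
  next
    fix q \<sigma> assume "\<sigma> \<subseteq> {1..m}"
    then show "ext_to_taylor m P ` gr (ext_module P) (q, \<sigma>)
         = gr (taylor_tensor m P :: ('k, _, _) graded_module) (q, set_expo \<sigma>)"
      by (rule ext_to_taylor_gr)
  next
    fix f assume "f \<in> carrier (ext_module P :: ('k, _, _) graded_module)"
    then have "Poly_Mapping.keys f \<subseteq> ext_gens P" by simp
    then show "ext_to_taylor m P (ext_diff m P f) = taylor_tensor_diff m P (ext_to_taylor m P f)"
      by (simp only: ext_diff_eq taylor_tensor_diff_eq)
  next
    fix q \<sigma>
    show "ext_diff m P ` gr (ext_module P) (Suc q, \<sigma>)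
         \<subseteq> gr (ext_module P :: ('k, _, _) graded_module) (q, \<sigma>)"
      by (rule ext_diff_gr)
  next
    fix u assume u: "u \<in> ext_gens P"
    then have "ext_diff m P (Poly_Mapping.single u (1 :: 'k)) = ext_boundary P u"
      by (simp add: ext_diff_eq)
    then show "ext_diff m P (Poly_Mapping.single u (1 :: 'k)) =
         (\<Sum>i = 1..length u. Poly_Mapping.single (del_gen i u)
            ((-1) ^ i * (if total_set P u = total_set P (del_gen i u) then 1 else 0)))"
      by (simp only: ext_boundary_eq[OF u])
  next
    fix q \<sigma> assume \<sigma>: "\<sigma> \<subseteq> {1..m}"
    show "module_isomorphic base_ring
           (homology (ext_module P :: ('k, _, _) graded_module) (ext_diff m P) q \<sigma>)
           (Tor m (quot_ring_module m (complement_ideal m P)) base_module q (set_expo \<sigma>))"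
      by (rule homology_isomorphic_Tor[OF \<sigma>])
    show "module_isomorphic base_ring
           (Tor m (quot_ring_module m (complement_ideal m P)) base_module q (set_expo \<sigma>) :: ('k, _) module)
           (Tor m (face_ring m (complement_complex m P)) base_module q (set_expo \<sigma>))"
      unfolding face_ideal_complement_complex[OF P] by (rule module_isomorphic_refl)
  qed
qed

end
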